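(* Let $G$ be an abelian-by-polycyclic group of type Bredon-$\mathrm{FP}_3$ with respect to the family of all virtually cyclic subgroups of $G$, such that for every element $g\in G$ of infinite order the centralizer $C_G(g)$ is finitely generated. Then $G$ is virtually cyclic.
   Context: $G$ is abelian-by-polycyclic if it has an abelian normal subgroup $A$ with $G/A$ polycyclic. A virtually cyclic group is one with a cyclic subgroup of finite index (finite groups are included). Let $\mathcal{VC}$ be the family of all virtually cyclic subgroups of $G$. The orbit category $\mathcal O_{\mathcal{VC}}G$ has as objects the transitive $G$-sets with stabilizers in $\mathcal{VC}$ and as morphisms the $G$-maps. An $\mathcal O_{\mathcal{VC}}G$-module is a contravariant functor from $\mathcal O_{\mathcal{VC}}G$ to abelian groups; exactness is defined pointwise. For a $G$-set $\Omega$ with stabilizers in $\mathcal{VC}$, $\mathbb Z[-,\Omega]$ is the $\mathcal O_{\mathcal{VC}}G$-module sending $\Delta$ to the free abelian group on the set of $G$-maps $\Delta\to\Omega$. A projective module is finitely generated if it is a direct summand of $\mathbb Z[-,\Omega]$ for some $\Omega$ with finitely many $G$-orbits and stabilizers in $\mathcal{VC}$. $G$ is of type Bredon-$\mathrm{FP}_n$ with respect to $\mathcal{VC}$ if the constant functor $\mathbb Z$ has a projective resolution $P_*$ over $\mathcal O_{\mathcal{VC}}G$ with $P_i$ finitely generated for all $i\le n$. *)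

theory Defs
  imports "HOL-Algebra.Multiplicative_Group" "HOL-Algebra.Group_Action" "HOL-Algebra.Free_Abelian_Groups"
begin

section \<open>Group theory\<close>

definition polycyclic :: "('a, 'b) monoid_scheme \<Rightarrow> bool" where
  "polycyclic G \<longleftrightarrow>
     (\<exists>(H :: nat \<Rightarrow> 'a set) n. H 0 = {\<one>\<^bsub>G\<^esub>} \<and> H n = carrier G \<and>
        (\<forall>i<n. subgroup (H (Suc i)) G \<and>
               H i \<lhd> G\<lparr>carrier := H (Suc i)\<rparr> \<and>
               cyclic_group (G\<lparr>carrier := H (Suc i)\<rparr> Mod H i)))"

definition abelian_by_polycyclic :: "('a, 'b) monoid_scheme \<Rightarrow> bool" where
  "abelian_by_polycyclic G \<longleftrightarrow>
     (\<exists>A. A \<lhd> G \<and> comm_group (G\<lparr>carrier := A\<rparr>) \<and> polycyclic (G Mod A))"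

definition virtually_cyclic :: "('a, 'b) monoid_scheme \<Rightarrow> bool" where
  "virtually_cyclic G \<longleftrightarrow>
     (\<exists>C. subgroup C G \<and> cyclic_group (G\<lparr>carrier := C\<rparr>) \<and> finite (rcosets\<^bsub>G\<^esub> C))"

definition vc_family :: "('a, 'b) monoid_scheme \<Rightarrow> 'a set set" where
  "vc_family G = {H. subgroup H G \<and> virtually_cyclic (G\<lparr>carrier := H\<rparr>)}"

definition fin_gen_group :: "('a, 'b) monoid_scheme \<Rightarrow> bool" where
  "fin_gen_group G \<longleftrightarrow> (\<exists>S. finite S \<and> S \<subseteq> carrier G \<and> generate G S = carrier G)"

definition centralizer :: "('a, 'b) monoid_scheme \<Rightarrow> 'a \<Rightarrow> 'a set" where
  "centralizer G g = {x \<in> carrier G. x \<otimes>\<^bsub>G\<^esub> g = g \<otimes>\<^bsub>G\<^esub> x}"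


section \<open>The orbit category\<close>

text \<open>A \<open>G\<close>-set is a carrier together with an action in the sense of \<^locale>\<open>group_action\<close>.
  \<open>F\<close> is a family of subgroups of \<open>G\<close>.\<close>

type_synonym ('a, 'x) gset = "'x set \<times> ('a \<Rightarrow> 'x \<Rightarrow> 'x)"

definition gset_over ::
    "('a, 'b) monoid_scheme \<Rightarrow> 'a set set \<Rightarrow> ('a, 'x) gset \<Rightarrow> bool" where
  "gset_over G F X \<longleftrightarrow>
     group_action G (fst X) (snd X) \<and> (\<forall>x \<in> fst X. stabilizer G (snd X) x \<in> F)"

text \<open>Underlying sets are taken inside the type \<^typ>\<open>'a set\<close>, which contains the set of cosets
  of every subgroup; so every transitive \<open>G\<close>-set is isomorphic to one considered here.
  \<^locale>\<open>transitive_action\<close> admits the empty set, which is not transitive.\<close>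

type_synonym 'a orb = "('a, 'a set) gset"

definition orb_objects :: "('a, 'b) monoid_scheme \<Rightarrow> 'a set set \<Rightarrow> 'a orb set" where
  "orb_objects G F =
     {X. gset_over G F X \<and> transitive_action G (fst X) (snd X) \<and> fst X \<noteq> {}}"

text \<open>Extensional functions, so that equality of \<open>G\<close>-maps is equality in HOL. Identities are
  \<open>\<lambda>x\<in>fst X. x\<close> and the composition of \<open>f : X \<rightarrow> Y\<close> and \<open>g : Y \<rightarrow> Z\<close>
  is \<open>compose (fst X) g f\<close>.\<close>

definition gmaps ::
    "('a, 'b) monoid_scheme \<Rightarrow> ('a, 'x) gset \<Rightarrow> ('a, 'y) gset \<Rightarrow> ('x \<Rightarrow> 'y) set" where
  "gmaps G X Y = {f \<in> fst X \<rightarrow>\<^sub>E fst Y.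
     \<forall>g \<in> carrier G. \<forall>x \<in> fst X. f (snd X g x) = snd Y g (f x)}"


section \<open>Modules over the orbit category\<close>

text \<open>\<open>Ob M X\<close> is the (multiplicatively written) abelian group at \<open>X\<close>, and \<open>Mor M X Y f\<close> is the
  map \<open>Ob M Y \<rightarrow> Ob M X\<close> induced by \<open>f : X \<rightarrow> Y\<close>.\<close>

record ('a, 'm) orb_module =
  Ob :: "'a orb \<Rightarrow> 'm monoid"
  Mor :: "'a orb \<Rightarrow> 'a orb \<Rightarrow> ('a set \<Rightarrow> 'a set) \<Rightarrow> 'm \<Rightarrow> 'm"

definition is_orb_module ::
    "('a, 'b) monoid_scheme \<Rightarrow> 'a set set \<Rightarrow> ('a, 'm) orb_module \<Rightarrow> bool" where
  "is_orb_module G F M \<longleftrightarrow>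
     (\<forall>X \<in> orb_objects G F. comm_group (Ob M X)) \<and>
     (\<forall>X \<in> orb_objects G F. \<forall>Y \<in> orb_objects G F. \<forall>f \<in> gmaps G X Y.
        Mor M X Y f \<in> hom (Ob M Y) (Ob M X)) \<and>
     (\<forall>X \<in> orb_objects G F. \<forall>a \<in> carrier (Ob M X). Mor M X X (\<lambda>x\<in>fst X. x) a = a) \<and>
     (\<forall>X \<in> orb_objects G F. \<forall>Y \<in> orb_objects G F. \<forall>Z \<in> orb_objects G F.
        \<forall>f \<in> gmaps G X Y. \<forall>g \<in> gmaps G Y Z. \<forall>a \<in> carrier (Ob M Z).
          Mor M X Z (compose (fst X) g f) a = Mor M X Y f (Mor M Y Z g a))"

definition orb_hom ::
    "('a, 'b) monoid_scheme \<Rightarrow> 'a set set \<Rightarrow> ('a, 'm) orb_module \<Rightarrow> ('a, 'n) orb_module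
       \<Rightarrow> ('a orb \<Rightarrow> 'm \<Rightarrow> 'n) set" where
  "orb_hom G F M N = {h.
     (\<forall>X \<in> orb_objects G F. h X \<in> hom (Ob M X) (Ob N X)) \<and>
     (\<forall>X \<in> orb_objects G F. \<forall>Y \<in> orb_objects G F. \<forall>f \<in> gmaps G X Y. \<forall>a \<in> carrier (Ob M Y).
        h X (Mor M X Y f a) = Mor N X Y f (h Y a))}"

definition orb_isomorphic ::
    "('a, 'b) monoid_scheme \<Rightarrow> 'a set set \<Rightarrow> ('a, 'm) orb_module \<Rightarrow> ('a, 'n) orb_module
       \<Rightarrow> bool" where
  "orb_isomorphic G F M N \<longleftrightarrow>
     (\<exists>h \<in> orb_hom G F M N. \<forall>X \<in> orb_objects G F. h X \<in> iso (Ob M X) (Ob N X))"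

definition orb_epi ::
    "('a, 'b) monoid_scheme \<Rightarrow> 'a set set \<Rightarrow> ('a, 'm) orb_module \<Rightarrow> ('a, 'n) orb_module
       \<Rightarrow> ('a orb \<Rightarrow> 'm \<Rightarrow> 'n) set" where
  "orb_epi G F M N =
     {h \<in> orb_hom G F M N. \<forall>X \<in> orb_objects G F. h X ` carrier (Ob M X) = carrier (Ob N X)}"

definition orb_dirsum ::
    "('a, 'm) orb_module \<Rightarrow> ('a, 'n) orb_module \<Rightarrow> ('a, 'm \<times> 'n) orb_module" where
  "orb_dirsum M N =
     \<lparr>Ob = (\<lambda>X. Ob M X \<times>\<times> Ob N X),
      Mor = (\<lambda>X Y f. map_prod (Mor M X Y f) (Mor N X Y f))\<rparr>"

text \<open>The constant functor \<open>\<int>\<close>.\<close>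

definition orb_const_int :: "('a, int) orb_module" where
  "orb_const_int = \<lparr>Ob = (\<lambda>X. integer_group), Mor = (\<lambda>X Y f a. a)\<rparr>"

text \<open>The module \<open>\<int>[-, W]\<close>.\<close>

definition orb_free ::
    "('a, 'b) monoid_scheme \<Rightarrow> ('a, 'w) gset \<Rightarrow> ('a, ('a set \<Rightarrow> 'w) \<Rightarrow>\<^sub>0 int) orb_module" where
  "orb_free G W =
     \<lparr>Ob = (\<lambda>X. free_Abelian_group (gmaps G X W)),
      Mor = (\<lambda>X Y f. frag_extend (\<lambda>h. frag_of (compose (fst X) h f)))\<rparr>"

text \<open>A complement of \<open>P\<close> in \<open>N\<close> embeds in \<open>N\<close>, so its elements may be taken in the type of those
  of \<open>N\<close>.\<close>

definition orb_summand ::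
    "('a, 'b) monoid_scheme \<Rightarrow> 'a set set \<Rightarrow> ('a, 'm) orb_module \<Rightarrow> ('a, 'n) orb_module
       \<Rightarrow> bool" where
  "orb_summand G F P N \<longleftrightarrow>
     (\<exists>Q :: ('a, 'n) orb_module. is_orb_module G F Q \<and> orb_isomorphic G F (orb_dirsum P Q) N)"

text \<open>Projectivity is the lifting property. HOL cannot quantify over all types inside a formula,
  so the test modules have their elements in the same type \<^typ>\<open>'m\<close> as \<open>P\<close>.\<close>

definition orb_projective ::
    "('a, 'b) monoid_scheme \<Rightarrow> 'a set set \<Rightarrow> ('a, 'm) orb_module \<Rightarrow> bool" where
  "orb_projective G F P \<longleftrightarrow> is_orb_module G F P \<and>
     (\<forall>(M :: ('a, 'm) orb_module) (N :: ('a, 'm) orb_module). \<forall>e \<in> orb_epi G F M N.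
        \<forall>f \<in> orb_hom G F P N. is_orb_module G F M \<longrightarrow> is_orb_module G F N \<longrightarrow>
          (\<exists>h \<in> orb_hom G F P M. \<forall>X \<in> orb_objects G F. \<forall>a \<in> carrier (Ob P X).
             e X (h X a) = f X a))"

text \<open>A \<open>G\<close>-set with finitely many orbits is a finite disjoint union of coset spaces, hence
  isomorphic to one inside the type \<^typ>\<open>nat \<times> 'a set\<close>.\<close>

definition orb_fg_projective ::
    "('a, 'b) monoid_scheme \<Rightarrow> 'a set set \<Rightarrow> ('a, 'm) orb_module \<Rightarrow> bool" where
  "orb_fg_projective G F P \<longleftrightarrow> orb_projective G F P \<and>
     (\<exists>W :: ('a, nat \<times> 'a set) gset. gset_over G F W \<and> finite (orbits G (fst W) (snd W)) \<and>
        orb_summand G F P (orb_free G W))"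

text \<open>Exactness of \<open>\<dots> \<rightarrow> P 1 \<rightarrow> P 0 \<rightarrow> \<int> \<rightarrow> 0\<close>, with \<open>d i : P (i+1) \<rightarrow> P i\<close> and augmentation \<open>\<epsilon>\<close>.\<close>

definition orb_resolution ::
    "('a, 'b) monoid_scheme \<Rightarrow> 'a set set \<Rightarrow> (nat \<Rightarrow> ('a, 'm) orb_module)
       \<Rightarrow> (nat \<Rightarrow> 'a orb \<Rightarrow> 'm \<Rightarrow> 'm) \<Rightarrow> ('a orb \<Rightarrow> 'm \<Rightarrow> int) \<Rightarrow> bool" where
  "orb_resolution G F P d \<epsilon> \<longleftrightarrow>
     (\<forall>i. d i \<in> orb_hom G F (P (Suc i)) (P i)) \<and>
     \<epsilon> \<in> orb_epi G F (P 0) orb_const_int \<and>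
     (\<forall>X \<in> orb_objects G F.
        d 0 X ` carrier (Ob (P 1) X) = kernel (Ob (P 0) X) integer_group (\<epsilon> X)) \<and>
     (\<forall>X \<in> orb_objects G F. \<forall>i.
        d (Suc i) X ` carrier (Ob (P (Suc (Suc i))) X)
          = kernel (Ob (P (Suc i)) X) (Ob (P i) X) (d i X))"

text \<open>The modules of a resolution have their elements in the type \<^typ>\<open>nat \<times> 'a + 'm\<close>, where
  \<^typ>\<open>'m\<close> is arbitrary, so that no bound is imposed on their size. The left summand makes
  the type infinite and at least as large as \<open>G\<close>. When every member of \<open>F\<close> is finitely generated
  (as for the virtually cyclic subgroups), the orbit category has, up to isomorphism, at most
  \<open>max \<aleph>\<^sub>0 |G|\<close> objects, and each object at most \<open>|G|\<close> points. Hence a module \<open>P\<close> with elements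
  in this type is a quotient of some \<open>\<int>[-, W]\<close> that is isomorphic to a module with elements in this
  type, so that \<^const>\<open>orb_projective\<close> is projectivity with respect to all modules.\<close>

type_synonym ('a, 'm) univ = "nat \<times> 'a + 'm"

definition bredon_FP ::
    "'m itself \<Rightarrow> ('a, 'b) monoid_scheme \<Rightarrow> 'a set set \<Rightarrow> nat \<Rightarrow> bool" where
  "bredon_FP (U :: 'm itself) G F n \<longleftrightarrow>
     (\<exists>(P :: nat \<Rightarrow> ('a, ('a, 'm) univ) orb_module) d \<epsilon>.
        (\<forall>i. orb_projective G F (P i)) \<and>
        (\<forall>i\<le>n. orb_fg_projective G F (P i)) \<and>
        orb_resolution G F P d \<epsilon>)"

end

theory Submission
  imports Defs "HOL-Algebra.Solvable_Groups" "HOL-Computational_Algebra.Polynomial"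
    "HOL-Computational_Algebra.Primes"
begin

text \<open>
  A group \<open>G\<close> as in the theorem is soluble, and every cyclic subgroup of \<open>G\<close> is conjugate into one of
  finitely many virtually cyclic subgroups. The second property comes from the augmentation
  \<open>P\<^sub>0 \<rightarrow> \<int>\<close>: it is surjective at the orbit \<open>G/\<langle>g\<rangle>\<close>, and \<open>P\<^sub>0\<close> is a summand of \<open>\<int>[-, W]\<close> with \<open>W\<close>
  consisting of finitely many orbits, so there is a \<open>G\<close>-map \<open>G/\<langle>g\<rangle> \<rightarrow> W\<close> and \<open>g\<close> fixes a point of \<open>W\<close>.
  The theorem therefore follows from a statement about soluble groups: with finitely many virtually
  cyclic subgroups that catch all cyclic subgroups up to conjugacy, they are virtually cyclic.

  The property passes to quotients, so one climbs up the derived series: the step is a group \<open>G\<close> with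
  an abelian normal subgroup \<open>A\<close> such that \<open>G/A\<close> is virtually cyclic, generated up to finite index by
  an element \<open>t\<close>. If some \<open>t\<^sup>k\<close>, \<open>k \<noteq> 0\<close>, lies in \<open>A\<close>, then \<open>A\<close> has finite index and is a finite union of
  cosets of cyclic groups, hence virtually cyclic by a pigeonhole argument. Otherwise \<open>A\<close> has to be
  finite. Write \<open>\<tau>\<close> for conjugation by \<open>t\<close> on \<open>A\<close>. The hypothesis has two consequences for the pair
  \<open>(A, \<tau>)\<close>, both by counting:
  \<^item> up to the action of \<open>\<tau>\<close>, finitely many cyclic subgroups of \<open>A\<close> contain the \<open>m\<close>-th powers of all
    elements of \<open>A\<close>, for a fixed \<open>m\<close> (the elements of \<open>A\<close> are caught);
  \<^item> the order of each element in \<open>A / (\<tau>\<^sup>n - 1) A\<close> is at most linear in \<open>n\<close> (the elements of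
    the coset \<open>A t\<^sup>n\<close> are caught, and each coset of a cyclic group meets \<open>A t\<^sup>n\<close> at most once).

  The torsion of \<open>A\<close> has bounded exponent \<open>E\<close>, so \<open>A\<^sup>E\<close> is torsion free. The claim is that \<open>A\<^sup>E\<close> is
  trivial. View it as a module over \<open>\<int>[X]\<close> with \<open>X\<close> acting as \<open>\<tau>\<close>. By the first property every element
  \<open>a\<close> is annihilated by a nonzero polynomial. If its minimal polynomial \<open>P\<close> had degree at least \<open>2\<close>,
  the elements \<open>(s - X) a\<close>, \<open>s \<in> \<int>\<close>, would span infinitely many lines modulo \<open>\<tau>\<close>: a prime \<open>p\<close> that
  divides \<open>P(s)\<close> and neither the leading nor the constant coefficient of \<open>P\<close> tells \<open>s - X\<close> from
  \<open>s' - X\<close> unless \<open>s \<equiv> s'\<close> modulo \<open>p\<close> (\<open>associated_linear_factors_congruent\<close>), and there are enough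
  such primes (\<open>separating_primes\<close>). Hence \<open>\<tau> a = (u/v) a\<close> for coprime integers \<open>u\<close>, \<open>v\<close>. By the first property
  \<open>a\<close> is divisible only by integers composed of primes of \<open>u v\<close>, up to a bounded factor. By the second one,
  some multiple \<open>e a\<close>, with \<open>e\<close> at most linear in \<open>n\<close>, is divisible by \<open>u\<^sup>n - v\<^sup>n\<close>, which is prime to \<open>u v\<close> and grows exponentially
  (\<open>linear_growth_imp_trivial\<close>). So \<open>A\<^sup>E\<close> is trivial and \<open>A\<close> is a torsion group that is a finite
  union of \<open>\<tau>\<close>-orbits; such a group is finite (\<open>finite_of_torsion_finitely_many_orbits\<close>).
\<close>

section \<open>Primes dividing the values of an integer polynomial\<close>

text \<open>Modulo \<open>p\<close> the degree of \<open>P\<close> does not drop, so a nonzero multiple of \<open>P\<close> modulo \<open>p\<close> cannot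
  agree with a polynomial of smaller degree: look at the last coefficient of \<open>H\<close> not divisible by \<open>p\<close>.\<close>
lemma const_dvd_cofactor:
  fixes D P H :: "int poly"
  assumes p: "prime p" and dv: "[:p:] dvd D - P * H"
    and deg: "degree D < degree P" and lc: "\<not> p dvd lead_coeff P"
  shows "[:p:] dvd H"
proof (rule ccontr)
  assume "\<not> [:p:] dvd H"
  then obtain i0 where i0: "\<not> p dvd coeff H i0"
    by (auto simp: const_poly_dvd_iff)
  define I where "I = {i. \<not> p dvd coeff H i}"
  have sub: "I \<subseteq> {..degree H}"
    unfolding I_def by (auto intro: le_degree)
  then have fin: "finite I" by (rule finite_subset) simp
  define h where "h = Max I"
  have hI: "h \<in> I" unfolding h_def using fin i0 by (intro Max_in) (auto simp: I_def)
  have above: "p dvd coeff H i" if "i > h" for i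
    using that Max_ge[OF fin, of i] unfolding h_def I_def by auto
  define r where "r = degree P"
  have "coeff (D - P * H) (r + h) = - (\<Sum>i\<le>r + h. coeff P i * coeff H (r + h - i))"
    using deg by (simp add: coeff_mult coeff_eq_0 r_def)
  also have "(\<Sum>i\<le>r + h. coeff P i * coeff H (r + h - i)) =
      coeff P r * coeff H h + (\<Sum>i\<in>{..r + h} - {r}. coeff P i * coeff H (r + h - i))"
    by (subst sum.remove[of _ r]) auto
  finally have eq: "coeff (D - P * H) (r + h) =
      - (coeff P r * coeff H h + (\<Sum>i\<in>{..r + h} - {r}. coeff P i * coeff H (r + h - i)))" .
  have "p dvd (\<Sum>i\<in>{..r + h} - {r}. coeff P i * coeff H (r + h - i))"
  proof (rule dvd_sum)
    fix i assume i: "i \<in> {..r + h} - {r}"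
    show "p dvd coeff P i * coeff H (r + h - i)"
    proof (cases "i < r")
      case True
      then show ?thesis using above[of "r + h - i"] by simp
    next
      case False
      then have "coeff P i = 0" using i by (auto simp: r_def coeff_eq_0)
      then show ?thesis by simp
    qed
  qed
  moreover have "p dvd coeff (D - P * H) (r + h)"
    using dv by (auto simp: const_poly_dvd_iff)
  ultimately have "p dvd coeff P r * coeff H h"
    unfolding eq dvd_minus_iff using dvd_add_left_iff by blast
  then show False
    using p lc hI by (auto simp: r_def I_def prime_dvd_mult_iff)
qed

text \<open>Modulo \<open>P\<close>, the linear polynomials \<open>s - X\<close> and \<open>s' - X\<close> agree up to a rational factor and a power of
  the unit \<open>X\<close>. Evaluation at the root \<open>s'\<close> of \<open>P\<close> modulo \<open>p\<close> kills \<open>s' - X\<close> but, unless \<open>s \<equiv> s'\<close>, not \<open>s - X\<close>, so the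
  rational factor has to account for a power of \<open>p\<close>; this is impossible because \<open>s' - X\<close> is not
  divisible by \<open>p\<close> modulo \<open>P\<close> when the degree of \<open>P\<close> exceeds \<open>1\<close>. The induction cancels common
  factors \<open>p\<close> of \<open>j\<close>, \<open>j'\<close> and \<open>H\<close>.\<close>
lemma associated_linear_factors_congruent:
  fixes P H :: "int poly" and s s' j j' p :: int
  assumes p: "prime p" and deg: "2 \<le> degree P" and lc: "\<not> p dvd lead_coeff P"
    and c0: "\<not> p dvd coeff P 0" and root: "p dvd poly P s'"
    and rel: "smult j' [:s', -1:] - smult j (monom 1 k * [:s, -1:]) = P * H"
    and nz: "j' \<noteq> 0"
  shows "p dvd s' - s"
  using rel nz
proof (induction "nat \<bar>j'\<bar>" arbitrary: j j' H rule: less_induct)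
  case less
  note rel = less.prems(1)
  have s'0: "\<not> p dvd s'"
  proof
    assume "p dvd s'"
    moreover obtain c Q where "P = pCons c Q" by (rule pCons_cases)
    ultimately show False using root c0 by (simp add: dvd_add_left_iff)
  qed
  have "poly (smult j' [:s', -1:] - smult j (monom 1 k * [:s, -1:])) s' = poly P s' * poly H s'"
    unfolding rel by simp
  then have "j * (s' ^ k * (s' - s)) = poly P s' * poly H s'"
    by (simp add: poly_monom algebra_simps)
  then have "p dvd j * (s' ^ k * (s' - s))" using root by simp
  then consider "p dvd s' - s" | "p dvd j"
    using p s'0 by (auto simp: prime_dvd_mult_iff dest: prime_dvd_power)
  then show ?case
  proof cases
    case 2
    have "smult j' [:s', -1:] - P * H = smult j (monom 1 k * [:s, -1:])"
      using rel by (simp add: algebra_simps)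
    moreover have "[:p:] dvd smult j (monom 1 k * [:s, -1:])"
      using 2 by (auto simp: const_poly_dvd_iff)
    ultimately have "[:p:] dvd smult j' [:s', -1:] - P * H" by simp
    moreover have "degree (smult j' [:s', -1:]) < degree P" using deg by auto
    ultimately have pH: "[:p:] dvd H" using const_dvd_cofactor[OF p _ _ lc] by blast
    then obtain H' where H': "H = smult p H'" by (auto elim: dvdE)
    have "[:p:] dvd P * H" using pH by simp
    then have "[:p:] dvd (smult j' [:s', -1:] - P * H) + P * H"
      using \<open>[:p:] dvd smult j' [:s', -1:] - P * H\<close> by (rule dvd_add[rotated])
    then have "p dvd coeff (smult j' [:s', -1:]) 1"
      by (simp only: diff_add_cancel const_poly_dvd_iff)
    then have "p dvd j'" by simp
    then obtain i' where i': "j' = p * i'" by (auto elim: dvdE)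
    obtain i where i: "j = p * i" using 2 by (auto elim: dvdE)
    have "smult p (smult i' [:s', -1:] - smult i (monom 1 k * [:s, -1:])) = smult p (P * H')"
      using rel by (simp only: i i' H' smult_diff_right smult_smult mult_smult_right)
    then have "smult i' [:s', -1:] - smult i (monom 1 k * [:s, -1:]) = P * H'"
      (is "?L = ?R")
    proof -
      assume "smult p ?L = smult p ?R"
      then have "smult p (?L - ?R) = 0" by (simp only: smult_diff_right diff_self)
      moreover have "p \<noteq> 0" using p by auto
      ultimately show "?L = ?R" by (simp only: smult_eq_0_iff) simp
    qed
    moreover have "nat \<bar>i'\<bar> < nat \<bar>j'\<bar>"
      using less.prems(2) prime_gt_1_int[OF p] unfolding i' by (auto simp: abs_mult)
    moreover have "i' \<noteq> 0" using less.prems(2) i' by auto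
    ultimately show ?thesis using less.hyps by blast
  qed
qed

lemma dvd_poly_diff: "(x - y :: int) dvd poly P x - poly P y"
proof (induction P)
  case (pCons a P)
  have "poly (pCons a P) x - poly (pCons a P) y = x * (poly P x - poly P y) + (x - y) * poly P y"
    by (simp add: algebra_simps)
  then show ?case using pCons by simp
qed simp

text \<open>Pairs \<open>(s, p)\<close> with \<open>p\<close> dividing \<open>P(s)\<close> are chosen one after the other. With \<open>c = P(0)\<close> and \<open>M\<close>
  collecting everything chosen before, a multiple \<open>s\<close> of \<open>c M\<close> gives \<open>P(s) = c (1 + M y)\<close>, whose
  second factor has only primes that do not divide \<open>M\<close>.\<close>
lemma separating_primes:
  fixes P :: "int poly"
  assumes deg: "0 < degree P" and c0: "coeff P 0 \<noteq> 0"
  shows "\<exists>S :: (int \<times> int) set. finite S \<and> card S = n \<and>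
    (\<forall>x\<in>S. prime (snd x) \<and> \<not> snd x dvd coeff P 0 \<and> \<not> snd x dvd lead_coeff P \<and>
        snd x dvd poly P (fst x) \<and> poly P (fst x) \<noteq> 0) \<and>
    (\<forall>x\<in>S. \<forall>y\<in>S. x \<noteq> y \<longrightarrow> \<not> snd x dvd fst x - fst y)"
proof (induction n)
  case 0
  show ?case by (intro exI[of _ "{}"]) auto
next
  case (Suc n)
  then obtain S :: "(int \<times> int) set" where S: "finite S" "card S = n"
    and good: "\<And>x. x \<in> S \<Longrightarrow> prime (snd x) \<and> \<not> snd x dvd coeff P 0 \<and> \<not> snd x dvd lead_coeff P \<and>
        snd x dvd poly P (fst x) \<and> poly P (fst x) \<noteq> 0"
    and sep: "\<And>x y. x \<in> S \<Longrightarrow> y \<in> S \<Longrightarrow> x \<noteq> y \<Longrightarrow> \<not> snd x dvd fst x - fst y"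
    by blast
  define c where "c = coeff P 0"
  \<comment> \<open>\<open>M\<close> contains the primes used so far and the values \<open>P(s)\<close>; the latter keep the new prime from
      dividing \<open>s - s'\<close> for an earlier \<open>s'\<close>.\<close>
  define M where "M = c * lead_coeff P * (\<Prod>x\<in>S. snd x * poly P (fst x))"
  have M0: "M \<noteq> 0"
    unfolding M_def c_def using c0 deg S(1) by (auto dest: good)
  have cM: "c dvd M" "lead_coeff P dvd M" unfolding M_def by auto
  have SM: "snd x dvd M \<and> poly P (fst x) dvd M" if "x \<in> S" for x
  proof -
    have "snd x * poly P (fst x) dvd M"
      unfolding M_def using that S(1) by (intro dvd_mult dvd_prodI)
    then show ?thesis by (meson dvd_mult_left dvd_mult_right)
  qed
  obtain Q where Q: "P = pCons c Q" unfolding c_def by (metis pCons_cases coeff_pCons_0)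
  have fin: "finite {y. poly P y = b}" for b
  proof -
    have "P - [:b:] \<noteq> 0" using deg by (metis degree_pCons_0 eq_iff_diff_eq_0 less_irrefl)
    then have "finite {y. poly (P - [:b:]) y = 0}" by (rule poly_roots_finite)
    then show ?thesis by simp
  qed
  define B where "B = {y. poly P y = c} \<union> {y. poly P y = 0} \<union> {y. poly P y = - c}"
  have "finite B" using fin unfolding B_def by blast
  moreover have "infinite (range (\<lambda>x::int. c * M * x))"
  proof
    assume "finite (range (\<lambda>x::int. c * M * x))"
    moreover have "inj (\<lambda>x::int. c * M * x)"
      using M0 c0 unfolding c_def by (intro injI) simp
    ultimately have "finite (UNIV :: int set)" by (rule finite_imageD)
    then show False using infinite_UNIV_int by blast
  qed
  ultimately have "infinite (range (\<lambda>x::int. c * M * x) - B)" by (rule Diff_infinite_finite)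
  then obtain s where "s \<in> range (\<lambda>x::int. c * M * x) - B" by (metis ex_in_conv finite.emptyI)
  then have s: "s \<in> range (\<lambda>x::int. c * M * x)"
    "poly P s \<noteq> c" "poly P s \<noteq> 0" "poly P s \<noteq> - c" unfolding B_def by auto
  then obtain x where x: "s = c * M * x" by blast
  define q where "q = 1 + M * (x * poly Q s)"
  have Ps: "poly P s = c * q" unfolding Q q_def by (simp add: x algebra_simps)
  have "q \<noteq> 0" "\<not> is_unit q" using s Ps by (auto simp: zdvd1_eq abs_if split: if_splits)
  then obtain p where p: "prime p" "p dvd q" using prime_divisor_exists by blast
  have pM: "\<not> p dvd M"
  proof
    assume "p dvd M"
    then have "p dvd 1" using p(2) unfolding q_def by (metis dvd_add_left_iff dvd_mult2)
    then show False using p(1) by auto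
  qed
  have pc: "\<not> p dvd c" "\<not> p dvd lead_coeff P" using pM cM dvd_trans by blast+
  have Ms: "M dvd s" unfolding x by simp
  have new_old: "\<not> p dvd s - fst y" if y: "y \<in> S" for y
  proof
    assume "p dvd s - fst y"
    then have "p dvd poly P s - poly P (fst y)" using dvd_poly_diff dvd_trans by blast
    moreover have "p dvd poly P s" using p(2) Ps by simp
    ultimately have "p dvd poly P (fst y)" by (metis dvd_diff_right_iff dvd_diff_commute)
    then show False using SM[OF y] pM dvd_trans by blast
  qed
  have old_new: "\<not> snd y dvd fst y - s" if y: "y \<in> S" for y
  proof
    assume "snd y dvd fst y - s"
    moreover have "snd y dvd s" using SM[OF y] Ms dvd_trans by blast
    ultimately have "snd y dvd fst y" by (metis dvd_diff_right_iff dvd_diff_commute dvd_minus_iff minus_diff_eq)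
    then have "snd y dvd c"
      using good[OF y] unfolding Q by (auto simp: dvd_add_left_iff)
    then show False using good[OF y] c_def by simp
  qed
  have notin: "(s, p) \<notin> S" using new_old[of "(s, p)"] by auto
  have new: "prime p \<and> \<not> p dvd coeff P 0 \<and> \<not> p dvd lead_coeff P \<and> p dvd poly P s \<and> poly P s \<noteq> 0"
    using p pc s(3) unfolding Ps c_def by simp
  show ?case
  proof (intro exI[of _ "insert (s, p) S"] conjI ballI impI)
    show "finite (insert (s, p) S)" "card (insert (s, p) S) = Suc n" using S notin by auto
  next
    fix x y assume "x \<in> insert (s, p) S" "y \<in> insert (s, p) S" "x \<noteq> y"
    then consider "x = (s, p)" "y \<in> S" | "x \<in> S" "y = (s, p)" | "x \<in> S" "y \<in> S" by blast
    then show "\<not> snd x dvd fst x - fst y"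
      using sep[of x y] new_old[of y] old_new[of x] \<open>x \<noteq> y\<close> by cases simp_all
  next
    fix x assume "x \<in> insert (s, p) S"
    then have "prime (snd x) \<and> \<not> snd x dvd coeff P 0 \<and> \<not> snd x dvd lead_coeff P \<and>
        snd x dvd poly P (fst x) \<and> poly P (fst x) \<noteq> 0"
      using good[of x] new by (metis fst_conv insertE snd_conv)
    then show "prime (snd x)" "\<not> snd x dvd coeff P 0" "\<not> snd x dvd lead_coeff P"
      "snd x dvd poly P (fst x)" "poly P (fst x) \<noteq> 0" by blast+
  qed
qed

section \<open>Abelian groups with an injective endomorphism\<close>

locale abelian_endo = comm_group A for A (structure) +
  fixes \<tau> :: "'a \<Rightarrow> 'a"
  assumes endo: "\<tau> \<in> hom A A" and inj: "inj_on \<tau> (carrier A)"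
begin

sublocale \<tau>: group_hom A A \<tau>
  by unfold_locales (rule endo)

lemma funpow_closed [simp]: "a \<in> carrier A \<Longrightarrow> (\<tau> ^^ n) a \<in> carrier A"
  by (induction n) auto

lemma funpow_mult:
  "a \<in> carrier A \<Longrightarrow> b \<in> carrier A \<Longrightarrow> (\<tau> ^^ n) (a \<otimes> b) = (\<tau> ^^ n) a \<otimes> (\<tau> ^^ n) b"
  by (induction n) auto

lemma hom_funpow: "\<tau> ^^ n \<in> hom A A"
  by (auto simp: hom_def funpow_mult)

lemma funpow_int_pow: "a \<in> carrier A \<Longrightarrow> (\<tau> ^^ n) (a [^] (j::int)) = (\<tau> ^^ n) a [^] j"
  by (rule hom_int_pow[OF hom_funpow]) (auto intro: is_group)

lemma inj_funpow:
  assumes "a \<in> carrier A" "b \<in> carrier A" "(\<tau> ^^ n) a = (\<tau> ^^ n) b"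
  shows "a = b"
  using assms
proof (induction n)
  case (Suc n)
  have "(\<tau> ^^ n) a = (\<tau> ^^ n) b"
    using inj_onD[OF inj, of "(\<tau> ^^ n) a" "(\<tau> ^^ n) b"] Suc.prems by simp
  then show ?case using Suc by blast
qed simp

lemma funpow_commute_add: "(\<tau> ^^ m) ((\<tau> ^^ n) a) = (\<tau> ^^ (m + n)) a"
  by (simp add: funpow_add)

text \<open>This makes the group a module over \<open>\<int>[X]\<close>, with \<open>X\<close> acting as \<open>\<tau>\<close>.\<close>
definition act :: "int poly \<Rightarrow> 'a \<Rightarrow> 'a" where
  "act P a = fold_coeffs (\<lambda>c b. a [^] c \<otimes> \<tau> b) P \<one>"

lemma act_0 [simp]: "act 0 a = \<one>"
  by (simp add: act_def)

lemma act_pCons: "a \<in> carrier A \<Longrightarrow> act (pCons c P) a = a [^] c \<otimes> \<tau> (act P a)"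
  by (cases "c = 0 \<and> P = 0") (auto simp: act_def)

lemma act_closed [simp]: "a \<in> carrier A \<Longrightarrow> act P a \<in> carrier A"
  by (induction P) (auto simp: act_pCons)

lemma act_add: "a \<in> carrier A \<Longrightarrow> act (P + Q) a = act P a \<otimes> act Q a"
  by (induction P Q rule: poly_induct2) (auto simp: act_pCons int_pow_mult m_ac)

lemma act_smult: "a \<in> carrier A \<Longrightarrow> act (smult c P) a = act P a [^] c"
  by (induction P)
    (auto simp: act_pCons int_pow_distrib \<tau>.hom_int_pow int_pow_pow mult.commute)

lemma act_diff: "a \<in> carrier A \<Longrightarrow> act (P - Q) a = act P a \<otimes> inv (act Q a)"
  using act_add[of a P "smult (-1) Q"] act_smult[of a "-1" Q]
  by (simp add: int_pow_neg)

lemma act_mult: "a \<in> carrier A \<Longrightarrow> act (P * Q) a = act P (act Q a)"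
  by (induction P) (auto simp: act_pCons act_add act_smult)

lemma act_monom: "a \<in> carrier A \<Longrightarrow> act (monom 1 k) a = (\<tau> ^^ k) a"
  by (induction k) (auto simp: monom_0 monom_Suc act_pCons)

lemma act_const: "a \<in> carrier A \<Longrightarrow> act [:c:] a = a [^] c"
  by (simp add: act_pCons)

lemma act_linear: "a \<in> carrier A \<Longrightarrow> act [:u, v:] a = a [^] u \<otimes> \<tau> a [^] v"
  by (simp add: act_pCons \<tau>.hom_int_pow)

end

section \<open>Torsion groups with finitely many orbits\<close>

context abelian_endo
begin

lemma finite_cyclic_range:
  assumes "y \<in> carrier A" "y [^] (e::int) = \<one>" "e > 0"
  shows "finite (range (\<lambda>j::int. y [^] j))"
proof -
  have "y [^] j \<in> (\<lambda>j. y [^] j) ` {0..<e}" for j :: int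
  proof -
    have "y [^] j = y [^] (e * (j div e)) \<otimes> y [^] (j mod e)"
      using assms by (simp flip: int_pow_mult)
    also have "y [^] (e * (j div e)) = \<one>"
      using assms by (simp flip: int_pow_pow)
    finally show ?thesis using assms by auto
  qed
  then show ?thesis by (metis finite_atLeastLessThan_int finite_imageI finite_subset image_subsetI)
qed

text \<open>The subgroup generated by \<open>a, \<tau> a, \<dots>, \<tau>\<^bsup>n-1\<^esup> a\<close>, built up one generator at a time so that its
  finiteness for torsion elements is an immediate induction.\<close>
fun span :: "'a \<Rightarrow> nat \<Rightarrow> 'a set" where
  "span a 0 = {\<one>}"
| "span a (Suc n) = (\<lambda>(x, y). x \<otimes> y) ` (span a n \<times> range (\<lambda>j::int. (\<tau> ^^ n) a [^] j))"

lemma span_SucI: "x \<in> span a n \<Longrightarrow> x \<otimes> (\<tau> ^^ n) a [^] (j::int) \<in> span a (Suc n)"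
  by force

lemma span_SucE:
  assumes "x \<in> span a (Suc n)"
  obtains y j where "y \<in> span a n" "x = y \<otimes> (\<tau> ^^ n) a [^] (j::int)"
  using assms by auto

declare span.simps(2) [simp del]

lemma subgroup_span: "a \<in> carrier A \<Longrightarrow> subgroup (span a n) A"
proof (induction n)
  case 0
  show ?case by (simp add: triv_subgroup)
next
  case (Suc n)
  interpret S: subgroup "span a n" A using Suc by simp
  have y: "(\<tau> ^^ n) a \<in> carrier A" using Suc by simp
  show ?case
  proof (unfold_locales, goal_cases)
    case 1
    show ?case using y S.subset by (auto elim!: span_SucE)
  next
    case (2 x z)
    then obtain x1 j x2 i where "x1 \<in> span a n" "x2 \<in> span a n"
      and e: "x = x1 \<otimes> (\<tau> ^^ n) a [^] (j::int)" "z = x2 \<otimes> (\<tau> ^^ n) a [^] (i::int)"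
      by (metis span_SucE)
    moreover from this have "x1 \<in> carrier A" "x2 \<in> carrier A" using S.subset by auto
    then have "x \<otimes> z = (x1 \<otimes> x2) \<otimes> (\<tau> ^^ n) a [^] (j + i)"
      unfolding e using y by (simp add: int_pow_mult m_ac)
    ultimately show ?case using span_SucI S.m_closed by metis
  next
    case 3
    show ?case using span_SucI[OF S.one_closed, of 0] by simp
  next
    case (4 x)
    then obtain x1 j where "x1 \<in> span a n"
      and e: "x = x1 \<otimes> (\<tau> ^^ n) a [^] (j::int)" by (metis span_SucE)
    moreover from this have "x1 \<in> carrier A" using S.subset by auto
    then have "inv x = inv x1 \<otimes> (\<tau> ^^ n) a [^] (- j)"
      unfolding e using y by (simp add: int_pow_neg inv_mult)
    ultimately show ?case using span_SucI S.m_inv_closed by metis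
  qed
qed

lemma span_mono_Suc: "a \<in> carrier A \<Longrightarrow> span a n \<subseteq> span a (Suc n)"
proof
  fix x assume a: "a \<in> carrier A" and "x \<in> span a n"
  moreover from this have "x = x \<otimes> (\<tau> ^^ n) a [^] (0::int)"
    using subgroup.subset[OF subgroup_span[of a n]] by (auto simp: subset_iff)
  ultimately show "x \<in> span a (Suc n)" using span_SucI by metis
qed

lemma span_mono: "a \<in> carrier A \<Longrightarrow> m \<le> n \<Longrightarrow> span a m \<subseteq> span a n"
  using lift_Suc_mono_le[of "span a" m n] span_mono_Suc by blast

lemma funpow_in_span: "a \<in> carrier A \<Longrightarrow> i < n \<Longrightarrow> (\<tau> ^^ i) a \<in> span a n"
proof -
  assume a: "a \<in> carrier A" and "i < n"
  have "(\<tau> ^^ i) a = \<one> \<otimes> (\<tau> ^^ i) a [^] (1::int)" using a by simp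
  then have "(\<tau> ^^ i) a \<in> span a (Suc i)"
    using span_SucI subgroup.one_closed[OF subgroup_span[OF a, of i]] by metis
  then show ?thesis using span_mono[OF a, of "Suc i" n] \<open>i < n\<close> by (meson Suc_leI subsetD)
qed

lemma finite_span:
  assumes "a \<in> carrier A" "a [^] (e::int) = \<one>" "e > 0"
  shows "finite (span a n)"
proof (induction n)
  case (Suc n)
  have "(\<tau> ^^ n) a [^] e = (\<tau> ^^ n) \<one>" using assms by (simp flip: funpow_int_pow)
  also have "\<dots> = \<one>" using hom_one[OF hom_funpow] by (simp add: is_group)
  finally show ?case
    using Suc assms finite_cyclic_range[of "(\<tau> ^^ n) a" e] by (simp add: span.simps(2))
qed simp

lemma \<tau>_span: "a \<in> carrier A \<Longrightarrow> x \<in> span a n \<Longrightarrow> \<tau> x \<in> span a (Suc n)"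
proof (induction n arbitrary: x)
  case 0
  then show ?case using subgroup.one_closed[OF subgroup_span] by simp
next
  case (Suc n)
  then obtain x1 j where x1: "x1 \<in> span a n"
    and e: "x = x1 \<otimes> (\<tau> ^^ n) a [^] (j::int)" by (metis span_SucE)
  then have "x1 \<in> carrier A" using Suc subgroup.subset[OF subgroup_span] by blast
  then have "\<tau> x = \<tau> x1 \<otimes> (\<tau> ^^ Suc n) a [^] j"
    unfolding e using Suc by (simp add: \<tau>.hom_int_pow)
  moreover have "\<tau> x1 \<in> span a (Suc n)" using Suc x1 by blast
  ultimately show ?case using span_SucI by metis
qed

text \<open>If \<open>\<tau>\<^sup>N a\<close> is a combination of the earlier iterates, these span a \<open>\<tau>\<close>-invariant subgroup.\<close>
lemma finite_forward_orbit:
  assumes a: "a \<in> carrier A" "a [^] (e::int) = \<one>" "e > 0" and N: "(\<tau> ^^ N) a \<in> span a N"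
    and N0: "0 < N"
  shows "finite (range (\<lambda>n. (\<tau> ^^ n) a))"
proof -
  interpret S: subgroup "span a N" A using a subgroup_span by simp
  have stab: "\<tau> x \<in> span a N" if "x \<in> span a N" for x
  proof -
    have "\<tau> x \<in> span a (Suc N)" using \<tau>_span a that by blast
    then obtain x1 j where x1: "x1 \<in> span a N"
      and e: "\<tau> x = x1 \<otimes> (\<tau> ^^ N) a [^] (j::int)" by (metis span_SucE)
    have "(\<tau> ^^ N) a [^] j \<in> span a N"
      using subgroup_int_pow_closed[OF S.subgroup_axioms N] .
    then show ?thesis using x1 e by simp
  qed
  have "(\<tau> ^^ n) a \<in> span a N" for n
  proof (induction n)
    case 0
    show ?case using funpow_in_span[of a 0 N] a N0 by simp
  qed (use stab in auto)
  then show ?thesis using finite_span[OF a] by (meson finite_subset image_subsetI)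
qed

lemma finite_forward_orbit_imp_periodic:
  assumes a: "a \<in> carrier A" and fin: "finite (range (\<lambda>n. (\<tau> ^^ n) a))"
  shows "\<exists>r>0. (\<tau> ^^ r) a = a"
proof -
  have "\<not> inj (\<lambda>n. (\<tau> ^^ n) a)" using fin finite_imageD by fastforce
  then obtain m n where mn: "(\<tau> ^^ m) a = (\<tau> ^^ n) a" "m < n"
    by (auto simp: inj_on_def) (metis linorder_less_linear)
  then have "(\<tau> ^^ m) a = (\<tau> ^^ m) ((\<tau> ^^ (n - m)) a)" by (simp add: funpow_commute_add)
  then have "a = (\<tau> ^^ (n - m)) a" using inj_funpow a by simp
  then show ?thesis using mn by (intro exI[of _ "n - m"]) auto
qed

lemma pigeonhole_same_orbit:
  assumes x: "\<And>i. x i \<in> carrier A" and C: "finite C" "C \<subseteq> carrier A"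
    and cov: "\<And>a. a \<in> carrier A \<Longrightarrow> \<exists>c\<in>C. \<exists>p q. (\<tau> ^^ p) a = (\<tau> ^^ q) c"
  shows "\<exists>i i' k. i \<noteq> (i'::nat) \<and> (\<tau> ^^ k) (x i) = x i'"
proof -
  obtain f p q where f: "\<And>i. f i \<in> C" "\<And>i. (\<tau> ^^ p i) (x i) = (\<tau> ^^ q i) (f i)"
    using cov[OF x] by metis
  have "\<not> inj f" using f C(1) by (metis finite_imageD finite_subset image_subsetI infinite_UNIV_nat)
  then obtain i i' where i: "i \<noteq> i'" "f i = f i'" by (auto simp: inj_on_def)
  have eq: "(\<tau> ^^ (q i' + p i)) (x i) = (\<tau> ^^ (q i + p i')) (x i')"
    using f(2)[of i] f(2)[of i'] i(2) by (metis funpow_commute_add add.commute)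
  have aux: "(\<tau> ^^ (m - n)) y = z" if "(\<tau> ^^ m) y = (\<tau> ^^ n) z" "n \<le> m"
    "y \<in> carrier A" "z \<in> carrier A" for m n y z
  proof -
    have "(\<tau> ^^ n) ((\<tau> ^^ (m - n)) y) = (\<tau> ^^ n) z" using that by (simp add: funpow_commute_add)
    then show ?thesis using inj_funpow that by simp
  qed
  show ?thesis
  proof (cases "q i + p i' \<le> q i' + p i")
    case True
    then show ?thesis using aux[OF eq True] i x by blast
  next
    case False
    then show ?thesis using aux[OF eq[symmetric]] i x by (metis nle_le)
  qed
qed

text \<open>Two of the elements \<open>a + \<tau>\<^sup>i a\<close>, \<open>i \<ge> 1\<close>, lie in one orbit. The resulting relation between the
  iterates of \<open>a\<close> has leading coefficient \<open>1\<close> or \<open>-1\<close>, so the iterates of \<open>a\<close> span a finite group.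
  Hence all orbits are finite.\<close>
theorem finite_of_torsion_finitely_many_orbits:
  assumes C: "finite C" "C \<subseteq> carrier A"
    and cov: "\<And>a. a \<in> carrier A \<Longrightarrow> \<exists>c\<in>C. \<exists>p q. (\<tau> ^^ p) a = (\<tau> ^^ q) c"
    and tor: "\<And>a. a \<in> carrier A \<Longrightarrow> \<exists>e::int. 0 < e \<and> a [^] e = \<one>"
  shows "finite (carrier A)"
proof -
  have fin: "finite (range (\<lambda>n. (\<tau> ^^ n) a))" if a: "a \<in> carrier A" for a
  proof -
    obtain e :: int where e: "0 < e" "a [^] e = \<one>" using tor a by blast
    obtain i i' k where i: "i \<noteq> i'" and
      eq: "(\<tau> ^^ k) (a \<otimes> (\<tau> ^^ Suc i) a) = a \<otimes> (\<tau> ^^ Suc i') a"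
      using pigeonhole_same_orbit[OF _ C cov, of "\<lambda>i. a \<otimes> (\<tau> ^^ Suc i) a"] a
      by (auto simp del: funpow.simps)
    then have eq: "(\<tau> ^^ k) a \<otimes> (\<tau> ^^ (k + Suc i)) a = a \<otimes> (\<tau> ^^ Suc i') a"
      using a by (simp add: funpow_mult funpow_commute_add del: funpow.simps)
    show ?thesis
    proof (cases "k + i" i' rule: linorder_cases)
      case greater
      interpret S: subgroup "span a (k + Suc i)" A using a subgroup_span by simp
      have "(\<tau> ^^ (k + Suc i)) a = inv ((\<tau> ^^ k) a) \<otimes> (a \<otimes> (\<tau> ^^ Suc i') a)"
        using eq a by (metis funpow_closed inv_solve_left m_closed)
      moreover have "(\<tau> ^^ k) a \<in> span a (k + Suc i)"
        "(\<tau> ^^ Suc i') a \<in> span a (k + Suc i)"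
        using greater a by (auto intro!: funpow_in_span simp del: funpow.simps)
      moreover have "a \<in> span a (k + Suc i)" using funpow_in_span[OF a, of 0 "k + Suc i"] by simp
      ultimately have "(\<tau> ^^ (k + Suc i)) a \<in> span a (k + Suc i)"
        by (simp del: funpow.simps add_Suc_right)
      then show ?thesis using finite_forward_orbit[OF a e(2,1)] by blast
    next
      case less
      interpret S: subgroup "span a (Suc i')" A using a subgroup_span by simp
      have "(\<tau> ^^ Suc i') a = inv a \<otimes> ((\<tau> ^^ k) a \<otimes> (\<tau> ^^ (k + Suc i)) a)"
        using eq a by (metis funpow_closed inv_solve_left m_closed)
      moreover have "(\<tau> ^^ k) a \<in> span a (Suc i')"
        "(\<tau> ^^ (k + Suc i)) a \<in> span a (Suc i')"
        using less a by (auto intro!: funpow_in_span simp del: funpow.simps)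
      moreover have "a \<in> span a (Suc i')" using funpow_in_span[OF a, of 0 "Suc i'"] by simp
      ultimately have "(\<tau> ^^ Suc i') a \<in> span a (Suc i')" by (simp del: funpow.simps)
      then show ?thesis using finite_forward_orbit[OF a e(2,1)] by blast
    next
      case equal
      then have "(\<tau> ^^ k) a = a" using eq a by (metis add_Suc_right funpow_closed right_cancel)
      moreover have "0 < k" using i equal by (cases k) auto
      moreover have "(\<tau> ^^ 0) a \<in> span a k" using \<open>0 < k\<close> a by (intro funpow_in_span)
      ultimately show ?thesis using finite_forward_orbit[OF a e(2,1), of k] by simp
    qed
  qed
  have "carrier A \<subseteq> (\<Union>c\<in>C. range (\<lambda>n. (\<tau> ^^ n) c))"
  proof
    fix a assume a: "a \<in> carrier A"
    then obtain c p q where c: "c \<in> C" "(\<tau> ^^ p) a = (\<tau> ^^ q) c" using cov by blast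
    obtain r where r: "r > 0" "(\<tau> ^^ r) a = a"
      using finite_forward_orbit_imp_periodic a fin by blast
    have per: "(\<tau> ^^ (r * s)) a = a" for s
      by (induction s) (auto simp: r funpow_add)
    have "a = (\<tau> ^^ (r * p)) a" using per by simp
    also have "\<dots> = (\<tau> ^^ (r * p - p)) ((\<tau> ^^ p) a)" using r(1) by (simp add: funpow_commute_add)
    also have "\<dots> = (\<tau> ^^ (r * p - p + q)) c" by (simp add: c(2) funpow_commute_add)
    finally show "a \<in> (\<Union>c\<in>C. range (\<lambda>n. (\<tau> ^^ n) c))" using c(1) by blast
  qed
  moreover have "finite (\<Union>c\<in>C. range (\<lambda>n. (\<tau> ^^ n) c))" using C fin by auto
  ultimately show ?thesis by (rule finite_subset)
qed

end

section \<open>Torsion-free groups with finitely many lines\<close>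

lemma (in abelian_endo) act_one [simp]: "act P \<one> = \<one>"
  by (induction P) (auto simp: act_pCons)

locale torsion_free_endo = abelian_endo +
  assumes torsion_free: "\<And>a j. a \<in> carrier A \<Longrightarrow> a [^] (j::int) = \<one> \<Longrightarrow> j \<noteq> 0 \<Longrightarrow> a = \<one>"
begin

lemma pow_cancel:
  assumes "a \<in> carrier A" "b \<in> carrier A" "a [^] (j::int) = b [^] j" "j \<noteq> 0"
  shows "a = b"
proof -
  have "(a \<otimes> inv b) [^] j = \<one>"
    using assms by (simp add: int_pow_distrib int_pow_inv)
  then have "a \<otimes> inv b = \<one>" using torsion_free assms by simp
  then show ?thesis using assms by (metis inv_equality inv_inv r_inv inv_closed)
qed

lemma exponent_unique:
  assumes "a \<in> carrier A" "a \<noteq> \<one>" "a [^] (i::int) = a [^] j"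
  shows "i = j"
proof (rule ccontr)
  assume "i \<noteq> j"
  moreover have "a [^] (i - j) = \<one>" using assms by (simp add: int_pow_diff)
  ultimately show False using torsion_free assms by simp
qed

text \<open>An annihilating polynomial of least degree. It divides the others only after multiplication by
  an integer, since the division takes place over \<open>\<rat>\<close>. Torsion-freeness rules out constants, and injectivity of
  \<open>\<tau>\<close> makes the constant coefficient nonzero.\<close>
lemma minimal_annihilator:
  assumes a: "a \<in> carrier A" "a \<noteq> \<one>" and ex: "P0 \<noteq> 0" "act P0 a = \<one>"
  obtains P where "act P a = \<one>" "0 < degree P" "coeff P 0 \<noteq> 0"
    and "\<And>Q. act Q a = \<one> \<Longrightarrow> Q \<noteq> 0 \<Longrightarrow> degree P \<le> degree Q"
    and "\<And>Q. act Q a = \<one> \<Longrightarrow> \<exists>e H. e \<noteq> 0 \<and> smult e Q = P * H"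
proof -
  define P where "P = arg_min degree (\<lambda>P. P \<noteq> 0 \<and> act P a = \<one>)"
  have P: "P \<noteq> 0" "act P a = \<one>"
    using arg_min_natI[of "\<lambda>P. P \<noteq> 0 \<and> act P a = \<one>" P0 degree] ex unfolding P_def by auto
  have min: "degree P \<le> degree Q" if "act Q a = \<one>" "Q \<noteq> 0" for Q
    using arg_min_nat_le[of "\<lambda>P. P \<noteq> 0 \<and> act P a = \<one>" Q degree] that unfolding P_def by auto
  have deg: "0 < degree P"
  proof (rule ccontr)
    assume "\<not> 0 < degree P"
    then obtain c where "P = [:c:]" using degree_eq_zeroE by blast
    then show False using P a torsion_free[of a c] by (auto simp: act_const)
  qed
  have c0: "coeff P 0 \<noteq> 0"
  proof
    assume "coeff P 0 = 0"
    then obtain Q where Q: "P = pCons 0 Q" by (metis pCons_cases coeff_pCons_0)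
    then have "\<tau> (act Q a) = \<tau> \<one>" using P a by (simp add: act_pCons)
    then have "act Q a = \<one>" using inj_onD[OF inj] a by (metis act_closed one_closed)
    moreover have "Q \<noteq> 0" "degree Q < degree P" using P Q by auto
    ultimately show False using min[of Q] by simp
  qed
  have div: "\<exists>e H. e \<noteq> 0 \<and> smult e Q = P * H" if Q: "act Q a = \<one>" for Q
  proof -
    obtain H R where HR: "pseudo_divmod Q P = (H, R)" by force
    define e where "e = lead_coeff P ^ (Suc (degree Q) - degree P)"
    have eq: "smult e Q = P * H + R" and R: "R = 0 \<or> degree R < degree P"
      using pseudo_divmod[OF P(1) HR] unfolding e_def by auto
    have "act R a = act (smult e Q - H * P) a" using eq by (simp add: mult.commute)
    also have "\<dots> = \<one>" using a P Q by (simp add: act_diff act_smult act_mult)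
    finally have "R = 0" using R min[of R] by fastforce
    moreover have "e \<noteq> 0" using P unfolding e_def by simp
    ultimately show ?thesis using eq by auto
  qed
  show ?thesis using that P deg c0 min div by blast
qed

end

text \<open>Tensored with \<open>\<rat>\<close>, the condition says that \<open>\<tau>\<close> has finitely many orbits on lines; the fixed exponent
  \<open>m\<close> moreover bounds the divisibility of elements. Orbits are those of the group generated by \<open>\<tau>\<close>,
  and the two exponents \<open>p\<close>, \<open>q\<close> avoid the inverse of \<open>\<tau>\<close>.\<close>
locale line_covered_endo = torsion_free_endo +
  fixes C :: "'a set" and m :: int
  assumes C: "finite C" "C \<subseteq> carrier A" and m: "0 < m"
    and cov: "\<And>a. a \<in> carrier A \<Longrightarrow>
      \<exists>c\<in>C. \<exists>p q. \<exists>j::int. (\<tau> ^^ p) (a [^] m) = (\<tau> ^^ q) (c [^] j)"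
begin

lemma pigeonhole_same_line:
  assumes x: "\<And>i. i \<in> I \<Longrightarrow> x i \<in> carrier A" "\<And>i. i \<in> I \<Longrightarrow> x i \<noteq> \<one>"
    and I: "finite I" "card C < card I"
  shows "\<exists>i\<in>I. \<exists>i'\<in>I. \<exists>k j j'. i \<noteq> i' \<and> j \<noteq> 0 \<and> j' \<noteq> 0 \<and>
    (\<tau> ^^ k) (x i) [^] (j::int) = x i' [^] (j'::int)"
proof -
  obtain f p q l where f: "\<And>i. i \<in> I \<Longrightarrow> f i \<in> C"
    and eq: "\<And>i. i \<in> I \<Longrightarrow> (\<tau> ^^ p i) (x i [^] m) = (\<tau> ^^ q i) (f i [^] (l i :: int))"
    using cov[OF x(1)] by metis
  have l0: "l i \<noteq> 0" if i: "i \<in> I" for i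
  proof
    assume "l i = 0"
    then have "(\<tau> ^^ p i) (x i [^] m) = (\<tau> ^^ p i) \<one>"
      using eq[OF i] funpow_int_pow[of \<one>, where j=0] by simp
    then have "x i [^] m = \<one>" using inj_funpow x(1)[OF i] by (metis int_pow_closed one_closed)
    then show False using torsion_free x[OF i] m by auto
  qed
  have "\<not> inj_on f I"
    using f I C(1) by (metis card_inj_on_le image_subsetI leD)
  then obtain i i' where i: "i \<in> I" "i' \<in> I" "i \<noteq> i'" "f i = f i'" by (auto simp: inj_on_def)
  have main: "\<exists>k j j'. j \<noteq> 0 \<and> j' \<noteq> 0 \<and> (\<tau> ^^ k) (x i) [^] (j::int) = x i' [^] (j'::int)"
    if i: "i \<in> I" "i' \<in> I" "f i = f i'" and le: "q i + p i' \<le> q i' + p i" for i i'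
  proof -
    have fc: "f i \<in> carrier A" using f C i by auto
    have X: "x i \<in> carrier A" "x i' \<in> carrier A" using x i by auto
    have "(\<tau> ^^ (q i' + p i)) (x i) [^] (m * l i') = (\<tau> ^^ q i') ((\<tau> ^^ p i) (x i [^] m)) [^] l i'"
      using X by (simp add: funpow_commute_add funpow_int_pow int_pow_pow)
    also have "\<dots> = (\<tau> ^^ (q i' + q i)) (f i) [^] (l i * l i')"
      using fc by (simp add: eq[OF i(1)] funpow_commute_add funpow_int_pow int_pow_pow)
    also have "\<dots> = (\<tau> ^^ q i) ((\<tau> ^^ q i') (f i' [^] l i')) [^] l i"
      using fc i(3) by (simp add: funpow_commute_add funpow_int_pow int_pow_pow mult.commute add.commute)
    also have "\<dots> = (\<tau> ^^ (q i + p i')) (x i') [^] (m * l i)"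
      using X by (simp add: eq[OF i(2), symmetric] funpow_commute_add funpow_int_pow int_pow_pow)
    finally have "(\<tau> ^^ (q i + p i')) ((\<tau> ^^ (q i' + p i - (q i + p i'))) (x i) [^] (m * l i')) =
        (\<tau> ^^ (q i + p i')) (x i' [^] (m * l i))"
      using le X by (simp add: funpow_int_pow funpow_commute_add)
    then have "(\<tau> ^^ (q i' + p i - (q i + p i'))) (x i) [^] (m * l i') = x i' [^] (m * l i)"
      using inj_funpow X by simp
    moreover have "m * l i' \<noteq> 0" "m * l i \<noteq> 0" using l0 i m by auto
    ultimately show ?thesis by blast
  qed
  show ?thesis
    using main[OF i(1,2,4)] main[OF i(2,1) i(4)[symmetric]] i by (metis nle_le)
qed

text \<open>Two of the elements \<open>a + \<tau>\<^sup>i a\<close>, \<open>i \<ge> 1\<close>, span the same line up to a power of \<open>\<tau>\<close>, and the exponents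
  show that the relation between them is not trivial.\<close>
lemma annihilator_exists:
  assumes a: "a \<in> carrier A" "a \<noteq> \<one>"
  shows "\<exists>P. P \<noteq> 0 \<and> act P a = \<one>"
proof (cases "\<exists>i. act (1 + monom 1 (Suc i)) a = \<one>")
  case True
  then obtain i where "act (1 + monom 1 (Suc i)) a = \<one>" by blast
  moreover have "coeff (1 + monom 1 (Suc i) :: int poly) 0 \<noteq> 0" by simp
  ultimately show ?thesis by (metis coeff_0)
next
  case False
  obtain i i' k j j' where i: "i \<noteq> i'" "j \<noteq> 0" "j' \<noteq> 0"
    and eq: "(\<tau> ^^ k) (act (1 + monom 1 (Suc i)) a) [^] (j::int) = act (1 + monom 1 (Suc i')) a [^] (j'::int)"
    using pigeonhole_same_line[of "{..card C}" "\<lambda>i. act (1 + monom 1 (Suc i)) a"] a False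
    by auto
  define P where "P = smult j (monom 1 k * (1 + monom 1 (Suc i))) - smult j' (1 + monom 1 (Suc i'))"
  have "act P a = \<one>"
    using a eq unfolding P_def by (simp add: act_diff act_smult act_mult act_monom del: monom_Suc)
  moreover have "P \<noteq> 0"
  proof
    assume 0: "P = 0"
    have co: "coeff P n = j * ((if n = k then 1 else 0) + (if n = k + Suc i then 1 else 0))
        - j' * ((if n = 0 then 1 else 0) + (if n = Suc i' then 1 else 0))" for n
      unfolding P_def by (simp add: distrib_left mult_monom coeff_add del: monom_Suc) 
    have "k = 0" using co[of 0] 0 i by (auto split: if_splits)
    moreover from this have "j = j'" using co[of 0] 0 by simp
    ultimately show False using co[of "Suc i"] 0 i by (auto split: if_splits)
  qed
  ultimately show ?thesis by blast
qed

text \<open>Otherwise the minimal polynomial \<open>P\<close> of \<open>a\<close> has degree at least \<open>2\<close>. For more pairs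
  \<open>(s, p)\<close> as in \<open>separating_primes\<close> than there are orbits of lines, two of the elements \<open>(s - X) a\<close> would
  span the same line up to a power of \<open>\<tau>\<close>.\<close>
theorem multiplier_exists:
  assumes a: "a \<in> carrier A" "a \<noteq> \<one>"
  obtains u v :: int where "u \<noteq> 0" "v \<noteq> 0" "coprime u v" "\<tau> a [^] v = a [^] u"
proof -
  obtain P0 where P0: "P0 \<noteq> 0" "act P0 a = \<one>" using annihilator_exists[OF a] by blast
  obtain P where P: "act P a = \<one>" "0 < degree P" "coeff P 0 \<noteq> 0"
    and min: "\<And>Q. act Q a = \<one> \<Longrightarrow> Q \<noteq> 0 \<Longrightarrow> degree P \<le> degree Q"
    and div: "\<And>Q. act Q a = \<one> \<Longrightarrow> \<exists>e H. e \<noteq> 0 \<and> smult e Q = P * H"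
    using minimal_annihilator[OF a P0] by blast
  have "degree P = 1"
  proof (rule ccontr)
    assume "degree P \<noteq> 1"
    then have deg: "2 \<le> degree P" using P by simp
    obtain S :: "(int \<times> int) set" where S: "finite S" "card S = Suc (card C)"
      and good: "\<And>x. x \<in> S \<Longrightarrow> prime (snd x) \<and> \<not> snd x dvd coeff P 0 \<and> \<not> snd x dvd lead_coeff P \<and>
          snd x dvd poly P (fst x) \<and> poly P (fst x) \<noteq> 0"
      and sep: "\<And>x y. x \<in> S \<Longrightarrow> y \<in> S \<Longrightarrow> x \<noteq> y \<Longrightarrow> \<not> snd x dvd fst x - fst y"
      using separating_primes[OF P(2,3), of "Suc (card C)"] by blast
    have ne: "act [:s, -1:] a \<noteq> \<one>" for s
      using min[of "[:s, -1:]"] deg by auto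
    obtain x y k j j' where xy: "x \<in> S" "y \<in> S" "x \<noteq> y" "j \<noteq> 0" "j' \<noteq> 0"
      and eq: "(\<tau> ^^ k) (act [:fst x, -1:] a) [^] (j::int) = act [:fst y, -1:] a [^] (j'::int)"
      using pigeonhole_same_line[of S "\<lambda>x. act [:fst x, -1:] a"] S ne a
      by (metis act_closed lessI)
    have "act (smult j' [:fst y, -1:] - smult j (monom 1 k * [:fst x, -1:])) a = \<one>"
      using a eq by (simp only: act_diff act_smult act_mult act_monom act_closed)
        (simp add: r_inv)
    then obtain e H where e: "e \<noteq> 0"
      and "smult e (smult j' [:fst y, -1:] - smult j (monom 1 k * [:fst x, -1:])) = P * H"
      using div by blast
    then have rel: "smult (e * j') [:fst y, -1:] - smult (e * j) (monom 1 k * [:fst x, -1:]) = P * H"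
      by (simp only: smult_diff_right smult_smult)
    have "snd y dvd fst y - fst x"
      using associated_linear_factors_congruent[OF _ deg _ _ _ rel] good[OF xy(2)] e xy by auto
    then show False using sep xy by blast
  qed
  moreover obtain u' Q where "P = pCons u' Q" by (rule pCons_cases)
  ultimately obtain v' where P': "P = [:u', v':]"
    by (auto split: if_splits elim!: degree_eq_zeroE)
  have uv': "u' \<noteq> 0" "v' \<noteq> 0" using P \<open>degree P = 1\<close> unfolding P' by (auto split: if_splits)
  define g where "g = gcd u' v'"
  obtain u v where uv: "u' = g * u" "v' = g * v" "coprime u v"
    using uv'(1) unfolding g_def by (metis gcd_coprime_exists mult.commute gcd_eq_0_iff)
  have g0: "g \<noteq> 0" using uv' g_def by auto
  have "(a [^] u \<otimes> \<tau> a [^] v) [^] g = \<one>"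
    using P(1) a unfolding P' uv by (simp add: act_linear int_pow_distrib int_pow_pow mult.commute)
  then have "a [^] u \<otimes> \<tau> a [^] v = \<one>" using torsion_free g0 a by simp
  then have "\<tau> a [^] v = a [^] (- u)"
    using a by (metis int_pow_closed int_pow_neg inv_equality m_comm \<tau>.hom_closed)
  moreover have "coprime (- u) v" using uv by simp
  ultimately show ?thesis using that[of "-u" v] uv' uv by auto
qed

lemma funpow_multiplier:
  assumes a: "a \<in> carrier A" and uv: "\<tau> a [^] (v::int) = a [^] (u::int)"
  shows "(\<tau> ^^ n) a [^] (v ^ n) = a [^] (u ^ n)"
proof (induction n)
  case (Suc n)
  have "(\<tau> ^^ Suc n) a [^] (v ^ Suc n) = \<tau> ((\<tau> ^^ n) a [^] (v ^ n)) [^] v"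
    using a by (simp add: \<tau>.hom_int_pow int_pow_pow mult.commute)
  also have "\<dots> = (\<tau> a [^] v) [^] (u ^ n)"
    using a by (simp add: Suc \<tau>.hom_int_pow int_pow_pow mult.commute)
  also have "\<dots> = a [^] (u ^ Suc n)" using a by (simp add: uv int_pow_pow)
  finally show ?case .
qed (use a in simp)

end

lemma exponential_difference:
  fixes u v :: int
  assumes "u \<noteq> 0" "v \<noteq> 0" "\<bar>u\<bar> \<noteq> \<bar>v\<bar>"
  shows "2 ^ n - 1 \<le> \<bar>u ^ n - v ^ n\<bar>"
proof -
  have aux: "2 ^ n - 1 \<le> x ^ n - y ^ n" if "1 \<le> y" "y < x" for x y :: int
  proof (induction n)
    case (Suc n)
    have "2 ^ Suc n - 1 \<le> 2 * (x ^ n - y ^ n) + 1" using Suc by simp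
    also have "\<dots> \<le> x * (x ^ n - y ^ n) + y ^ n"
    proof (rule add_mono)
      show "2 * (x ^ n - y ^ n) \<le> x * (x ^ n - y ^ n)"
        using that by (intro mult_right_mono) (auto intro: power_mono)
      show "1 \<le> y ^ n" using that by simp
    qed
    also have "\<dots> \<le> x * (x ^ n - y ^ n) + (x - y) * y ^ n"
      using that mult_right_mono[of 1 "x - y" "y ^ n"] by simp
    also have "\<dots> = x ^ Suc n - y ^ Suc n" by (simp add: algebra_simps)
    finally show ?case .
  qed simp
  have "2 ^ n - 1 \<le> \<bar>\<bar>u\<bar> ^ n - \<bar>v\<bar> ^ n\<bar>"
    using aux[of "\<bar>u\<bar>" "\<bar>v\<bar>"] aux[of "\<bar>v\<bar>" "\<bar>u\<bar>"] assms by fastforce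
  also have "\<dots> \<le> \<bar>u ^ n - v ^ n\<bar>"
    using abs_triangle_ineq3[of "u ^ n" "v ^ n"] by (simp add: power_abs)
  finally show ?thesis .
qed

lemma power_outgrows_linear: "\<exists>n>0. B * int n < 2 ^ n - 1"
proof -
  have sq: "int n * int n < 2 ^ n - 1" if "5 \<le> n" for n
    using that
  proof (induction n rule: dec_induct)
    case (step n)
    have "5 * int n \<le> int n * int n" using step by (intro mult_right_mono) auto
    moreover have "int (Suc n) * int (Suc n) = int n * int n + 2 * int n + 1"
      by (simp add: algebra_simps)
    moreover have "(2::int) ^ Suc n = 2 * 2 ^ n" by simp
    moreover have "1 \<le> int n" using step by simp
    ultimately show ?case using step.IH by linarith
  qed simp
  define n where "n = nat (max 5 B)"
  have "B * int n \<le> int n * int n" unfolding n_def by (intro mult_right_mono) auto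
  moreover have "5 \<le> n" unfolding n_def by simp
  ultimately have "0 < n \<and> B * int n < 2 ^ n - 1" using sq[of n] by linarith
  then show ?thesis by blast
qed

section \<open>Linear growth of the quotients\<close>

lemma abs_eq_imp_square_eq: "\<bar>u :: int\<bar> = \<bar>v\<bar> \<Longrightarrow> u ^ 2 = v ^ 2"
  by (metis power2_abs)

context line_covered_endo
begin

lemma multiplier_abs_eq_imp_square_fixed:
  assumes a: "a \<in> carrier A" and uv: "\<tau> a [^] (v::int) = a [^] (u::int)"
    and v: "v \<noteq> 0" and abs: "\<bar>u\<bar> = \<bar>v\<bar>"
  shows "(\<tau> ^^ 2) a = a"
proof -
  have "(\<tau> ^^ 2) a [^] (v ^ 2) = a [^] (v ^ 2)"
    using funpow_multiplier[OF a uv, of 2] abs_eq_imp_square_eq[OF abs] by simp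
  then show ?thesis using pow_cancel[of "(\<tau> ^^ 2) a" a "v ^ 2"] a v by simp
qed

text \<open>The multiplier \<open>u/v\<close> of a periodic element is a rational root of unity.\<close>
lemma periodic_imp_square_fixed:
  assumes a: "a \<in> carrier A" and n: "0 < n" and per: "(\<tau> ^^ n) a = a"
  shows "(\<tau> ^^ 2) a = a"
proof (cases "a = \<one>")
  case True
  then show ?thesis by (simp add: numeral_2_eq_2)
next
  case False
  obtain u v :: int where uv: "u \<noteq> 0" "v \<noteq> 0" "coprime u v" "\<tau> a [^] v = a [^] u"
    using multiplier_exists[OF a False] .
  have "a [^] (v ^ n) = a [^] (u ^ n)" using funpow_multiplier[OF a uv(4), of n] per by simp
  then have "v ^ n = u ^ n" using exponent_unique[OF a False] by blast
  then have "\<bar>v\<bar> ^ n = \<bar>u\<bar> ^ n" by (metis power_abs)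
  then have "\<bar>u\<bar> = \<bar>v\<bar>" using n power_eq_imp_eq_base[of "\<bar>v\<bar>" n "\<bar>u\<bar>"] by simp
  then show ?thesis using multiplier_abs_eq_imp_square_fixed[OF a uv(4,2)] by blast
qed

text \<open>A fixed point \<open>d\<close> of \<open>\<tau>\<^sup>2\<close> of finite order modulo the image of \<open>\<tau>\<^sup>2 - 1\<close> has a multiple \<open>(\<tau>\<^sup>2 - 1) b\<close>;
  then \<open>\<tau>\<^sup>2\<close> would be unipotent but not trivial on the span of \<open>b\<close>, although \<open>b\<close> is an eigenvector.\<close>
lemma no_square_fixed_point:
  assumes growth: "\<And>a. a \<in> carrier A \<Longrightarrow> \<exists>e::int. \<exists>b\<in>carrier A. 1 \<le> e \<and> a [^] e \<otimes> b = (\<tau> ^^ 2) b"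
    and d: "d \<in> carrier A" "(\<tau> ^^ 2) d = d"
  shows "d = \<one>"
proof (rule ccontr)
  assume ne: "d \<noteq> \<one>"
  obtain e :: int and b where e: "1 \<le> e" and b: "b \<in> carrier A" and eq: "d [^] e \<otimes> b = (\<tau> ^^ 2) b"
    using growth[OF d(1)] by blast
  have de: "d [^] e \<noteq> \<one>" using torsion_free[OF d(1), of e] ne e by auto
  have b1: "b \<noteq> \<one>"
  proof
    assume "b = \<one>"
    then have "d [^] e = \<one>" using eq d by (simp add: numeral_2_eq_2)
    then show False using de by simp
  qed
  obtain u v :: int where uv: "u \<noteq> 0" "v \<noteq> 0" "coprime u v" "\<tau> b [^] v = b [^] u"
    using multiplier_exists[OF b b1] .
  have "(d [^] e \<otimes> b) [^] (v ^ 2) = b [^] (u ^ 2)"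
    using funpow_multiplier[OF b uv(4), of 2] eq by simp
  then have "d [^] (e * v ^ 2) \<otimes> b [^] (v ^ 2) = b [^] (u ^ 2)"
    using d b by (simp add: int_pow_distrib int_pow_pow)
  then have dbw: "d [^] (e * v ^ 2) = b [^] (u ^ 2 - v ^ 2)"
    using d b by (metis int_pow_closed int_pow_diff inv_solve_right)
  have "(\<tau> ^^ 2) (d [^] (e * v ^ 2)) = d [^] (e * v ^ 2)"
    using d by (simp only: funpow_int_pow d(2))
  then have *: "(\<tau> ^^ 2) b [^] (u ^ 2 - v ^ 2) = b [^] (u ^ 2 - v ^ 2)"
    using dbw funpow_int_pow[OF b, of 2 "u\<^sup>2 - v\<^sup>2"] by simp
  have "u ^ 2 - v ^ 2 \<noteq> 0"
  proof
    assume "u ^ 2 - v ^ 2 = 0"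
    then have "d [^] (e * v ^ 2) = \<one>" using dbw by simp
    then show False using torsion_free[OF d(1), of "e * v ^ 2"] ne e uv by auto
  qed
  then have "(\<tau> ^^ 2) b = b" using pow_cancel[OF _ b *] b by simp
  then have "d [^] e \<otimes> b = \<one> \<otimes> b" using eq b by simp
  then have "d [^] e = \<one>" using b d by (metis int_pow_closed one_closed right_cancel)
  then show False using de by simp
qed

text \<open>Let \<open>\<tau> a = (u/v) a\<close> and let \<open>e a = (\<tau>\<^sup>n - 1) b\<close>, with \<open>e\<close> linear in \<open>n\<close>. Then \<open>b\<close> is an eigenvector for
  \<open>u/v\<close> as well, so \<open>v\<^sup>n e a = (u\<^sup>n - v\<^sup>n) b\<close>. As \<open>v\<close> is prime to \<open>w = u\<^sup>n - v\<^sup>n\<close>, already \<open>e a\<close> is divisible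
  by \<open>w\<close>. But finitely many lines cover everything, so the part prime to \<open>u v\<close> of an integer dividing \<open>e a\<close>
  is at most a constant times \<open>e\<close>. This bounds \<open>w\<close> linearly in \<open>n\<close>.\<close>
theorem linear_growth_imp_trivial:
  assumes growth: "\<And>n a. 0 < n \<Longrightarrow> a \<in> carrier A \<Longrightarrow>
      \<exists>e. \<exists>b\<in>carrier A. 1 \<le> e \<and> e \<le> K * int n \<and> a [^] e \<otimes> b = (\<tau> ^^ n) b"
  shows "carrier A = {\<one>}"
proof (rule ccontr)
  assume "carrier A \<noteq> {\<one>}"
  then obtain a where a: "a \<in> carrier A" "a \<noteq> \<one>" using one_closed by blast
  have nofix: "d = \<one>" if "d \<in> carrier A" "(\<tau> ^^ 2) d = d" for d
    using no_square_fixed_point[OF _ that] growth[of 2] by (metis zero_less_numeral)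
  obtain u v :: int where uv: "u \<noteq> 0" "v \<noteq> 0" "coprime u v" and lin: "\<tau> a [^] v = a [^] u"
    using multiplier_exists[OF a] .
  have uv_abs: "\<bar>u\<bar> \<noteq> \<bar>v\<bar>"
    using multiplier_abs_eq_imp_square_fixed[OF a(1) lin uv(2)] nofix a by blast
  \<comment> \<open>For \<open>c\<close> on the line of \<open>a\<close>, a nonzero exponent that carries \<open>c\<close> into \<open>\<langle>a\<rangle>\<close>; only the
      choice once and for all matters, so that the bound \<open>B\<close> does not depend on \<open>n\<close>.\<close>
  define comm where "comm c = (SOME \<beta>::int. (\<exists>\<alpha>::int. a [^] \<alpha> = c [^] \<beta>) \<and> \<beta> \<noteq> 0)" for c
  define B where "B = (\<Sum>c\<in>C. \<bar>comm c\<bar>)"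
  have bound: "\<bar>u ^ n - v ^ n\<bar> \<le> K * m * B * int n" if n: "0 < n" for n
  proof -
    obtain e b where e: "1 \<le> e" "e \<le> K * int n" and b: "b \<in> carrier A"
      and eq: "a [^] e \<otimes> b = (\<tau> ^^ n) b"
      using growth[OF n a(1)] by blast
    \<comment> \<open>\<open>d = (v \<tau> - u) b\<close> is fixed by \<open>\<tau>\<^sup>n\<close>, hence trivial: \<open>b\<close> has the same multiplier as \<open>a\<close>.\<close>
    define d where "d = \<tau> b [^] v \<otimes> inv (b [^] u)"
    have d: "d \<in> carrier A" unfolding d_def using b by simp
    have lin_e: "\<tau> (a [^] e) [^] v = (a [^] e) [^] u"
      using a(1) lin by (simp add: \<tau>.hom_int_pow int_pow_pow) (metis int_pow_pow mult.commute \<tau>.hom_closed)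
    have tb: "(\<tau> ^^ n) (\<tau> b) = \<tau> (a [^] e) \<otimes> \<tau> b"
      using eq a(1) b by (metis \<tau>.hom_mult funpow_swap1 int_pow_closed)
    have "(\<tau> ^^ n) d = (\<tau> ^^ n) (\<tau> b) [^] v \<otimes> inv ((\<tau> ^^ n) b [^] u)"
      unfolding d_def using b funpow_int_pow[of b n "-u"]
      by (simp add: funpow_mult funpow_int_pow flip: int_pow_neg)
    also have "\<dots> = (\<tau> (a [^] e) [^] v \<otimes> \<tau> b [^] v) \<otimes> (inv ((a [^] e) [^] u) \<otimes> inv (b [^] u))"
      unfolding tb eq[symmetric] using a(1) b by (simp add: int_pow_distrib inv_mult)
    also have "\<dots> = (\<tau> (a [^] e) [^] v \<otimes> inv ((a [^] e) [^] u)) \<otimes> d"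
      unfolding d_def using a(1) b by (simp add: m_ac)
    also have "\<dots> = d" unfolding lin_e using a(1) d by simp
    finally have "(\<tau> ^^ n) d = d" .
    then have "d = \<one>" using periodic_imp_square_fixed[OF d n] nofix d by blast
    then have linb: "\<tau> b [^] v = b [^] u"
      unfolding d_def using b by (metis \<tau>.hom_closed int_pow_closed inv_closed inv_equality inv_inv)
    define w where "w = u ^ n - v ^ n"
    have "(a [^] e \<otimes> b) [^] (v ^ n) = b [^] (u ^ n)"
      using funpow_multiplier[OF b linb, of n] eq by simp
    then have "a [^] (e * v ^ n) \<otimes> b [^] (v ^ n) = b [^] (u ^ n)"
      using a b by (simp add: int_pow_distrib int_pow_pow)
    then have abw: "a [^] (e * v ^ n) = b [^] w"
      unfolding w_def using a b by (metis int_pow_closed int_pow_diff inv_solve_right)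
    have cop_u: "coprime w u" and cop_v: "coprime w v"
    proof -
      have un: "coprime (u ^ n) (v ^ n)" using uv(3) by simp
      have "coprime w (u ^ n)" unfolding w_def using un
        by (metis coprime_commute gcd_diff1 coprime_iff_gcd_eq_1 minus_diff_eq coprime_minus_left_iff)
      moreover have "coprime w (v ^ n)" unfolding w_def using un
        by (metis gcd_diff1 coprime_iff_gcd_eq_1)
      ultimately show "coprime w u" "coprime w v" using n by auto
    qed
    \<comment> \<open>A Bezout relation between \<open>w\<close> and \<open>v\<^sup>n\<close> turns \<open>e a\<close> into a \<open>w\<close>-fold multiple.\<close>
    have "coprime (v ^ n) w" using cop_v by (simp add: coprime_commute)
    then obtain \<alpha> \<beta> where bez: "\<alpha> * v ^ n + \<beta> * w = 1"
      by (metis coprime_iff_gcd_eq_1 bezout_int)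
    define b' where "b' = b [^] \<alpha> \<otimes> a [^] (e * \<beta>)"
    have b': "b' \<in> carrier A" unfolding b'_def using a b by simp
    have "b' [^] w = (b [^] w) [^] \<alpha> \<otimes> a [^] (e * \<beta> * w)"
      unfolding b'_def using a b by (simp add: int_pow_distrib int_pow_pow mult.commute)
    also have "\<dots> = a [^] (e * v ^ n * \<alpha> + e * \<beta> * w)"
      unfolding abw[symmetric] using a by (simp add: int_pow_pow int_pow_mult)
    also have "e * v ^ n * \<alpha> + e * \<beta> * w = e * (\<alpha> * v ^ n + \<beta> * w)" by (simp add: algebra_simps)
    finally have b'w: "b' [^] w = a [^] e" using bez by simp
    have "b' \<noteq> \<one>" using b'w torsion_free[OF a(1), of e] a(2) e by auto
    obtain c p q and j :: int where c: "c \<in> C" and cj: "(\<tau> ^^ p) (b' [^] m) = (\<tau> ^^ q) (c [^] j)"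
      using cov[OF b'] by blast
    have cA: "c \<in> carrier A" using c C by blast
    have ecj: "(\<tau> ^^ p) a [^] (e * m) = (\<tau> ^^ q) c [^] (j * w)"
    proof -
      have "(\<tau> ^^ p) a [^] (e * m) = (\<tau> ^^ p) (b' [^] m) [^] w"
        using a b' b'w by (simp add: funpow_int_pow int_pow_pow flip: funpow_int_pow) (metis int_pow_pow mult.commute)
      then show ?thesis unfolding cj using cA by (simp add: funpow_int_pow int_pow_pow)
    qed
    have ma: "(\<tau> ^^ p) a [^] (v ^ p) = a [^] (u ^ p)" "(\<tau> ^^ q) a [^] (v ^ q) = a [^] (u ^ q)"
      using funpow_multiplier[OF a(1) lin] by auto
    \<comment> \<open>\<open>a\<close> and \<open>c\<close> span the same line, since \<open>\<tau>\<close> acts on each of them by a rational number.\<close>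
    have "\<exists>\<beta>::int. (\<exists>\<alpha>::int. a [^] \<alpha> = c [^] \<beta>) \<and> \<beta> \<noteq> 0"
    proof -
      have "c \<noteq> \<one>"
      proof
        assume "c = \<one>"
        then have "(\<tau> ^^ p) a [^] (e * m) = \<one>"
          using ecj funpow_int_pow[of \<one> q 0] by simp
        then have "(\<tau> ^^ p) a = (\<tau> ^^ p) \<one>"
          using torsion_free[of "(\<tau> ^^ p) a" "e * m"] a e m funpow_int_pow[of \<one> p 0] by auto
        then show False using inj_funpow[OF a(1) one_closed] a(2) by blast
      qed
      obtain u' v' :: int where uv': "u' \<noteq> 0" "v' \<noteq> 0" and linc: "\<tau> c [^] v' = c [^] u'"
        using multiplier_exists[OF cA \<open>c \<noteq> \<one>\<close>] by blast
      have mc: "(\<tau> ^^ q) c [^] (v' ^ q) = c [^] (u' ^ q)"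
        using funpow_multiplier[OF cA linc] .
      have "a [^] (u ^ p * (e * m * v' ^ q)) = ((\<tau> ^^ p) a [^] (e * m)) [^] (v ^ p * v' ^ q)"
        using a by (simp add: ma(1)[symmetric] int_pow_pow flip: int_pow_pow[of a]) (simp add: int_pow_pow mult_ac)
      also have "\<dots> = c [^] (u' ^ q * (j * w * v ^ p))"
        unfolding ecj using cA by (simp add: mc[symmetric] int_pow_pow flip: int_pow_pow[of c]) (simp add: int_pow_pow mult_ac)
      finally have fin: "a [^] (u ^ p * (e * m * v' ^ q)) = c [^] (u' ^ q * (j * w * v ^ p))" .
      have "u' ^ q * (j * w * v ^ p) \<noteq> 0"
      proof
        assume "u' ^ q * (j * w * v ^ p) = 0"
        then have "a [^] (u ^ p * (e * m * v' ^ q)) = \<one>" using fin by (metis int_pow_0)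
        then show False using torsion_free[OF a(1)] a(2) uv uv' e m by fastforce
      qed
      then show ?thesis using fin by blast
    qed
    then have "(\<exists>\<alpha>::int. a [^] \<alpha> = c [^] comm c) \<and> comm c \<noteq> 0"
      unfolding comm_def by (rule someI_ex)
    then obtain \<gamma> :: int where \<gamma>: "a [^] \<gamma> = c [^] comm c" and c0: "comm c \<noteq> 0" by blast
    have "(\<tau> ^^ p) a [^] (e * m * comm c) = (\<tau> ^^ q) (c [^] comm c) [^] (j * w)"
    proof -
      have "(\<tau> ^^ p) a [^] (e * m * comm c) = ((\<tau> ^^ p) a [^] (e * m)) [^] comm c"
        using a by (simp add: int_pow_pow)
      then show ?thesis unfolding ecj using cA by (simp add: funpow_int_pow int_pow_pow mult_ac)
    qed
    also have "\<dots> = (\<tau> ^^ q) a [^] (j * w * \<gamma>)"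
      unfolding \<gamma>[symmetric] using a by (simp add: funpow_int_pow int_pow_pow mult_ac)
    finally have *: "(\<tau> ^^ p) a [^] (e * m * comm c) = (\<tau> ^^ q) a [^] (j * w * \<gamma>)" .
    have "a [^] (u ^ p * (e * m * comm c * v ^ q)) = ((\<tau> ^^ p) a [^] (v ^ p)) [^] (e * m * comm c * v ^ q)"
      using a by (simp add: ma(1) int_pow_pow)
    also have "\<dots> = ((\<tau> ^^ p) a [^] (e * m * comm c)) [^] (v ^ p * v ^ q)"
      using a by (simp add: int_pow_pow mult_ac)
    also have "\<dots> = ((\<tau> ^^ q) a [^] (v ^ q)) [^] (j * w * \<gamma> * v ^ p)"
      unfolding * using a by (simp add: int_pow_pow mult_ac)
    also have "\<dots> = a [^] (u ^ q * (j * w * \<gamma> * v ^ p))"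
      using a by (simp add: ma(2) int_pow_pow)
    finally have "u ^ p * (e * m * comm c * v ^ q) = u ^ q * (j * w * \<gamma> * v ^ p)"
      using exponent_unique[OF a] by blast
    then have "w dvd u ^ p * (e * m * comm c * v ^ q)" by simp
    moreover have "coprime w (u ^ p)" "coprime w (v ^ q)" using cop_u cop_v by simp_all
    ultimately have "w dvd e * m * comm c"
      by (simp add: coprime_dvd_mult_left_iff coprime_dvd_mult_right_iff)
    then have "\<bar>w\<bar> \<le> \<bar>e * m * comm c\<bar>"
      using e m c0 by (intro dvd_imp_le_int) auto
    also have "\<dots> = e * m * \<bar>comm c\<bar>" using e m by (simp add: abs_mult)
    also have "\<dots> \<le> (K * int n) * m * B"
    proof (intro mult_mono)
      show "\<bar>comm c\<bar> \<le> B" unfolding B_def using c C by (intro member_le_sum) auto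
    qed (use e m in auto)
    finally show ?thesis unfolding w_def by (simp add: mult_ac)
  qed
  obtain n where n: "0 < n" "K * m * B * int n < 2 ^ n - 1"
    using power_outgrows_linear by blast
  then show False using bound[OF n(1)] exponential_difference[OF uv(1,2) uv_abs, of n] by linarith
qed

end

section \<open>Conjugation and cosets of cyclic subgroups\<close>

text \<open>A virtually cyclic subgroup is a finite union of cosets \<open>f \<langle>c\<rangle>\<close>, and a common power of its elements
  lies in \<open>\<langle>c\<rangle>\<close>. A finite list \<open>P\<close> of pairs \<open>(f, c)\<close> thus encodes finitely many virtually cyclic
  subgroups into which every element can be conjugated. In this form the property is
  inherited by quotients, and \<open>P\<close> may be enlarged freely.\<close>
definition cyclic_cosets_cover :: "('a, 'b) monoid_scheme \<Rightarrow> ('a \<times> 'a) set \<Rightarrow> int \<Rightarrow> bool" where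
  "cyclic_cosets_cover G P m \<longleftrightarrow>
     finite P \<and> P \<subseteq> carrier G \<times> carrier G \<and> 0 < m \<and>
     (\<forall>x\<in>carrier G. \<exists>y\<in>carrier G. \<exists>p\<in>P. \<exists>(j::int) (j'::int).
        y \<otimes>\<^bsub>G\<^esub> x \<otimes>\<^bsub>G\<^esub> inv\<^bsub>G\<^esub> y = fst p \<otimes>\<^bsub>G\<^esub> snd p [^]\<^bsub>G\<^esub> j \<and>
        (fst p \<otimes>\<^bsub>G\<^esub> snd p [^]\<^bsub>G\<^esub> j) [^]\<^bsub>G\<^esub> m = snd p [^]\<^bsub>G\<^esub> j')"

text \<open>For a normal subgroup \<open>N\<close> this says that \<open>G/N\<close> is virtually cyclic, without leaving the type of \<open>G\<close>.\<close>
definition virtually_cyclic_over :: "('a, 'b) monoid_scheme \<Rightarrow> 'a set \<Rightarrow> bool" where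
  "virtually_cyclic_over G N \<longleftrightarrow>
     (\<exists>t\<in>carrier G. \<exists>R. finite R \<and> R \<subseteq> carrier G \<and>
        (\<forall>g\<in>carrier G. \<exists>r\<in>R. \<exists>n::int. \<exists>a\<in>N. g = r \<otimes>\<^bsub>G\<^esub> t [^]\<^bsub>G\<^esub> n \<otimes>\<^bsub>G\<^esub> a))"

lemma virtually_cyclic_overI:
  assumes "t \<in> carrier G" "finite R" "R \<subseteq> carrier G"
    and "\<And>g. g \<in> carrier G \<Longrightarrow>
      \<exists>r\<in>R. \<exists>n::int. \<exists>a\<in>N. g = r \<otimes>\<^bsub>G\<^esub> t [^]\<^bsub>G\<^esub> n \<otimes>\<^bsub>G\<^esub> a"
  shows "virtually_cyclic_over G N"
  unfolding virtually_cyclic_over_def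
  by (rule bexI[of _ t], rule exI[of _ R], intro conjI ballI) (fact assms)+

context group
begin

lemma inv_mult_cancel [simp]: "x \<in> carrier G \<Longrightarrow> y \<in> carrier G \<Longrightarrow> inv x \<otimes> (x \<otimes> y) = y"
  by (simp flip: m_assoc)

lemma mult_inv_cancel [simp]: "x \<in> carrier G \<Longrightarrow> y \<in> carrier G \<Longrightarrow> x \<otimes> (inv x \<otimes> y) = y"
  by (simp flip: m_assoc)

definition conj_by :: "'a \<Rightarrow> 'a \<Rightarrow> 'a" where
  "conj_by g x = g \<otimes> x \<otimes> inv g"

lemma conj_by_closed [simp]: "g \<in> carrier G \<Longrightarrow> x \<in> carrier G \<Longrightarrow> conj_by g x \<in> carrier G"
  by (simp add: conj_by_def)

lemma conj_by_mult:
  "g \<in> carrier G \<Longrightarrow> x \<in> carrier G \<Longrightarrow> y \<in> carrier G \<Longrightarrow> conj_by g (x \<otimes> y) = conj_by g x \<otimes> conj_by g y"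
  by (simp add: conj_by_def m_assoc)

lemma conj_by_hom: "g \<in> carrier G \<Longrightarrow> conj_by g \<in> hom G G"
  by (auto simp: hom_def conj_by_mult)

lemma conj_by_int_pow: "g \<in> carrier G \<Longrightarrow> x \<in> carrier G \<Longrightarrow> conj_by g (x [^] (j::int)) = conj_by g x [^] j"
  by (rule hom_int_pow[OF conj_by_hom]) (auto simp: is_group)

lemma conj_by_conj_by:
  "g \<in> carrier G \<Longrightarrow> h \<in> carrier G \<Longrightarrow> x \<in> carrier G \<Longrightarrow> conj_by g (conj_by h x) = conj_by (g \<otimes> h) x"
  by (simp add: conj_by_def m_assoc inv_mult_group)

lemma conj_by_one [simp]: "x \<in> carrier G \<Longrightarrow> conj_by \<one> x = x"
  by (simp add: conj_by_def)

lemma conj_by_inv_cancel [simp]: "g \<in> carrier G \<Longrightarrow> x \<in> carrier G \<Longrightarrow> conj_by (inv g) (conj_by g x) = x"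
  by (simp add: conj_by_conj_by)

lemma conj_by_commute: "g \<in> carrier G \<Longrightarrow> x \<in> carrier G \<Longrightarrow> g \<otimes> x = x \<otimes> g \<Longrightarrow> conj_by g x = x"
  by (simp add: conj_by_def m_assoc)

lemma inj_conj_by: "g \<in> carrier G \<Longrightarrow> inj_on (conj_by g) (carrier G)"
  by (auto simp: inj_on_def conj_by_def)

lemma conj_by_funpow:
  "g \<in> carrier G \<Longrightarrow> x \<in> carrier G \<Longrightarrow> (conj_by g ^^ n) x = conj_by (g [^] int n) x"
proof (induction n)
  case (Suc n)
  then have "(conj_by g ^^ Suc n) x = conj_by (g \<otimes> g [^] n) x" by (simp add: conj_by_conj_by int_pow_int)
  also have "g \<otimes> g [^] n = g [^] int (Suc n)" using Suc by (metis int_pow_int nat_pow_Suc2)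
  finally show ?case .
qed simp

text \<open>Two distinct elements of \<open>f \<langle>c\<rangle>\<close> that differ by torsion force \<open>c\<close> to have finite order.\<close>
lemma finite_coset_Int_torsion:
  assumes f: "f \<in> carrier G" and c: "c \<in> carrier G" and S: "S \<subseteq> carrier G"
    and tor: "\<And>x y. x \<in> S \<Longrightarrow> y \<in> S \<Longrightarrow> \<exists>e::int. 0 < e \<and> (inv x \<otimes> y) [^] e = \<one>"
  shows "finite (S \<inter> range (\<lambda>j::int. f \<otimes> c [^] j))"
proof (cases "\<exists>l::int. l \<noteq> 0 \<and> c [^] l = \<one>")
  case True
  then obtain l' :: int where "l' \<noteq> 0" "c [^] l' = \<one>" by blast
  then obtain l :: int where l: "0 < l" "c [^] l = \<one>"
    using int_pow_neg[OF c, of l'] by (metis inv_one neg_0_less_iff_less linorder_neqE_linordered_idom)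
  have "f \<otimes> c [^] j \<in> (\<lambda>j. f \<otimes> c [^] j) ` {0..<l}" for j :: int
  proof -
    have "c [^] j = c [^] (l * (j div l)) \<otimes> c [^] (j mod l)"
      using c by (simp flip: int_pow_mult)
    also have "c [^] (l * (j div l)) = \<one>"
      using l c by (simp flip: int_pow_pow)
    finally show ?thesis using l c by auto
  qed
  then have "range (\<lambda>j::int. f \<otimes> c [^] j) \<subseteq> (\<lambda>j. f \<otimes> c [^] j) ` {0..<l}" by blast
  then show ?thesis by (metis finite_Int finite_atLeastLessThan_int finite_imageI finite_subset)
next
  case False
  have "x = y" if xy: "x \<in> S \<inter> range (\<lambda>j::int. f \<otimes> c [^] j)" "y \<in> S \<inter> range (\<lambda>j::int. f \<otimes> c [^] j)" for x y
  proof -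
    obtain i j :: int where ij: "x = f \<otimes> c [^] i" "y = f \<otimes> c [^] j" using xy by auto
    obtain e :: int where e: "0 < e" "(inv x \<otimes> y) [^] e = \<one>" using tor xy by blast
    have "inv x \<otimes> y = inv (c [^] i) \<otimes> c [^] j"
      unfolding ij using f c by (simp add: inv_mult_group m_assoc)
    also have "\<dots> = c [^] (j - i)"
      using c int_pow_mult[of c "-i" j] by (simp add: int_pow_neg)
    finally have "c [^] ((j - i) * e) = \<one>" using e c by (simp add: int_pow_pow)
    then have "(j - i) * e = 0" using False by blast
    then show "x = y" using e ij by simp
  qed
  then show ?thesis by (metis finite.simps is_singletonI' is_singleton_the_elem)
qed

text \<open>If \<open>A\<close> is torsion it is finite. Otherwise let \<open>a\<close> have infinite order. For every \<open>x\<close>, two of the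
  elements \<open>x, x a, x a\<^sup>2, \<dots>\<close> lie in the same coset \<open>f \<langle>c\<rangle>\<close>, which makes \<open>\<langle>c\<rangle>\<close> commensurable with \<open>\<langle>a\<rangle>\<close>;
  so \<open>x\<close> lies in a coset of \<open>\<langle>a\<rangle>\<close> taken from a fixed finite set.\<close>
lemma finite_cosets_imp_virtually_cyclic:
  assumes A: "subgroup A G" and P: "finite P" "P \<subseteq> carrier G \<times> carrier G"
    and cov: "\<And>a. a \<in> A \<Longrightarrow> \<exists>p\<in>P. \<exists>j::int. a = fst p \<otimes> snd p [^] j"
  shows "\<exists>s\<in>A. \<exists>F. finite F \<and> F \<subseteq> carrier G \<and> (\<forall>a\<in>A. \<exists>f\<in>F. \<exists>n::int. a = f \<otimes> s [^] n)"
proof (cases "\<exists>a\<in>A. \<forall>l::int. a [^] l = \<one> \<longrightarrow> l = 0")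
  case False
  interpret A: subgroup A G by (rule A)
  have "A \<subseteq> (\<Union>p\<in>P. A \<inter> range (\<lambda>j::int. fst p \<otimes> snd p [^] j))"
  proof
    fix a assume a: "a \<in> A"
    then obtain p and j :: int where "p \<in> P" "a = fst p \<otimes> snd p [^] j" using cov by metis
    then show "a \<in> (\<Union>p\<in>P. A \<inter> range (\<lambda>j::int. fst p \<otimes> snd p [^] j))"
      using a by (intro UN_I[of p]) auto
  qed
  moreover have "finite (A \<inter> range (\<lambda>j::int. fst p \<otimes> snd p [^] j))" if "p \<in> P" for p
  proof (rule finite_coset_Int_torsion)
    show "\<exists>e::int. 0 < e \<and> (inv x \<otimes> y) [^] e = \<one>" if xy: "x \<in> A" "y \<in> A" for x y
    proof -
      have z: "inv x \<otimes> y \<in> A" using xy by simp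
      then obtain l :: int where l: "(inv x \<otimes> y) [^] l = \<one>" "l \<noteq> 0" using False by blast
      show ?thesis
      proof (cases "l > 0")
        case False
        have "(inv x \<otimes> y) [^] (- l) = \<one>" using l z by (subst int_pow_neg) auto
        then show ?thesis using False l by (intro exI[of _ "-l"]) auto
      qed (use l in blast)
    qed
  qed (use that P in \<open>auto\<close>)
  ultimately have "finite A" using P(1) by (meson finite_UN_I finite_subset)
  then show ?thesis
    using A.one_closed by (intro bexI[of _ \<one>] exI[of _ A]) auto
next
  case True
  interpret A: subgroup A G by (rule A)
  obtain a where aA: "a \<in> A" and inf: "\<And>l::int. a [^] l = \<one> \<Longrightarrow> l = 0" using True by blast
  have a: "a \<in> carrier G" using aA by simp
  \<comment> \<open>One relation \<open>c\<^sup>l = a\<^sup>d\<close> with \<open>l \<noteq> 0\<close> is fixed for each \<open>c\<close>, so that \<open>F\<close> does not depend on \<open>x\<close>.\<close>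
  define rel where "rel c ld \<longleftrightarrow> fst ld \<noteq> 0 \<and> c [^] (fst ld :: int) = a [^] (snd ld :: int)" for c ld
  define l where "l c = fst (SOME ld. rel c ld)" for c
  define d where "d c = snd (SOME ld. rel c ld)" for c
  define F where "F = (\<Union>p\<in>P. (\<lambda>(i, s). fst p \<otimes> snd p [^] i \<otimes> a [^] s) `
      ({0..\<bar>l (snd p)\<bar>} \<times> {- int (card P)..(0::int)}))"
  have FG: "F \<subseteq> carrier G" unfolding F_def using P a by force
  have finF: "finite F" unfolding F_def using P by auto
  have "\<exists>f\<in>F. \<exists>n::int. x = f \<otimes> a [^] n" if x: "x \<in> A" for x
  proof -
    have xG: "x \<in> carrier G" using x by simp
    have "x \<otimes> a [^] int s \<in> A" for s
      using x aA subgroup_int_pow_closed[OF A] by simp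
    then have "\<forall>s. \<exists>p. p \<in> P \<and> (\<exists>j::int. x \<otimes> a [^] int s = fst p \<otimes> snd p [^] j)"
      using cov by (simp add: Bex_def)
    then obtain p where "\<forall>s. p s \<in> P \<and> (\<exists>j::int. x \<otimes> a [^] int s = fst (p s) \<otimes> snd (p s) [^] j)"
      by (rule choice[THEN exE])
    then have p: "\<And>s. p s \<in> P"
      and "\<forall>s. \<exists>j::int. x \<otimes> a [^] int s = fst (p s) \<otimes> snd (p s) [^] j" by auto
    then obtain j where j: "\<And>s. x \<otimes> a [^] int s = fst (p s) \<otimes> snd (p s) [^] (j s :: int)"
      by (auto dest: choice)
    have "\<not> inj_on p {..card P}"
      using p P(1) card_inj_on_le[of p "{..card P}" P] by fastforce
    then obtain s s' where s: "s \<le> card P" "s' \<le> card P" "s \<noteq> s'" "p s = p s'"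
      by (auto simp: inj_on_def)
    define f c where "f = fst (p s)" and "c = snd (p s)"
    then have fc: "fst (p s) = f" "snd (p s) = c" "fst (p s') = f" "snd (p s') = c" using s(4) by auto
    have fcG: "f \<in> carrier G" "c \<in> carrier G" using p[of s] P(2) fc by auto
    have "inv (x \<otimes> a [^] int s) \<otimes> (x \<otimes> a [^] int s') = inv (f \<otimes> c [^] j s) \<otimes> (f \<otimes> c [^] j s')"
      by (simp only: j fc)
    then have "inv (a [^] int s) \<otimes> a [^] int s' = inv (c [^] j s) \<otimes> c [^] j s'"
      using xG a fcG by (simp add: inv_mult_group m_assoc)
    then have "a [^] (int s' - int s) = c [^] (j s' - j s)"
      using int_pow_mult[OF a, of "- int s" "int s'"] int_pow_mult[OF fcG(2), of "- j s" "j s'"] a fcG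
      by (simp add: int_pow_neg)
    moreover from this have "j s' - j s \<noteq> 0" using inf[of "int s' - int s"] s(3) by auto
    ultimately have "rel c (j s' - j s, int s' - int s)" unfolding rel_def by simp
    then have "rel c (SOME ld. rel c ld)" by (rule someI)
    then have lc: "l c \<noteq> 0" "c [^] l c = a [^] d c" unfolding rel_def l_def d_def by auto
    define q i where "q = j s div \<bar>l c\<bar> * sgn (l c)" and "i = j s mod \<bar>l c\<bar>"
    have i: "0 \<le> i" "i \<le> \<bar>l c\<bar>" using lc pos_mod_bound[of "\<bar>l c\<bar>" "j s"] unfolding i_def by (auto simp: less_imp_le)
    have js: "j s = i + l c * q"
      unfolding i_def q_def using div_mult_mod_eq[of "j s" "\<bar>l c\<bar>"]
      by (simp add: abs_sgn algebra_simps)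
    have "c [^] j s = c [^] i \<otimes> a [^] (d c * q)"
      unfolding js using fcG a lc(2) by (simp add: int_pow_mult flip: int_pow_pow)
    then have "x \<otimes> a [^] int s = f \<otimes> c [^] i \<otimes> a [^] (d c * q)"
      using j[of s] fc fcG a by (simp add: m_assoc)
    then have "x = f \<otimes> c [^] i \<otimes> a [^] (d c * q) \<otimes> a [^] (- int s)"
      using xG a fcG by (metis int_pow_closed int_pow_neg inv_solve_right m_closed)
    also have "\<dots> = f \<otimes> c [^] i \<otimes> a [^] (- int s) \<otimes> a [^] (d c * q)"
      using fcG a by (simp add: m_assoc add.commute flip: int_pow_mult)
    finally have "x = f \<otimes> c [^] i \<otimes> a [^] (- int s) \<otimes> a [^] (d c * q)" .
    moreover have "f \<otimes> c [^] i \<otimes> a [^] (- int s) \<in> F"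
      unfolding F_def using i s p[of s] fc by (intro UN_I[of "p s"] image_eqI[of _ _ "(i, - int s)"]) auto
    ultimately show ?thesis by blast
  qed
  then show ?thesis using aA finF FG by blast
qed

end

section \<open>Abelian by virtually cyclic groups\<close>

locale abelian_by_virtually_cyclic = normal A G for A and G (structure) +
  fixes t :: 'a and R :: "'a set" and P :: "('a \<times> 'a) set" and m :: int
  assumes abelian: "\<And>x y. x \<in> A \<Longrightarrow> y \<in> A \<Longrightarrow> x \<otimes> y = y \<otimes> x"
    and t [simp]: "t \<in> carrier G" and R: "finite R" "R \<subseteq> carrier G"
    and gen: "\<And>g. g \<in> carrier G \<Longrightarrow> \<exists>r\<in>R. \<exists>n::int. \<exists>a\<in>A. g = r \<otimes> t [^] n \<otimes> a"
    and cover: "cyclic_cosets_cover G P m"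
begin

text \<open>Adding the conjugates by \<open>R\<close> to the list \<open>P\<close> allows one to conjugate by elements of \<open>\<langle>t\<rangle> A\<close> only.\<close>
definition Q :: "('a \<times> 'a) set" where
  "Q = (\<lambda>(r, p). (conj_by (inv r) (fst p), conj_by (inv r) (snd p))) ` (R \<times> P)"

lemma finite_Q: "finite Q" and Q_carrier: "Q \<subseteq> carrier G \<times> carrier G" and m_pos: "0 < m"
  using cover R unfolding Q_def cyclic_cosets_cover_def by (auto simp: subset_iff)

lemma Q_cover:
  assumes x: "x \<in> carrier G"
  obtains n :: int and a p and j j' :: int where "a \<in> A" "p \<in> Q"
    "conj_by (t [^] n \<otimes> a) x = fst p \<otimes> snd p [^] j"
    "(fst p \<otimes> snd p [^] j) [^] m = snd p [^] j'"
proof -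
  obtain y p and j j' :: int where y: "y \<in> carrier G" and p: "p \<in> P"
    and eq: "conj_by y x = fst p \<otimes> snd p [^] j" "(fst p \<otimes> snd p [^] j) [^] m = snd p [^] j'"
    using cover x unfolding cyclic_cosets_cover_def conj_by_def by blast
  obtain r and n :: int and a where r: "r \<in> R" "a \<in> A" "y = r \<otimes> t [^] n \<otimes> a"
    using gen[OF y] by blast
  have rG: "r \<in> carrier G" using r R by blast
  have pG: "fst p \<in> carrier G" "snd p \<in> carrier G" using p cover unfolding cyclic_cosets_cover_def by auto
  define p' where "p' = (conj_by (inv r) (fst p), conj_by (inv r) (snd p))"
  have "p' \<in> Q" unfolding Q_def p'_def using r p by force
  moreover have *: "fst p' \<otimes> snd p' [^] j = conj_by (inv r) (fst p \<otimes> snd p [^] j)"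
    unfolding p'_def using rG pG by (simp add: conj_by_mult conj_by_int_pow)
  moreover have "conj_by (t [^] n \<otimes> a) x = conj_by (inv r) (conj_by y x)"
    using r(2,3) rG x by (simp add: conj_by_conj_by m_assoc)
  moreover have "(fst p' \<otimes> snd p' [^] j) [^] m = snd p' [^] j'"
    unfolding * using rG pG by (simp add: eq(2) p'_def flip: conj_by_int_pow)
  ultimately show ?thesis using that r(2) eq by metis
qed

lemma conj_by_A: "g \<in> carrier G \<Longrightarrow> a \<in> A \<Longrightarrow> conj_by g a \<in> A"
  unfolding conj_by_def by (rule inv_op_closed2)

lemma Q_cover_A:
  assumes a: "a \<in> A"
  obtains n :: int and p and j j' :: int where "p \<in> Q" "conj_by (t [^] n) a = fst p \<otimes> snd p [^] j"
    "(fst p \<otimes> snd p [^] j) [^] m = snd p [^] j'"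
proof -
  obtain n :: int and b p and j j' :: int where b: "b \<in> A" "p \<in> Q"
    and eq: "conj_by (t [^] n \<otimes> b) a = fst p \<otimes> snd p [^] j"
    "(fst p \<otimes> snd p [^] j) [^] m = snd p [^] j'"
    by (rule Q_cover[OF mem_carrier[OF a]])
  have "conj_by (t [^] n \<otimes> b) a = conj_by (t [^] n) (conj_by b a)" using a b by (simp add: conj_by_conj_by)
  also have "conj_by b a = a" using abelian a b by (intro conj_by_commute) auto
  finally show ?thesis using that b eq by metis
qed

text \<open>On \<open>A\<close>, conjugation by \<open>\<langle>t\<rangle> A\<close> amounts to conjugation by the \<open>k\<close> elements \<open>1, t, \<dots>, t\<^bsup>k-1\<^esup>\<close>. Conjugating the
  list once more by these, \<open>A\<close> itself becomes a finite union of cosets of cyclic groups.\<close>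
lemma virtually_cyclic_if_power_in_A:
  assumes k: "0 < (k::int)" "t [^] k \<in> A"
  shows "virtually_cyclic_over G {\<one>}"
proof -
  define P' where "P' = (\<lambda>(i, p). (conj_by (t [^] (- i)) (fst p), conj_by (t [^] (- i)) (snd p))) ` ({0..<k} \<times> Q)"
  have "finite P'" "P' \<subseteq> carrier G \<times> carrier G"
    unfolding P'_def using finite_Q Q_carrier by auto
  moreover have "\<exists>p\<in>P'. \<exists>j::int. a = fst p \<otimes> snd p [^] j" if a: "a \<in> A" for a
  proof -
    obtain n :: int and p and j j' :: int where p: "p \<in> Q" "conj_by (t [^] n) a = fst p \<otimes> snd p [^] j"
      "(fst p \<otimes> snd p [^] j) [^] m = snd p [^] j'"
      by (rule Q_cover_A[OF a])
    have pG: "fst p \<in> carrier G" "snd p \<in> carrier G" using p(1) Q_carrier by auto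
    have tk: "(t [^] k) [^] (n div k) \<in> A" by (rule subgroup_int_pow_closed[OF subgroup_axioms k(2)])
    have "t [^] n = t [^] (n mod k) \<otimes> (t [^] k) [^] (n div k)"
      by (simp add: int_pow_pow flip: int_pow_mult)
    then have "conj_by (t [^] n) a = conj_by (t [^] (n mod k)) (conj_by ((t [^] k) [^] (n div k)) a)"
      using a by (simp add: conj_by_conj_by)
    also have "conj_by ((t [^] k) [^] (n div k)) a = a" using a tk abelian by (intro conj_by_commute) auto
    finally have "a = conj_by (inv (t [^] (n mod k))) (fst p \<otimes> snd p [^] j)"
      using a p(2) by (metis conj_by_inv_cancel int_pow_closed mem_carrier t)
    then have "a = conj_by (t [^] (- (n mod k))) (fst p) \<otimes> conj_by (t [^] (- (n mod k))) (snd p) [^] j"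
      using pG by (simp add: conj_by_mult conj_by_int_pow int_pow_neg)
    moreover have "(conj_by (t [^] (- (n mod k))) (fst p), conj_by (t [^] (- (n mod k))) (snd p)) \<in> P'"
      unfolding P'_def using p(1) k(1) by (intro image_eqI[of _ _ "(n mod k, p)"]) auto
    ultimately show ?thesis by force
  qed
  ultimately obtain s F where s: "s \<in> A" and F: "finite F" "F \<subseteq> carrier G"
    and sF: "\<And>a. a \<in> A \<Longrightarrow> \<exists>f\<in>F. \<exists>n::int. a = f \<otimes> s [^] n"
    using finite_cosets_imp_virtually_cyclic[OF subgroup_axioms] by metis
  define R' where "R' = (\<lambda>(r, i, f). r \<otimes> t [^] i \<otimes> f) ` (R \<times> {0..<k} \<times> F)"
  have "\<exists>r\<in>R'. \<exists>n::int. \<exists>a\<in>{\<one>}. g = r \<otimes> s [^] n \<otimes> a" if g: "g \<in> carrier G" for g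
  proof -
    obtain r and n :: int and a where r: "r \<in> R" "a \<in> A" "g = r \<otimes> t [^] n \<otimes> a"
      using gen[OF g] by blast
    have tk: "(t [^] k) [^] (n div k) \<in> A" by (rule subgroup_int_pow_closed[OF subgroup_axioms k(2)])
    then have "(t [^] k) [^] (n div k) \<otimes> a \<in> A" using r by simp
    then obtain f and l :: int where f: "f \<in> F" "(t [^] k) [^] (n div k) \<otimes> a = f \<otimes> s [^] l" using sF by blast
    have fG: "f \<in> carrier G" "r \<in> carrier G" using f F r R by auto
    have "t [^] n = t [^] (n mod k) \<otimes> (t [^] k) [^] (n div k)"
      by (simp add: int_pow_pow flip: int_pow_mult)
    then have "g = r \<otimes> t [^] (n mod k) \<otimes> ((t [^] k) [^] (n div k) \<otimes> a)"
      unfolding r(3) using r(2) fG by (simp add: m_assoc)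
    then have "g = (r \<otimes> t [^] (n mod k) \<otimes> f) \<otimes> s [^] l \<otimes> \<one>"
      unfolding f(2) using fG s by (simp add: m_assoc)
    moreover have "r \<otimes> t [^] (n mod k) \<otimes> f \<in> R'"
      unfolding R'_def using r(1) f(1) k(1) by (intro image_eqI[of _ _ "(r, n mod k, f)"]) auto
    ultimately show ?thesis by blast
  qed
  moreover have "finite R'" "R' \<subseteq> carrier G" unfolding R'_def using R F by (auto simp: subset_iff)
  ultimately show ?thesis using s by (intro virtually_cyclic_overI[of s G R']) simp_all
qed

end

locale abelian_by_infinite_cyclic = abelian_by_virtually_cyclic +
  assumes indep: "\<And>k::int. t [^] k \<in> A \<Longrightarrow> k = 0"
begin

definition \<pi> :: "'a \<Rightarrow> 'a set" where "\<pi> x = A #> x"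

lemma group_hom_\<pi>: "group_hom G (G Mod A) \<pi>"
proof (intro group_hom.intro group_hom_axioms.intro is_group factorgroup_is_group)
  have "\<pi> = (\<lambda>a. A #> a)" by (simp add: fun_eq_iff \<pi>_def)
  then show "\<pi> \<in> hom G (G Mod A)" using r_coset_hom_Mod by simp
qed

lemma \<pi>_eq_one_iff: "x \<in> carrier G \<Longrightarrow> \<pi> x = \<one>\<^bsub>G Mod A\<^esub> \<longleftrightarrow> x \<in> A"
  unfolding \<pi>_def one_FactGroup by (meson coset_join1 coset_join2 subgroup_axioms)

lemma \<pi>_A: "a \<in> A \<Longrightarrow> \<pi> a = \<one>\<^bsub>G Mod A\<^esub>"
  using \<pi>_eq_one_iff by simp

text \<open>A pair whose coset meets \<open>A t\<^sup>n\<close> for some \<open>n > 0\<close> has \<open>c\<close> of infinite order modulo \<open>A\<close>, because a power of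
  \<open>f c\<^sup>j\<close> lies in \<open>\<langle>c\<rangle>\<close>. Hence \<open>f \<langle>c\<rangle>\<close> meets \<open>A t\<^sup>n\<close> only once.\<close>
lemma unique_exponent:
  assumes n: "0 < n" and p: "p \<in> Q" and j: "(fst p \<otimes> snd p [^] (j::int)) [^] m = snd p [^] (j'::int)"
    and \<pi>: "\<pi> (fst p \<otimes> snd p [^] j) = \<pi> (t [^] (n::int))" "\<pi> (fst p \<otimes> snd p [^] (i::int)) = \<pi> (t [^] n)"
  shows "i = j"
proof -
  interpret \<pi>: group_hom G "G Mod A" \<pi> by (rule group_hom_\<pi>)
  have pG: "fst p \<in> carrier G" "snd p \<in> carrier G" using p Q_carrier by auto
  define c where "c = snd p"
  have cG: "c \<in> carrier G" using pG c_def by simp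
  have "\<pi> (fst p) \<otimes>\<^bsub>G Mod A\<^esub> \<pi> (c [^] i) = \<pi> (fst p) \<otimes>\<^bsub>G Mod A\<^esub> \<pi> (c [^] j)"
    using \<pi> pG by (simp add: c_def)
  then have "\<pi> (c [^] i) = \<pi> (c [^] j)" using pG cG by (simp del: mult_FactGroup)
  then have "\<pi> (c [^] (i - j)) = \<one>\<^bsub>G Mod A\<^esub>"
    using cG by (simp add: int_pow_diff del: mult_FactGroup one_FactGroup)
  then have ck: "\<pi> c [^]\<^bsub>G Mod A\<^esub> (i - j) = \<one>\<^bsub>G Mod A\<^esub>"
    using cG by (simp add: \<pi>.hom_int_pow del: one_FactGroup)
  have "\<pi> (t [^] (n * m)) = \<pi> (fst p \<otimes> snd p [^] j) [^]\<^bsub>G Mod A\<^esub> m"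
    unfolding \<pi>(1) by (simp add: int_pow_pow flip: \<pi>.hom_int_pow)
  also have "\<dots> = \<pi> ((fst p \<otimes> snd p [^] j) [^] m)"
    using pG by (simp only: \<pi>.hom_int_pow m_closed int_pow_closed)
  also have "\<dots> = \<pi> (c [^] j')" by (simp only: j c_def)
  finally have "\<pi> (t [^] (n * m)) [^]\<^bsub>G Mod A\<^esub> (i - j) = \<pi> (c [^] j') [^]\<^bsub>G Mod A\<^esub> (i - j)" by simp
  also have "\<dots> = (\<pi> c [^]\<^bsub>G Mod A\<^esub> (i - j)) [^]\<^bsub>G Mod A\<^esub> j'"
    using cG by (simp only: \<pi>.hom_int_pow \<pi>.H.int_pow_pow \<pi>.hom_closed) (simp add: mult.commute)
  also have "\<dots> = \<one>\<^bsub>G Mod A\<^esub>" by (simp only: ck \<pi>.H.int_pow_one)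
  finally have "\<pi> (t [^] (n * m * (i - j))) = \<one>\<^bsub>G Mod A\<^esub>"
    by (simp add: int_pow_pow flip: \<pi>.hom_int_pow)
  then have "t [^] (n * m * (i - j)) \<in> A" using \<pi>_eq_one_iff by simp
  then have "n * m * (i - j) = 0" by (rule indep)
  then show "i = j" using n m_pos by simp
qed

text \<open>The elements \<open>a\<^sup>i t\<^sup>n\<close> fall into at most \<open>card Q\<close> conjugacy classes under \<open>\<langle>t\<rangle> A\<close>. Recording also the power of \<open>t\<close>
  used for conjugation modulo \<open>n\<close>, two of them with \<open>i < i' \<le> n card Q\<close> are conjugate by some \<open>w\<close> in \<open>t\<^bsup>n q\<^esup> A\<close>.
  Since \<open>w\<close> may be multiplied by a power of \<open>a\<^bsup>i'\<^esup> t\<^sup>n\<close>, they are conjugate by an element \<open>b\<close> of \<open>A\<close>, and this says that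
  \<open>a\<^bsup>i'-i\<^esup>\<close> is the quotient of \<open>t\<^sup>n b t\<^bsup>-n\<^esup>\<close> by \<open>b\<close>.\<close>
lemma growth:
  assumes n: "0 < n" and a: "a \<in> A"
  shows "\<exists>e. \<exists>b\<in>A. 1 \<le> e \<and> e \<le> int (card Q) * int n \<and> a [^] e \<otimes> b = conj_by (t [^] int n) b"
proof -
  interpret \<pi>: group_hom G "G Mod A" \<pi> by (rule group_hom_\<pi>)
  define x where "x i = a [^] int i \<otimes> t [^] int n" for i
  have aG [simp]: "a \<in> carrier G" using a by simp
  have xG [simp]: "x i \<in> carrier G" for i unfolding x_def by simp
  have \<pi>x: "\<pi> (x i) = \<pi> (t [^] int n)" for i
  proof -
    have "\<pi> (a [^] int i) = \<one>\<^bsub>G Mod A\<^esub>"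
      using \<pi>_A subgroup_int_pow_closed[OF subgroup_axioms a] by blast
    then show ?thesis unfolding x_def by (simp del: mult_FactGroup one_FactGroup)
  qed
  have "\<exists>y. \<exists>l::int. \<exists>p j. \<exists>j'::int. y \<in> carrier G \<and> \<pi> y = \<pi> (t [^] l) \<and> p \<in> Q \<and>
      conj_by y (x i) = fst p \<otimes> snd p [^] (j::int) \<and> (fst p \<otimes> snd p [^] j) [^] m = snd p [^] j'" for i
  proof -
    obtain l :: int and b p and j j' :: int where b: "b \<in> A" "p \<in> Q"
      "conj_by (t [^] l \<otimes> b) (x i) = fst p \<otimes> snd p [^] j"
      "(fst p \<otimes> snd p [^] j) [^] m = snd p [^] j'"
      by (rule Q_cover[OF xG])
    moreover have "\<pi> (t [^] l \<otimes> b) = \<pi> (t [^] l)"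
      using \<pi>_A[OF b(1)] b(1) by (simp del: mult_FactGroup one_FactGroup)
    moreover have "t [^] l \<otimes> b \<in> carrier G" using b by simp
    ultimately show ?thesis by blast
  qed
  then obtain y l p j j' where y: "\<And>i. y i \<in> carrier G" "\<And>i. \<pi> (y i) = \<pi> (t [^] (l i :: int))"
    and p: "\<And>i. p i \<in> Q" and eq: "\<And>i. conj_by (y i) (x i) = fst (p i) \<otimes> snd (p i) [^] (j i :: int)"
    and eqm: "\<And>i. (fst (p i) \<otimes> snd (p i) [^] j i) [^] m = snd (p i) [^] (j' i :: int)"
    by metis
  define N where "N = card Q * n"
  have "card (Q \<times> {0..<int n}) = N" unfolding N_def by (simp add: card_cartesian_product)
  moreover have "(\<lambda>i. (p i, l i mod int n)) ` {..N} \<subseteq> Q \<times> {0..<int n}" using p n by auto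
  ultimately have "\<not> inj_on (\<lambda>i. (p i, l i mod int n)) {..N}"
    using card_inj_on_le[of "\<lambda>i. (p i, l i mod int n)" "{..N}" "Q \<times> {0..<int n}"] finite_Q by fastforce
  then obtain i0 i1 where "i0 \<le> N" "i1 \<le> N" "i0 \<noteq> i1" "p i0 = p i1" "l i0 mod int n = l i1 mod int n"
    by (auto simp: inj_on_def)
  then obtain i i' where i: "i < i'" "i' \<le> N" "p i = p i'" "l i mod int n = l i' mod int n"
    by (metis linorder_neqE_nat)
  have \<pi>z: "\<pi> (fst (p k) \<otimes> snd (p k) [^] j k) = \<pi> (t [^] int n)" for k
  proof -
    have "\<pi> (fst (p k) \<otimes> snd (p k) [^] j k) = \<pi> (y k) \<otimes>\<^bsub>G Mod A\<^esub> \<pi> (x k) \<otimes>\<^bsub>G Mod A\<^esub> inv\<^bsub>G Mod A\<^esub> \<pi> (y k)"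
      unfolding eq[symmetric] conj_by_def using y(1) by (simp del: mult_FactGroup)
    also have "\<dots> = \<pi> (conj_by (t [^] l k) (t [^] int n))"
      unfolding y(2) \<pi>x conj_by_def by (simp del: mult_FactGroup)
    also have "conj_by (t [^] l k) (t [^] int n) = t [^] int n"
      by (intro conj_by_commute) (simp_all add: add.commute flip: int_pow_mult)
    finally show ?thesis .
  qed
  have "j i' = j i"
  proof (rule unique_exponent[OF _ p[of i] eqm[of i] \<pi>z[of i]])
    show "0 < int n" using n by simp
    show "\<pi> (fst (p i) \<otimes> snd (p i) [^] j i') = \<pi> (t [^] int n)" using \<pi>z[of i'] i(3) by simp
  qed
  then have conj_eq: "conj_by (y i) (x i) = conj_by (y i') (x i')" using eq i(3) by simp
  define w where "w = inv (y i) \<otimes> y i'"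
  have wG: "w \<in> carrier G" unfolding w_def using y(1) by simp
  have wx: "conj_by w (x i') = x i"
  proof -
    have "conj_by w (x i') = conj_by (inv (y i)) (conj_by (y i') (x i'))"
      unfolding w_def using y(1) by (simp add: conj_by_conj_by)
    then show ?thesis using y(1) by (simp flip: conj_eq)
  qed
  have "int n dvd l i' - l i" using i(4) by (metis mod_eq_dvd_iff)
  then obtain q where q: "l i' - l i = int n * q" by blast
  define b where "b = w \<otimes> inv (x i' [^] q)"
  have bG: "b \<in> carrier G" unfolding b_def using wG by simp
  have "\<pi> w = \<pi> (t [^] (l i' - l i))"
    unfolding w_def using y(1) int_pow_mult[OF t, of "- l i" "l i'"]
    by (simp add: y(2) int_pow_neg del: mult_FactGroup)
  moreover have "\<pi> (x i' [^] q) = \<pi> (t [^] (int n * q))"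
    by (simp add: \<pi>.hom_int_pow \<pi>x flip: int_pow_pow)
  ultimately have "\<pi> b = \<one>\<^bsub>G Mod A\<^esub>"
    unfolding b_def using wG by (simp add: q del: mult_FactGroup one_FactGroup)
  then have bA: "b \<in> A" using \<pi>_eq_one_iff bG by simp
  have "w = b \<otimes> x i' [^] q" unfolding b_def using wG by (simp add: m_assoc)
  then have "conj_by w (x i') = conj_by b (conj_by (x i' [^] q) (x i'))" using bG by (simp add: conj_by_conj_by)
  also have "conj_by (x i' [^] q) (x i') = x i'"
    using int_pow_mult[OF xG, of i' q 1] int_pow_mult[OF xG, of i' 1 q]
    by (intro conj_by_commute) (simp_all add: add.commute)
  finally have bx: "b \<otimes> x i' = x i \<otimes> b" using wx bG by (metis conj_by_def inv_solve_right m_closed xG)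
  have ai: "a [^] int i' = a [^] int i \<otimes> a [^] (int i' - int i)" by (simp flip: int_pow_mult)
  have aA: "a [^] (k::int) \<in> A" for k by (rule subgroup_int_pow_closed[OF subgroup_axioms a])
  define \<tau>b where "\<tau>b = conj_by (t [^] int n) b"
  have \<tau>bA: "\<tau>b \<in> A" unfolding \<tau>b_def using bA by (simp add: conj_by_A)
  have "a [^] int i \<otimes> (b \<otimes> a [^] (int i' - int i)) \<otimes> t [^] int n = b \<otimes> x i'"
    unfolding x_def ai using abelian[OF bA aA[of "int i"]] bG by (simp flip: m_assoc)
  also have "\<dots> = a [^] int i \<otimes> \<tau>b \<otimes> t [^] int n"
    unfolding bx unfolding x_def \<tau>b_def conj_by_def using bG by (simp add: m_assoc)
  finally have "b \<otimes> a [^] (int i' - int i) = \<tau>b"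
    using bG \<tau>bA by simp
  then have "a [^] (int i' - int i) \<otimes> b = conj_by (t [^] int n) b"
    using abelian[OF bA aA] unfolding \<tau>b_def by simp
  moreover have "1 \<le> int i' - int i" using i by simp
  moreover have "int i' - int i \<le> int (card Q) * int n" using i(2) unfolding N_def by (simp flip: of_nat_mult)
  ultimately show ?thesis using bA by blast
qed

text \<open>The \<open>m\<close>-th powers of elements of \<open>A\<close> are conjugate into \<open>A \<inter> \<langle>c\<rangle>\<close>, which is generated by the least positive
  power of \<open>c\<close> that lies in \<open>A\<close>, or trivial.\<close>
lemma line_cover:
  "\<exists>C. finite C \<and> C \<subseteq> A \<and> (\<forall>a\<in>A. \<exists>c\<in>C. \<exists>(p::nat) (q::nat) (j::int).
     conj_by (t [^] int p) (a [^] m) = conj_by (t [^] int q) (c [^] j))"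
proof -
  define k where "k c = (if \<exists>k>0. c [^] int k \<in> A then LEAST k. 0 < k \<and> c [^] int k \<in> A else 0)" for c
  define C where "C = (\<lambda>p. snd p [^] int (k (snd p))) ` Q"
  have k: "c [^] int (k c) \<in> A" for c
  proof (cases "\<exists>k>0. c [^] int k \<in> A")
    case True
    then show ?thesis using LeastI_ex[OF True] unfolding k_def by simp
  next
    case False
    then have "k c = 0" unfolding k_def by (rule if_not_P)
    then show ?thesis by simp
  qed
  have dvd: "int (k c) dvd j" if c: "c \<in> carrier G" "c [^] j \<in> A" for c and j :: int
  proof (cases "\<exists>k>0. c [^] int k \<in> A")
    case True
    then have k0: "0 < k c" using LeastI_ex[OF True] unfolding k_def by simp
    have "c [^] (j - int (k c) * (j div int (k c))) = c [^] j \<otimes> inv ((c [^] int (k c)) [^] (j div int (k c)))"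
      using c by (simp add: int_pow_diff int_pow_pow)
    also have "\<dots> \<in> A" using c k[of c] subgroup_int_pow_closed[OF subgroup_axioms k] by simp
    finally have "c [^] int (nat (j mod int (k c))) \<in> A" using k0 by (simp add: minus_mult_div_eq_mod)
    moreover have "nat (j mod int (k c)) < k c" using k0 by (simp add: nat_less_iff)
    ultimately have "nat (j mod int (k c)) = 0"
      using not_less_Least[of "nat (j mod int (k c))" "\<lambda>k. 0 < k \<and> c [^] int k \<in> A"] True
      unfolding k_def by auto
    then have "j mod int (k c) = 0" using pos_mod_sign[of "int (k c)" j] k0 by linarith
    then show ?thesis by (rule mod_0_imp_dvd)
  next
    case False
    have "j = 0"
    proof (rule ccontr)
      assume "j \<noteq> 0"
      have "c [^] int (nat \<bar>j\<bar>) \<in> A"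
        using c by (cases "j > 0") (auto simp: int_pow_neg)
      then show False using False \<open>j \<noteq> 0\<close> by (metis zero_less_abs_iff zero_less_nat_eq)
    qed
    then show ?thesis by simp
  qed
  have "\<exists>c\<in>C. \<exists>(p::nat) (q::nat) (j::int). conj_by (t [^] int p) (a [^] m) = conj_by (t [^] int q) (c [^] j)"
    if a: "a \<in> A" for a
  proof -
    obtain n :: int and p and j j' :: int where p: "p \<in> Q" "conj_by (t [^] n) a = fst p \<otimes> snd p [^] j"
      "(fst p \<otimes> snd p [^] j) [^] m = snd p [^] j'"
      by (rule Q_cover_A[OF a])
    have aG: "a \<in> carrier G" using a by simp
    have cG: "snd p \<in> carrier G" using p(1) Q_carrier by auto
    have am: "conj_by (t [^] n) (a [^] m) = snd p [^] j'"
      using p(2,3) aG by (simp add: conj_by_int_pow)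
    have "a [^] m \<in> A" by (rule subgroup_int_pow_closed[OF subgroup_axioms a])
    then have "snd p [^] j' \<in> A" using conj_by_A[of "t [^] n"] am by (metis int_pow_closed t)
    then obtain s where s: "j' = int (k (snd p)) * s" using dvd cG by blast
    define c where "c = snd p [^] int (k (snd p))"
    have c: "c \<in> C" "c \<in> carrier G" unfolding C_def c_def using p(1) cG by auto
    have am': "conj_by (t [^] n) (a [^] m) = c [^] s" unfolding am s c_def using cG by (simp add: int_pow_pow)
    show ?thesis
    proof (cases "0 \<le> n")
      case True
      then have "conj_by (t [^] int (nat n)) (a [^] m) = conj_by (t [^] int 0) (c [^] s)"
        using am' c by simp
      then show ?thesis using c by blast
    next
      case False
      have "conj_by (t [^] int 0) (a [^] m) = conj_by (inv (t [^] n)) (conj_by (t [^] n) (a [^] m))" using aG by simp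
      also have "\<dots> = conj_by (t [^] int (nat (- n))) (c [^] s)" using False by (simp add: am' int_pow_neg)
      finally show ?thesis using c by blast
    qed
  qed
  moreover have "finite C" "C \<subseteq> A" unfolding C_def using finite_Q k by auto
  ultimately show ?thesis by blast
qed

end

lemma (in normal) abelian_endo_conj_by:
  assumes t: "t \<in> carrier G" and H': "subgroup B G" "B \<subseteq> H"
    and ab: "\<And>x y. x \<in> H \<Longrightarrow> y \<in> H \<Longrightarrow> x \<otimes> y = y \<otimes> x"
    and inv: "\<And>x. x \<in> B \<Longrightarrow> conj_by t x \<in> B"
  shows "abelian_endo (G\<lparr>carrier := B\<rparr>) (conj_by t)"
proof (intro abelian_endo.intro abelian_endo_axioms.intro)
  show "comm_group (G\<lparr>carrier := B\<rparr>)"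
    using subgroup_imp_group[OF H'(1)] ab H'(2) by (intro group.group_comm_groupI) (auto simp: subset_iff)
  show "conj_by t \<in> hom (G\<lparr>carrier := B\<rparr>) (G\<lparr>carrier := B\<rparr>)"
    using inv t subgroup.subset[OF H'(1)] by (auto simp: hom_def conj_by_mult subset_iff)
  show "inj_on (conj_by t) (carrier (G\<lparr>carrier := B\<rparr>))"
    using inj_on_subset[OF inj_conj_by[OF t]] subgroup.subset[OF H'(1)] by simp
qed

context abelian_by_infinite_cyclic
begin

text \<open>The torsion elements of \<open>A\<close> are conjugate into a finite set, since they meet each coset of a cyclic
  group in a finite set.\<close>
lemma bounded_torsion:
  "\<exists>E::int. 0 < E \<and> (\<forall>a\<in>A. (\<exists>e::int. 0 < e \<and> a [^] e = \<one>) \<longrightarrow> a [^] E = \<one>)"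
proof -
  define T where "T = {a \<in> A. \<exists>e::int. 0 < e \<and> a [^] e = \<one>}"
  define D where "D = (\<Union>p\<in>Q. T \<inter> range (\<lambda>j::int. fst p \<otimes> snd p [^] j))"
  have TG: "T \<subseteq> carrier G" unfolding T_def by auto
  have "finite (T \<inter> range (\<lambda>j::int. fst p \<otimes> snd p [^] j))" if p: "p \<in> Q" for p
  proof (rule finite_coset_Int_torsion[OF _ _ TG])
    fix x y assume xy: "x \<in> T" "y \<in> T"
    then obtain e e' :: int where e: "0 < e" "x [^] e = \<one>" "0 < e'" "y [^] e' = \<one>"
      unfolding T_def by auto
    have xyA: "x \<in> A" "y \<in> A" using xy unfolding T_def by auto
    then have G: "x \<in> carrier G" "y \<in> carrier G" by auto
    have "(inv x \<otimes> y) [^] (e * e') = inv x [^] (e * e') \<otimes> y [^] (e' * e)"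
      using G abelian[of "inv x" y] xyA by (subst int_pow_mult_distrib) (simp_all add: mult.commute)
    also have "\<dots> = inv ((x [^] e) [^] e') \<otimes> (y [^] e') [^] e"
      using G by (simp add: int_pow_inv int_pow_pow)
    also have "\<dots> = \<one>" unfolding e by simp
    finally show "\<exists>e::int. 0 < e \<and> (inv x \<otimes> y) [^] e = \<one>"
      using e by (intro exI[of _ "e * e'"]) simp
  qed (use p Q_carrier in auto)
  then have finD: "finite D" unfolding D_def using finite_Q by blast
  have "\<forall>d\<in>D. \<exists>e::int. 0 < e \<and> d [^] e = \<one>" unfolding D_def T_def by blast
  then obtain ord where ord: "\<And>d. d \<in> D \<Longrightarrow> 0 < ord d \<and> d [^] (ord d :: int) = \<one>" by metis
  define E where "E = (\<Prod>d\<in>D. ord d)"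
  have E: "0 < E" unfolding E_def using ord by (intro prod_pos) auto
  have dE: "d [^] E = \<one>" if d: "d \<in> D" for d
  proof -
    have dG: "d \<in> carrier G" using d TG unfolding D_def by auto
    have "E = ord d * (\<Prod>d\<in>D - {d}. ord d)" unfolding E_def using finD d by (rule prod.remove)
    then have "d [^] E = (d [^] ord d) [^] (\<Prod>d\<in>D - {d}. ord d)" using dG by (simp add: int_pow_pow)
    then show ?thesis using ord[OF d] by simp
  qed
  have "a [^] E = \<one>" if a: "a \<in> A" "0 < e" "a [^] e = \<one>" for a and e :: int
  proof -
    obtain n :: int and p and j j' :: int where p: "p \<in> Q" "conj_by (t [^] n) a = fst p \<otimes> snd p [^] j"
      "(fst p \<otimes> snd p [^] j) [^] m = snd p [^] j'"
      by (rule Q_cover_A[OF a(1)])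
    have aG: "a \<in> carrier G" using a by simp
    define d where "d = conj_by (t [^] n) a"
    have "d [^] e = \<one>" unfolding d_def using aG a(3) by (simp flip: conj_by_int_pow) (simp add: conj_by_def)
    then have "d \<in> T" unfolding T_def using a conj_by_A[of "t [^] n" a] d_def by auto
    then have "d \<in> D" unfolding D_def d_def using p(1,2) by auto
    then have "conj_by (t [^] n) (a [^] E) = \<one>" using dE aG unfolding d_def by (simp add: conj_by_int_pow)
    then have "a [^] E = conj_by (inv (t [^] n)) \<one>" using aG by (metis conj_by_inv_cancel int_pow_closed t)
    then show ?thesis by (simp add: conj_by_def)
  qed
  then show ?thesis using E by blast
qed

text \<open>The subgroup \<open>B\<close> of \<open>E\<close>-th powers is torsion free and inherits both counting properties of \<open>A\<close>.\<close>
lemma bounded_exponent: "\<exists>E::int. 0 < E \<and> (\<forall>a\<in>A. a [^] E = \<one>)"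
proof -
  obtain E :: int where E: "0 < E" and tor: "\<And>a e. a \<in> A \<Longrightarrow> 0 < (e::int) \<Longrightarrow> a [^] e = \<one> \<Longrightarrow> a [^] E = \<one>"
    using bounded_torsion by blast
  obtain C where C: "finite C" "C \<subseteq> A" and cov: "\<And>a. a \<in> A \<Longrightarrow> \<exists>c\<in>C. \<exists>(p::nat) (q::nat) (j::int).
     conj_by (t [^] int p) (a [^] m) = conj_by (t [^] int q) (c [^] j)"
    using line_cover by blast
  define B where "B = (\<lambda>a. a [^] E) ` A"
  have powA: "a [^] (k::int) \<in> A" if "a \<in> A" for a k
    by (rule subgroup_int_pow_closed[OF subgroup_axioms that])
  have BA: "B \<subseteq> A" unfolding B_def using powA by blast
  have BG: "x \<in> carrier G" if "x \<in> B" for x using that BA by auto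
  have BI: "a [^] E \<in> B" if "a \<in> A" for a using that unfolding B_def by blast
  have mult_pow: "(x \<otimes> y) [^] (k::int) = x [^] k \<otimes> y [^] k" if "x \<in> A" "y \<in> A" for x y k
    using that abelian by (intro int_pow_mult_distrib) auto
  have subB: "subgroup B G"
  proof (unfold_locales)
    show "B \<subseteq> carrier G" using BG by blast
    show "x \<otimes> y \<in> B" if xy: "x \<in> B" "y \<in> B" for x y
    proof -
      obtain a b where "x = a [^] E" "y = b [^] E" "a \<in> A" "b \<in> A" using xy unfolding B_def by blast
      then show ?thesis using BI[of "a \<otimes> b"] mult_pow[of a b] by simp
    qed
    show "\<one> \<in> B" using BI[OF subgroup.one_closed[OF subgroup_axioms]] by simp
    show "inv x \<in> B" if x: "x \<in> B" for x
    proof -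
      obtain a where "x = a [^] E" "a \<in> A" using x unfolding B_def by blast
      then show ?thesis using BI[of "inv a"] by (simp add: int_pow_inv)
    qed
  qed
  have conjB: "conj_by (t [^] (k::int)) x \<in> B" if x: "x \<in> B" for x k
  proof -
    obtain a where a: "x = a [^] E" "a \<in> A" using x unfolding B_def by blast
    then show ?thesis using BI[OF conj_by_A[of "t [^] k" a]] by (simp add: conj_by_int_pow)
  qed
  let ?B = "G\<lparr>carrier := B\<rparr>"
  have pow: "x [^]\<^bsub>?B\<^esub> (k::int) = x [^] k" if "x \<in> B" for x k
    using int_pow_consistent[OF subB that] by simp
  have fp: "(conj_by t ^^ k) x = conj_by (t [^] int k) x" if "x \<in> B" for x k
    using conj_by_funpow BG[OF that] t by blast
  have "abelian_endo ?B (conj_by t)"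
    using abelian_endo_conj_by[OF t subB BA abelian] conjB[of _ 1] by simp
  then interpret B: abelian_endo ?B "conj_by t" .
  interpret B: line_covered_endo ?B "conj_by t" "(\<lambda>c. c [^] E) ` C" m
  proof unfold_locales
    fix x and k :: int assume x: "x \<in> carrier ?B" "x [^]\<^bsub>?B\<^esub> k = \<one>\<^bsub>?B\<^esub>" "k \<noteq> 0"
    then obtain a where a: "a \<in> A" "x = a [^] E" unfolding B_def by auto
    have "a [^] (E * k) = \<one>" using x a pow[of x k] by (simp add: int_pow_pow)
    then have "a [^] (E * \<bar>k\<bar>) = \<one>" using a(1)
      by (cases "k > 0") (auto simp: int_pow_neg)
    then have "a [^] E = \<one>" using tor[OF a(1), of "E * \<bar>k\<bar>"] x(3) E by simp
    then show "x = \<one>\<^bsub>?B\<^esub>" using a by simp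
  next
    show "finite ((\<lambda>c. c [^] E) ` C)" using C by simp
    show "(\<lambda>c. c [^] E) ` C \<subseteq> carrier ?B" using C BI by auto
    show "0 < m" by (rule m_pos)
  next
    fix x assume "x \<in> carrier ?B"
    then obtain a where a: "a \<in> A" "x = a [^] E" unfolding B_def by auto
    obtain c and p q :: nat and j :: int where c: "c \<in> C"
      and eq: "conj_by (t [^] int p) (a [^] m) = conj_by (t [^] int q) (c [^] j)" using cov[OF a(1)] by blast
    have cA: "c \<in> A" using c C by blast
    have "conj_by (t [^] int p) (x [^] m) = conj_by (t [^] int p) (a [^] m) [^] E"
      unfolding a(2) using a(1) by (simp add: int_pow_pow mult.commute flip: conj_by_int_pow)
    also have "\<dots> = conj_by (t [^] int q) ((c [^] E) [^] j)"
      unfolding eq using cA by (simp add: int_pow_pow mult.commute flip: conj_by_int_pow)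
    finally have "(conj_by t ^^ p) (x [^]\<^bsub>?B\<^esub> m) = (conj_by t ^^ q) ((c [^] E) [^]\<^bsub>?B\<^esub> j)"
      using a cA BI pow fp subgroup_int_pow_closed[OF subB] by simp
    then show "\<exists>c\<in>(\<lambda>c. c [^] E) ` C. \<exists>p q. \<exists>j::int. (conj_by t ^^ p) (x [^]\<^bsub>?B\<^esub> m) = (conj_by t ^^ q) (c [^]\<^bsub>?B\<^esub> j)"
      using c by blast
  qed
  have "carrier ?B = {\<one>\<^bsub>?B\<^esub>}"
  proof (rule B.linear_growth_imp_trivial)
    fix n :: nat and x assume n: "0 < n" and "x \<in> carrier ?B"
    then obtain a where a: "a \<in> A" "x = a [^] E" unfolding B_def by auto
    obtain e b where e: "1 \<le> e" "e \<le> int (card Q) * int n" and b: "b \<in> A"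
      and eq: "a [^] e \<otimes> b = conj_by (t [^] int n) b"
      using growth[OF n a(1)] by blast
    have "x [^] e \<otimes> b [^] E = (a [^] e \<otimes> b) [^] E"
      unfolding a(2) using a(1) b powA by (simp add: mult_pow int_pow_pow mult.commute)
    also have "\<dots> = conj_by (t [^] int n) (b [^] E)" unfolding eq using b by (simp add: conj_by_int_pow)
    finally have "x [^]\<^bsub>?B\<^esub> e \<otimes>\<^bsub>?B\<^esub> b [^] E = (conj_by t ^^ n) (b [^] E)"
      using a b BI pow fp by simp
    then show "\<exists>e. \<exists>b\<in>carrier ?B. 1 \<le> e \<and> e \<le> int (card Q) * int n \<and> x [^]\<^bsub>?B\<^esub> e \<otimes>\<^bsub>?B\<^esub> b = (conj_by t ^^ n) b"
      using e BI[OF b] by auto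
  qed
  then have "\<forall>a\<in>A. a [^] E = \<one>" using BI by auto
  then show ?thesis using E by blast
qed

text \<open>A torsion group meets every coset of a cyclic group in a finite set, so \<open>A\<close> is a finite union of
  orbits of \<open>\<tau>\<close>.\<close>
lemma finite_A: "finite A"
proof -
  obtain E :: int where E: "0 < E" "\<And>a. a \<in> A \<Longrightarrow> a [^] E = \<one>" using bounded_exponent by blast
  let ?A = "G\<lparr>carrier := A\<rparr>"
  have AG: "x \<in> carrier G" if "x \<in> A" for x using that by simp
  have pow: "x [^]\<^bsub>?A\<^esub> (k::int) = x [^] k" if "x \<in> A" for x k
    using int_pow_consistent[OF subgroup_axioms that] by simp
  have fp: "(conj_by t ^^ k) x = conj_by (t [^] int k) x" if "x \<in> A" for x k
    using conj_by_funpow AG[OF that] t by blast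
  have "abelian_endo ?A (conj_by t)"
    using abelian_endo_conj_by[OF t subgroup_axioms subset_refl abelian] conj_by_A t by blast
  then interpret A: abelian_endo ?A "conj_by t" .
  define C where "C = (\<Union>p\<in>Q. A \<inter> range (\<lambda>j::int. fst p \<otimes> snd p [^] j))"
  have "finite (A \<inter> range (\<lambda>j::int. fst p \<otimes> snd p [^] j))" if p: "p \<in> Q" for p
  proof (rule finite_coset_Int_torsion[OF _ _ subset])
    show "\<exists>e::int. 0 < e \<and> (inv x \<otimes> y) [^] e = \<one>" if "x \<in> A" "y \<in> A" for x y
      using that E by (intro exI[of _ E]) simp
  qed (use p Q_carrier in auto)
  then have finC: "finite C" unfolding C_def using finite_Q by blast
  have "finite (carrier ?A)"
  proof (rule A.finite_of_torsion_finitely_many_orbits)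
    show "finite C" by (rule finC)
    show "C \<subseteq> carrier ?A" unfolding C_def by auto
    show "\<exists>e::int. 0 < e \<and> a [^]\<^bsub>?A\<^esub> e = \<one>\<^bsub>?A\<^esub>" if "a \<in> carrier ?A" for a
      using that E pow by (intro exI[of _ E]) simp
    show "\<exists>c\<in>C. \<exists>p q. (conj_by t ^^ p) a = (conj_by t ^^ q) c" if "a \<in> carrier ?A" for a
    proof -
      have a: "a \<in> A" using that by simp
      obtain n :: int and p and j j' :: int where p: "p \<in> Q" "conj_by (t [^] n) a = fst p \<otimes> snd p [^] j"
        "(fst p \<otimes> snd p [^] j) [^] m = snd p [^] j'"
        by (rule Q_cover_A[OF a])
      define d where "d = conj_by (t [^] n) a"
      have d: "d \<in> A" "d \<in> C" unfolding C_def d_def using p(1,2) conj_by_A[of "t [^] n" a] a by auto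
      show ?thesis
      proof (cases "0 \<le> n")
        case True
        then have "(conj_by t ^^ nat n) a = (conj_by t ^^ 0) d" using a by (simp add: fp d_def)
        then show ?thesis using d by blast
      next
        case False
        have "(conj_by t ^^ 0) a = conj_by (inv (t [^] n)) d" unfolding d_def using a by simp
        also have "\<dots> = (conj_by t ^^ nat (- n)) d" using False d by (simp add: fp int_pow_neg)
        finally show ?thesis using d by blast
      qed
    qed
  qed
  then show ?thesis by simp
qed

end

text \<open>The two cases are \<open>A\<close> of finite index and \<open>A\<close> finite.\<close>
theorem (in abelian_by_virtually_cyclic) virtually_cyclic_over_one: "virtually_cyclic_over G {\<one>}"
proof (cases "\<exists>k::int. k \<noteq> 0 \<and> t [^] k \<in> A")
  case True
  then obtain k :: int where k: "k \<noteq> 0" "t [^] k \<in> A" by blast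
  have "t [^] (- k) \<in> A" using k(2) by (simp add: int_pow_neg)
  then show ?thesis
    using virtually_cyclic_if_power_in_A[of k] virtually_cyclic_if_power_in_A[of "- k"] k by linarith
next
  case False
  then interpret abelian_by_infinite_cyclic A G t R P m by unfold_locales blast
  define R' where "R' = (\<lambda>(r, a). r \<otimes> a) ` (R \<times> A)"
  have "\<exists>r\<in>R'. \<exists>n::int. \<exists>a\<in>{\<one>}. g = r \<otimes> t [^] n \<otimes> a" if g: "g \<in> carrier G" for g
  proof -
    obtain r and n :: int and a where r: "r \<in> R" "a \<in> A" "g = r \<otimes> t [^] n \<otimes> a"
      using gen[OF g] by blast
    have rG: "r \<in> carrier G" "a \<in> carrier G" using r R by auto
    have "g = (r \<otimes> conj_by (t [^] n) a) \<otimes> t [^] n \<otimes> \<one>"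
      unfolding r(3) conj_by_def using rG by (simp add: m_assoc)
    moreover have "r \<otimes> conj_by (t [^] n) a \<in> R'"
      unfolding R'_def using r(1,2) conj_by_A[of "t [^] n" a] by force
    ultimately show ?thesis by blast
  qed
  moreover have "finite R'" "R' \<subseteq> carrier G"
    unfolding R'_def using R finite_A by (auto simp: subset_iff)
  ultimately show ?thesis by (intro virtually_cyclic_overI[of t G R']) simp_all
qed

section \<open>Soluble groups\<close>

lemma (in group_hom) cyclic_cosets_cover_image:
  assumes cov: "cyclic_cosets_cover G P m" and surj: "h ` carrier G = carrier H"
  shows "cyclic_cosets_cover H ((\<lambda>p. (h (fst p), h (snd p))) ` P) m"
  unfolding cyclic_cosets_cover_def
proof (intro conjI ballI)
  have P: "finite P" "P \<subseteq> carrier G \<times> carrier G" "0 < m" using cov unfolding cyclic_cosets_cover_def by auto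
  show "finite ((\<lambda>p. (h (fst p), h (snd p))) ` P)" "0 < m"
    "(\<lambda>p. (h (fst p), h (snd p))) ` P \<subseteq> carrier H \<times> carrier H"
    using P by auto
  fix x assume "x \<in> carrier H"
  then obtain g where g: "g \<in> carrier G" "x = h g" using surj by auto
  then obtain y p and j j' :: int where y: "y \<in> carrier G" "p \<in> P"
    "y \<otimes> g \<otimes> inv y = fst p \<otimes> snd p [^] j" "(fst p \<otimes> snd p [^] j) [^] m = snd p [^] j'"
    using cov unfolding cyclic_cosets_cover_def by blast
  have pG: "fst p \<in> carrier G" "snd p \<in> carrier G" using y(2) P(2) by auto
  have 1: "h y \<otimes>\<^bsub>H\<^esub> x \<otimes>\<^bsub>H\<^esub> inv\<^bsub>H\<^esub> h y = h (fst p) \<otimes>\<^bsub>H\<^esub> h (snd p) [^]\<^bsub>H\<^esub> j"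
    using arg_cong[OF y(3), of h] g y(1) pG by (simp add: hom_int_pow)
  have 2: "(h (fst p) \<otimes>\<^bsub>H\<^esub> h (snd p) [^]\<^bsub>H\<^esub> j) [^]\<^bsub>H\<^esub> m = h (snd p) [^]\<^bsub>H\<^esub> j'"
    using arg_cong[OF y(4), of h] pG by (simp add: hom_int_pow)
  show "\<exists>y\<in>carrier H. \<exists>p\<in>(\<lambda>p. (h (fst p), h (snd p))) ` P. \<exists>(j::int) (j'::int).
      y \<otimes>\<^bsub>H\<^esub> x \<otimes>\<^bsub>H\<^esub> inv\<^bsub>H\<^esub> y = fst p \<otimes>\<^bsub>H\<^esub> snd p [^]\<^bsub>H\<^esub> j \<and>
      (fst p \<otimes>\<^bsub>H\<^esub> snd p [^]\<^bsub>H\<^esub> j) [^]\<^bsub>H\<^esub> m = snd p [^]\<^bsub>H\<^esub> j'"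
    by (rule bexI[of _ "h y"], rule bexI[of _ "(h (fst p), h (snd p))"], rule exI[of _ j], rule exI[of _ j'])
      (use 1 2 y in auto)
qed

text \<open>In \<open>G/[N, N]\<close> the image of \<open>N\<close> is abelian, with virtually cyclic quotient \<open>G/N\<close>.\<close>
lemma (in group) virtually_cyclic_over_derived:
  assumes cov: "cyclic_cosets_cover G P m" and N: "N \<lhd> G" and vc: "virtually_cyclic_over G N"
  shows "virtually_cyclic_over G (derived G N)"
proof -
  define D where "D = derived G N"
  have DG: "D \<lhd> G" unfolding D_def by (rule derived_is_normal[OF N])
  interpret D: normal D G by (rule DG)
  interpret N: normal N G by (rule N)
  define h where "h x = D #> x" for x
  interpret h: group_hom G "G Mod D" h
  proof (intro group_hom.intro group_hom_axioms.intro is_group D.factorgroup_is_group)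
    have "h = (\<lambda>a. D #> a)" by (simp add: fun_eq_iff h_def)
    then show "h \<in> hom G (G Mod D)" using D.r_coset_hom_Mod by simp
  qed
  have surj: "h ` carrier G = carrier (G Mod D)" by (simp add: carrier_FactGroup h_def image_def)
  have h1: "h x = \<one>\<^bsub>G Mod D\<^esub> \<longleftrightarrow> x \<in> D" if "x \<in> carrier G" for x
    using that unfolding h_def one_FactGroup by (meson coset_join1 coset_join2 D.subgroup_axioms)
  obtain t R where t: "t \<in> carrier G" and R: "finite R" "R \<subseteq> carrier G"
    and gen: "\<forall>g\<in>carrier G. \<exists>r\<in>R. \<exists>n::int. \<exists>a\<in>N. g = r \<otimes> t [^] n \<otimes> a"
    using vc unfolding virtually_cyclic_over_def by (elim bexE exE conjE)
  interpret Q: abelian_by_virtually_cyclic "h ` N" "G Mod D" "h t" "h ` R"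
    "(\<lambda>p. (h (fst p), h (snd p))) ` P" m
  proof (intro abelian_by_virtually_cyclic.intro abelian_by_virtually_cyclic_axioms.intro)
    show "h ` N \<lhd> G Mod D" by (rule N.surj_hom_normal_subgroup[OF h.group_hom_axioms surj])
    show "x \<otimes>\<^bsub>G Mod D\<^esub> y = y \<otimes>\<^bsub>G Mod D\<^esub> x" if xy: "x \<in> h ` N" "y \<in> h ` N" for x y
    proof -
      obtain a b where ab: "x = h a" "y = h b" "a \<in> N" "b \<in> N" using xy by blast
      have G: "a \<in> carrier G" "b \<in> carrier G" using ab by auto
      have "a \<otimes> b \<otimes> inv a \<otimes> inv b \<in> D"
        unfolding D_def derived_def using ab by (intro generate.incl) blast
      then have "h (a \<otimes> b \<otimes> inv a \<otimes> inv b) = \<one>\<^bsub>G Mod D\<^esub>"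
        by (simp only: h1 m_closed inv_closed G)
      moreover have "a \<otimes> b = (a \<otimes> b \<otimes> inv a \<otimes> inv b) \<otimes> (b \<otimes> a)" using G by (simp add: m_assoc)
      ultimately have "h (a \<otimes> b) = \<one>\<^bsub>G Mod D\<^esub> \<otimes>\<^bsub>G Mod D\<^esub> h (b \<otimes> a)"
        using G by (metis h.hom_mult inv_closed m_closed)
      then show ?thesis using G ab by (simp del: mult_FactGroup one_FactGroup)
    qed
    show "h t \<in> carrier (G Mod D)" "finite (h ` R)" "h ` R \<subseteq> carrier (G Mod D)"
      using t R h.hom_closed by (auto simp: subset_iff)
    show "cyclic_cosets_cover (G Mod D) ((\<lambda>p. (h (fst p), h (snd p))) ` P) m"
      by (rule h.cyclic_cosets_cover_image[OF cov surj])
    fix x assume "x \<in> carrier (G Mod D)"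
    then obtain g where g: "g \<in> carrier G" "x = h g" using surj by blast
    obtain r and n :: int and a where r: "r \<in> R" "a \<in> N" "g = r \<otimes> t [^] n \<otimes> a" using bspec[OF gen g(1)] by blast
    have "r \<in> carrier G" "a \<in> carrier G" using r R by auto
    then have "x = h r \<otimes>\<^bsub>G Mod D\<^esub> h t [^]\<^bsub>G Mod D\<^esub> n \<otimes>\<^bsub>G Mod D\<^esub> h a"
      unfolding g(2) r(3) using t by (simp add: h.hom_int_pow del: mult_FactGroup)
    then show "\<exists>r\<in>h ` R. \<exists>n::int. \<exists>a\<in>h ` N. x = r \<otimes>\<^bsub>G Mod D\<^esub> h t [^]\<^bsub>G Mod D\<^esub> n \<otimes>\<^bsub>G Mod D\<^esub> a"
      using r by blast
  qed
  obtain s' S' where s': "s' \<in> carrier (G Mod D)" and S': "finite S'" "S' \<subseteq> carrier (G Mod D)"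
    and gen': "\<forall>x\<in>carrier (G Mod D).
      \<exists>r\<in>S'. \<exists>n::int. \<exists>a\<in>{\<one>\<^bsub>G Mod D\<^esub>}. x = r \<otimes>\<^bsub>G Mod D\<^esub> s' [^]\<^bsub>G Mod D\<^esub> n \<otimes>\<^bsub>G Mod D\<^esub> a"
    using Q.virtually_cyclic_over_one unfolding virtually_cyclic_over_def by (elim bexE exE conjE)
  obtain s where s: "s \<in> carrier G" "s' = h s" using s' surj by blast
  obtain S where S: "finite S" "S \<subseteq> carrier G" "S' = h ` S"
    using S' surj by (metis finite_subset_image)
  show ?thesis
  proof (rule virtually_cyclic_overI[OF s(1) S(1,2)])
    fix g assume g: "g \<in> carrier G"
    then obtain r' and n :: int where r': "r' \<in> S'"
      "h g = r' \<otimes>\<^bsub>G Mod D\<^esub> s' [^]\<^bsub>G Mod D\<^esub> n \<otimes>\<^bsub>G Mod D\<^esub> \<one>\<^bsub>G Mod D\<^esub>"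
      using bspec[OF gen' h.hom_closed[OF g]] by blast
    obtain r where r: "r \<in> S" "r' = h r" using r'(1) S(3) by blast
    have rG: "r \<in> carrier G" using r S by blast
    define z where "z = inv (r \<otimes> s [^] n) \<otimes> g"
    have zG: "z \<in> carrier G" unfolding z_def using rG s g by simp
    have "h g = h (r \<otimes> s [^] n)"
      using r'(2) rG s unfolding r(2) s(2) by (simp add: h.hom_int_pow del: mult_FactGroup one_FactGroup)
    then have "h z = \<one>\<^bsub>G Mod D\<^esub>"
      unfolding z_def using rG s g by (simp del: mult_FactGroup one_FactGroup)
    then have "z \<in> D" using h1 zG by blast
    moreover have "g = r \<otimes> s [^] n \<otimes> z" unfolding z_def using rG s g by (simp add: m_assoc inv_mult_group)
    ultimately show "\<exists>r\<in>S. \<exists>n::int. \<exists>a\<in>derived G N. g = r \<otimes> s [^] n \<otimes> a"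
      using r(1) unfolding D_def by blast
  qed
qed

theorem (in group) solvable_imp_virtually_cyclic_over_one:
  assumes cov: "cyclic_cosets_cover G P m" and sol: "solvable G"
  shows "virtually_cyclic_over G {\<one>}"
proof -
  obtain n where n: "(derived G ^^ n) (carrier G) = {\<one>}"
    using sol solvable_iff_trivial_derived_seq by blast
  have "(derived G ^^ k) (carrier G) \<lhd> G \<and> virtually_cyclic_over G ((derived G ^^ k) (carrier G))" for k
  proof (induction k)
    case 0
    have "virtually_cyclic_over G (carrier G)"
    proof (rule virtually_cyclic_overI[of \<one> G "{\<one>}"])
      fix g assume "g \<in> carrier G"
      then have "g = \<one> \<otimes> \<one> [^] (0::int) \<otimes> g" by simp
      then show "\<exists>r\<in>{\<one>}. \<exists>n::int. \<exists>a\<in>carrier G. g = r \<otimes> \<one> [^] n \<otimes> a"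
        using \<open>g \<in> carrier G\<close> by blast
    qed auto
    then show ?case using normal_self by simp
  next
    case (Suc k)
    then show ?case using virtually_cyclic_over_derived[OF cov] derived_is_normal by simp
  qed
  then show ?thesis using n by metis
qed

section \<open>Virtually cyclic groups\<close>

lemma cyclic_groupI:
  fixes G (structure)
  assumes G: "group G" and t: "t \<in> carrier G"
  shows "subgroup (range (\<lambda>n::int. t [^]\<^bsub>G\<^esub> n)) G"
    and "cyclic_group (G\<lparr>carrier := range (\<lambda>n::int. t [^]\<^bsub>G\<^esub> n)\<rparr>)"
proof -
  interpret group G by (rule G)
  let ?C = "range (\<lambda>n::int. t [^] n)"
  have "generate G {t} = ?C" using generate_pow[OF t] by auto
  then show C: "subgroup ?C G" using generate_is_subgroup[of "{t}"] t by simp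
  have tC: "t \<in> ?C" using t by (metis int_pow_1 rangeI)
  have "t [^]\<^bsub>G\<lparr>carrier := ?C\<rparr>\<^esub> n = t [^] n" for n :: int
    by (rule int_pow_consistent[OF C tC, symmetric])
  then have eq: "range (\<lambda>n::int. t [^]\<^bsub>G\<lparr>carrier := ?C\<rparr>\<^esub> n) = ?C" by (simp only:)
  show "cyclic_group (G\<lparr>carrier := ?C\<rparr>)"
    unfolding group.cyclic_group[OF subgroup_imp_group[OF C]]
    by (rule bexI[of _ t]) (simp_all add: eq tC)
qed

lemma virtually_cyclic_over_one_imp_virtually_cyclic:
  fixes G (structure)
  assumes G: "group G" and vc: "virtually_cyclic_over G {\<one>\<^bsub>G\<^esub>}"
  shows "virtually_cyclic G"
proof -
  interpret group G by (rule G)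
  obtain t R where t: "t \<in> carrier G" and R: "finite R" "R \<subseteq> carrier G"
    and gen: "\<forall>g\<in>carrier G. \<exists>r\<in>R. \<exists>n::int. \<exists>a\<in>{\<one>}. g = r \<otimes> t [^] n \<otimes> a"
    using vc unfolding virtually_cyclic_over_def by (elim bexE exE conjE)
  let ?C = "range (\<lambda>n::int. t [^] n)"
  have C: "subgroup ?C G" "cyclic_group (G\<lparr>carrier := ?C\<rparr>)" using cyclic_groupI[OF G t] .
  have "rcosets ?C \<subseteq> (\<lambda>r. ?C #> inv r) ` R"
  proof
    fix X assume "X \<in> rcosets ?C"
    then obtain g where g: "g \<in> carrier G" "X = ?C #> g" unfolding RCOSETS_def by blast
    obtain r and n :: int where r: "r \<in> R" "inv g = r \<otimes> t [^] n \<otimes> \<one>"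
      using bspec[OF gen inv_closed[OF g(1)]] by blast
    have rG: "r \<in> carrier G" using r R by blast
    have "g = inv (r \<otimes> t [^] n)" using r(2) g(1) rG t by (metis int_pow_closed inv_inv m_closed r_one)
    also have "\<dots> = t [^] (- n) \<otimes> inv r" using rG t by (simp add: inv_mult_group int_pow_neg)
    finally have "g \<in> ?C #> inv r" unfolding r_coset_def by blast
    then have "?C #> inv r = ?C #> g" using repr_independence[OF _ _ C(1)] rG by simp
    then show "X \<in> (\<lambda>r. ?C #> inv r) ` R" using g r by auto
  qed
  then have "finite (rcosets ?C)" using R finite_subset by blast
  then show ?thesis unfolding virtually_cyclic_def using C by blast
qed

lemma virtually_cyclic_subgroup_cosets:
  fixes G (structure)
  assumes G: "group G" and S: "S \<in> vc_family G"
  shows "\<exists>c F. c \<in> carrier G \<and> finite F \<and> F \<subseteq> carrier G \<and>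
    (\<forall>h\<in>S. \<exists>f\<in>F. \<exists>j::int. h = f \<otimes>\<^bsub>G\<^esub> c [^]\<^bsub>G\<^esub> j)"
proof -
  interpret group G by (rule G)
  have sub: "subgroup S G" and "virtually_cyclic (G\<lparr>carrier := S\<rparr>)" using S unfolding vc_family_def by auto
  then obtain C where C: "subgroup C (G\<lparr>carrier := S\<rparr>)" "cyclic_group (G\<lparr>carrier := C\<rparr>)"
    and fin: "finite (rcosets\<^bsub>G\<lparr>carrier := S\<rparr>\<^esub> C)"
    unfolding virtually_cyclic_def by auto
  interpret S: group "G\<lparr>carrier := S\<rparr>" using subgroup_imp_group[OF sub] .
  have CG: "subgroup C G" using incl_subgroup[OF sub C(1)] .
  have "\<exists>x\<in>C. C = range (\<lambda>n::int. x [^]\<^bsub>G\<lparr>carrier := C\<rparr>\<^esub> n)"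
    using group.cyclic_group[OF subgroup_imp_group[OF CG]] C(2) by simp
  then obtain c where c1: "c \<in> C" "C = range (\<lambda>n::int. c [^]\<^bsub>G\<lparr>carrier := C\<rparr>\<^esub> n)" by blast
  have "range (\<lambda>n::int. c [^] n) = range (\<lambda>n::int. c [^]\<^bsub>G\<lparr>carrier := C\<rparr>\<^esub> n)"
    by (simp only: int_pow_consistent[OF CG c1(1)])
  then have c: "c \<in> C" "C = range (\<lambda>n::int. c [^] n)" using c1 by (simp_all only:)
  have cG: "c \<in> carrier G" using c(1) subgroup.subset[OF CG] by blast
  define F where "F = (\<lambda>X. inv (SOME x. x \<in> X)) ` (rcosets\<^bsub>G\<lparr>carrier := S\<rparr>\<^esub> C)"
  have rep: "(SOME x. x \<in> X) \<in> X" "(SOME x. x \<in> X) \<in> S" if X: "X \<in> rcosets\<^bsub>G\<lparr>carrier := S\<rparr>\<^esub> C" for X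
  proof -
    have "X \<noteq> {}" using subgroup.rcosets_non_empty[OF C(1) X] .
    then show *: "(SOME x. x \<in> X) \<in> X" by (simp add: some_in_eq)
    then show "(SOME x. x \<in> X) \<in> S" using subgroup.rcosets_carrier[OF C(1) S.is_group X] by auto
  qed
  have SG: "S \<subseteq> carrier G" using subgroup.subset[OF sub] .
  have "\<exists>f\<in>F. \<exists>j::int. h = f \<otimes> c [^] j" if h: "h \<in> S" for h
  proof -
    have hG: "h \<in> carrier G" using h SG by blast
    have ih: "inv h \<in> S" using subgroup.m_inv_closed[OF sub h] .
    define X where "X = C #> inv h"
    have X: "X \<in> rcosets\<^bsub>G\<lparr>carrier := S\<rparr>\<^esub> C"
      unfolding X_def RCOSETS_def r_coset_def using ih by auto
    define x where "x = (SOME x. x \<in> X)"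
    have x: "x \<in> X" "x \<in> S" using rep[OF X] unfolding x_def by auto
    then obtain j :: int where j: "x = c [^] j \<otimes> inv h" unfolding X_def r_coset_def c(2) by auto
    have "h = inv x \<otimes> c [^] j" unfolding j using cG hG by (simp add: inv_mult_group m_assoc)
    moreover have "inv x \<in> F" unfolding F_def x_def using X by blast
    ultimately show ?thesis by blast
  qed
  moreover have "finite F" "F \<subseteq> carrier G" unfolding F_def using fin rep SG by auto
  ultimately show ?thesis using cG by blast
qed

text \<open>Among \<open>1, h, \<dots>, h\<^sup>k\<close> with \<open>k = card F\<close> two lie in the same coset, so some power of \<open>h\<close> with exponent
  at most \<open>k\<close>, hence dividing \<open>M!\<close>, lies in \<open>\<langle>c\<rangle>\<close>.\<close>
lemma (in group) power_in_cyclic_of_cosets: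
  assumes S: "subgroup S G" and c: "c \<in> carrier G" and F: "finite F" "F \<subseteq> carrier G"
    and cos: "\<And>h. h \<in> S \<Longrightarrow> \<exists>f\<in>F. \<exists>j::int. h = f \<otimes> c [^] j"
    and h: "h \<in> S" and M: "card F \<le> M"
  shows "\<exists>j::int. h [^] (fact M :: int) = c [^] j"
proof -
  have hG: "h \<in> carrier G" using h subgroup.subset[OF S] by blast
  have "\<forall>i. \<exists>f. f \<in> F \<and> (\<exists>j::int. h [^] int i = f \<otimes> c [^] j)"
    using cos[OF subgroup_int_pow_closed[OF S h]] by blast
  then obtain f where "\<forall>i. f i \<in> F \<and> (\<exists>j::int. h [^] int i = f i \<otimes> c [^] j)"
    by (rule choice[THEN exE])
  then have f: "\<And>i. f i \<in> F" and ex: "\<forall>i. \<exists>j::int. h [^] int i = f i \<otimes> c [^] j" by auto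
  obtain j where j: "\<And>i. h [^] int i = f i \<otimes> c [^] (j i :: int)" using ex by (auto dest: choice)
  have "\<not> inj_on f {..card F}"
    using f F(1) card_inj_on_le[of f "{..card F}" F] by fastforce
  then obtain a b where "a \<le> card F" "b \<le> card F" "a \<noteq> b" "f a = f b" by (auto simp: inj_on_def)
  then obtain a b where ab: "b \<le> card F" "a < b" "f a = f b" by (metis linorder_neqE_nat)
  have fG: "f a \<in> carrier G" using f F by blast
  have "h [^] int (b - a) = inv (h [^] int a) \<otimes> h [^] int b"
    using hG ab int_pow_mult[OF hG, of "- int a" "int b"] by (simp add: int_pow_neg of_nat_diff)
  also have "\<dots> = c [^] (j b - j a)"
    unfolding j ab(3)[symmetric] using fG c int_pow_mult[OF c, of "- j a" "j b"]
    by (simp add: inv_mult_group m_assoc int_pow_neg)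
  finally have *: "h [^] int (b - a) = c [^] (j b - j a)" .
  have "b - a dvd fact M" using ab M by (intro dvd_fact) auto
  then obtain q :: nat where "fact M = (b - a) * q" by blast
  then have "(fact M :: int) = int (b - a) * int q" by (metis of_nat_fact of_nat_mult)
  then have "h [^] (fact M :: int) = (h [^] int (b - a)) [^] int q"
    using hG by (simp add: int_pow_pow)
  also have "\<dots> = c [^] ((j b - j a) * int q)" unfolding * using c by (simp add: int_pow_pow)
  finally show ?thesis by blast
qed

lemma cyclic_cosets_cover_of_finite_vc_family:
  fixes G (structure)
  assumes G: "group G" and fin: "finite \<S>" and sub: "\<S> \<subseteq> vc_family G"
    and cov: "\<And>g. g \<in> carrier G \<Longrightarrow> \<exists>y\<in>carrier G. \<exists>S\<in>\<S>. y \<otimes>\<^bsub>G\<^esub> g \<otimes>\<^bsub>G\<^esub> inv\<^bsub>G\<^esub> y \<in> S"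
  shows "\<exists>P m. cyclic_cosets_cover G P m"
proof -
  interpret group G by (rule G)
  have "\<forall>S\<in>\<S>. \<exists>cF. fst cF \<in> carrier G \<and> finite (snd cF) \<and> snd cF \<subseteq> carrier G \<and>
    (\<forall>h\<in>S. \<exists>f\<in>snd cF. \<exists>j::int. h = f \<otimes> fst cF [^] j)"
    using virtually_cyclic_subgroup_cosets[OF G] sub by (simp add: subset_iff) 
  then obtain cF where cF: "\<forall>S\<in>\<S>. fst (cF S) \<in> carrier G \<and> finite (snd (cF S)) \<and> snd (cF S) \<subseteq> carrier G \<and>
    (\<forall>h\<in>S. \<exists>f\<in>snd (cF S). \<exists>j::int. h = f \<otimes> fst (cF S) [^] j)"
    by (rule bchoice[THEN exE])
  define P where "P = (\<Union>S\<in>\<S>. snd (cF S) \<times> {fst (cF S)})"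
  define M where "M = (\<Sum>S\<in>\<S>. card (snd (cF S)))"
  have "cyclic_cosets_cover G P (fact M)"
    unfolding cyclic_cosets_cover_def
  proof (intro conjI ballI)
    show "finite P" "P \<subseteq> carrier G \<times> carrier G" "0 < (fact M :: int)"
      unfolding P_def using fin cF by auto
    fix g assume "g \<in> carrier G"
    then obtain y S where y: "y \<in> carrier G" "S \<in> \<S>" "y \<otimes> g \<otimes> inv y \<in> S" using cov by blast
    define c F where "c = fst (cF S)" and "F = snd (cF S)"
    have c: "c \<in> carrier G" and F: "finite F" "F \<subseteq> carrier G"
      and cos: "\<forall>h\<in>S. \<exists>f\<in>F. \<exists>j::int. h = f \<otimes> c [^] j"
      using bspec[OF cF y(2)] unfolding c_def F_def by auto
    have "subgroup S G" using y(2) sub unfolding vc_family_def by blast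
    moreover have "card F \<le> M" unfolding M_def F_def using fin y(2) by (intro member_le_sum) auto
    ultimately obtain j' :: int where j': "(y \<otimes> g \<otimes> inv y) [^] (fact M :: int) = c [^] j'"
      using power_in_cyclic_of_cosets[OF _ c F bspec[OF cos] y(3)] by blast
    obtain f and j :: int where f: "f \<in> F" "y \<otimes> g \<otimes> inv y = f \<otimes> c [^] j" using bspec[OF cos y(3)] by blast
    have fc: "(f, c) \<in> P" unfolding P_def using y(2) f(1) c_def F_def by auto
    show "\<exists>y\<in>carrier G. \<exists>p\<in>P. \<exists>(j::int) (j'::int). y \<otimes> g \<otimes> inv y = fst p \<otimes> snd p [^] j \<and>
        (fst p \<otimes> snd p [^] j) [^] (fact M :: int) = snd p [^] j'"
      by (rule bexI[OF _ y(1)], rule bexI[OF _ fc], rule exI[of _ j], rule exI[of _ j'])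
        (use f(2) j' in simp)
  qed
  then show ?thesis by blast
qed

section \<open>Orbits and the augmentation\<close>

lemma group_actionI:
  fixes G (structure)
  assumes G: "group G"
    and ext: "\<And>g. g \<in> carrier G \<Longrightarrow> \<phi> g \<in> E \<rightarrow>\<^sub>E E"
    and one: "\<And>x. x \<in> E \<Longrightarrow> \<phi> \<one>\<^bsub>G\<^esub> x = x"
    and mult: "\<And>g h x. g \<in> carrier G \<Longrightarrow> h \<in> carrier G \<Longrightarrow> x \<in> E \<Longrightarrow> \<phi> (g \<otimes>\<^bsub>G\<^esub> h) x = \<phi> g (\<phi> h x)"
  shows "group_action G E \<phi>"
proof -
  interpret group G by (rule G)
  have cl: "\<phi> g x \<in> E" if "g \<in> carrier G" "x \<in> E" for g x using ext that by blast
  have bij: "\<phi> g \<in> Bij E" if g: "g \<in> carrier G" for g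
  proof -
    have "bij_betw (\<phi> g) E E"
      by (rule bij_betw_byWitness[of _ "\<phi> (inv g)"]) (use g cl one in \<open>auto simp flip: mult\<close>)
    then show ?thesis unfolding Bij_def using ext[OF g] by (auto simp: PiE_def)
  qed
  show ?thesis
  proof (intro group_action.intro group_hom.intro group_hom_axioms.intro G group_BijGroup homI)
    show "\<phi> g \<in> carrier (BijGroup E)" if "g \<in> carrier G" for g using bij[OF that] by (simp add: BijGroup_def)
    show "\<phi> (g \<otimes> h) = \<phi> g \<otimes>\<^bsub>BijGroup E\<^esub> \<phi> h" if gh: "g \<in> carrier G" "h \<in> carrier G" for g h
    proof -
      have "\<phi> (g \<otimes> h) = compose E (\<phi> g) (\<phi> h)"
      proof (rule extensionalityI[of _ E])
        show "\<phi> (g \<otimes> h) \<in> extensional E" using ext[of "g \<otimes> h"] gh by (simp add: PiE_def)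
        show "\<phi> (g \<otimes> h) x = compose E (\<phi> g) (\<phi> h) x" if "x \<in> E" for x
          using mult[OF gh that] that by (simp add: compose_def)
      qed (simp add: compose_def)
      then show ?thesis using bij gh by (simp add: BijGroup_def)
    qed
  qed
qed

definition coset_gset :: "('a, 'b) monoid_scheme \<Rightarrow> 'a set \<Rightarrow> 'a orb" where
  "coset_gset G H = ((\<lambda>x. x <#\<^bsub>G\<^esub> H) ` carrier G,
     \<lambda>g. \<lambda>S\<in>(\<lambda>x. x <#\<^bsub>G\<^esub> H) ` carrier G. g <#\<^bsub>G\<^esub> S)"

lemma (in group) coset_gset_in_orb_objects:
  assumes H: "subgroup H G" and F: "\<And>x. x \<in> carrier G \<Longrightarrow> (\<lambda>h. x \<otimes> h \<otimes> inv x) ` H \<in> F"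
  shows "coset_gset G H \<in> orb_objects G F"
proof -
  interpret H: subgroup H G by (rule H)
  define E where "E = (\<lambda>x. x <# H) ` carrier G"
  define \<phi> where "\<phi> g = (\<lambda>S\<in>E. g <# S)" for g
  have X: "coset_gset G H = (E, \<phi>)" unfolding coset_gset_def E_def \<phi>_def[abs_def] by simp
  have \<phi>: "\<phi> g (x <# H) = (g \<otimes> x) <# H" if "g \<in> carrier G" "x \<in> carrier G" for g x
    using that unfolding \<phi>_def E_def by (simp add: lcos_m_assoc H.subset)
  have act: "group_action G E \<phi>"
  proof (rule group_actionI)
    show "group G" by (rule is_group)
    show "\<phi> g \<in> E \<rightarrow>\<^sub>E E" if "g \<in> carrier G" for g
    proof
      show "\<phi> g S \<in> E" if "S \<in> E" for S
        using that \<phi>[OF \<open>g \<in> carrier G\<close>] \<open>g \<in> carrier G\<close> unfolding E_def by auto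
    qed (simp add: \<phi>_def)
    show "\<phi> \<one> S = S" if "S \<in> E" for S using that \<phi>[of \<one>] unfolding E_def by auto
    show "\<phi> (g \<otimes> h) S = \<phi> g (\<phi> h S)" if "g \<in> carrier G" "h \<in> carrier G" "S \<in> E" for g h S
      using that unfolding E_def by (auto simp: \<phi> m_assoc)
  qed
  interpret act: group_action G E \<phi> by (rule act)
  have trans: "transitive_action G E \<phi>"
  proof (intro transitive_action.intro act transitive_action_axioms.intro)
    fix S T assume "S \<in> E" "T \<in> E"
    then obtain x y where xy: "x \<in> carrier G" "y \<in> carrier G" "S = x <# H" "T = y <# H" unfolding E_def by blast
    have "\<phi> (y \<otimes> inv x) S = T" using xy by (simp add: \<phi> m_assoc)
    then show "\<exists>g\<in>carrier G. \<phi> g S = T" using xy by (intro bexI[of _ "y \<otimes> inv x"]) auto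
  qed
  have "stabilizer G \<phi> S \<in> F" if "S \<in> E" for S
  proof -
    from that obtain x where x: "x \<in> carrier G" "S = x <# H" unfolding E_def by (elim imageE)
    have "stabilizer G \<phi> S = (\<lambda>h. x \<otimes> h \<otimes> inv x) ` H"
    proof (intro equalityI subsetI)
      fix g assume "g \<in> stabilizer G \<phi> S"
      then have gS: "g \<in> carrier G" "\<phi> g S = S" unfolding stabilizer_def by simp_all
      then have g: "g \<in> carrier G" "(g \<otimes> x) <# H = x <# H" using \<phi>[OF gS(1) x(1)] x(2) by simp_all
      have "g \<otimes> x \<otimes> \<one> \<in> (g \<otimes> x) <# H" unfolding l_coset_def using H.one_closed by blast
      then have "g \<otimes> x \<otimes> \<one> \<in> x <# H" by (simp only: g(2))
      then obtain h where h: "h \<in> H" "g \<otimes> x \<otimes> \<one> = x \<otimes> h" unfolding l_coset_def by blast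
      have "g = x \<otimes> h \<otimes> inv x" using h g x by (metis H.mem_carrier inv_solve_right m_closed r_one)
      then show "g \<in> (\<lambda>h. x \<otimes> h \<otimes> inv x) ` H" using h by blast
    next
      fix g assume "g \<in> (\<lambda>h. x \<otimes> h \<otimes> inv x) ` H"
      then obtain h where h: "h \<in> H" "g = x \<otimes> h \<otimes> inv x" by blast
      have g: "g \<in> carrier G" "g \<otimes> x = x \<otimes> h" using h x by (auto simp: m_assoc)
      have "\<phi> g S = x <# (h <# H)" using g x h by (simp add: \<phi> lcos_m_assoc H.subset)
      also have "h <# H = H" using h(1) coset_join3 H by auto
      finally show "g \<in> stabilizer G \<phi> S" unfolding stabilizer_def using g x by simp
    qed
    then show ?thesis using F[OF x(1)] by simp
  qed
  then show ?thesis
    unfolding X orb_objects_def gset_over_def using act trans by (auto simp: E_def)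
qed

text \<open>Without a \<open>G\<close>-map from \<open>X\<close> to \<open>W\<close> the group \<open>\<int>[X, W]\<close> is trivial, and so is its summand \<open>M(X)\<close>; but \<open>M(X)\<close>
  maps onto \<open>\<int>\<close>.\<close>
lemma orb_fg_projective_cover_imp_gmaps:
  fixes G :: "('a, 'b) monoid_scheme"
  assumes G: "group G" and fg: "orb_fg_projective G F M"
    and \<epsilon>: "\<epsilon> \<in> orb_epi G F M orb_const_int"
  shows "\<exists>W :: ('a, nat \<times> 'a set) gset. gset_over G F W \<and> finite (orbits G (fst W) (snd W)) \<and>
    (\<forall>X\<in>orb_objects G F. gmaps G X W \<noteq> {})"
proof -
  have M: "is_orb_module G F M" using fg unfolding orb_fg_projective_def orb_projective_def by blast
  obtain W :: "('a, nat \<times> 'a set) gset" where W: "gset_over G F W" "finite (orbits G (fst W) (snd W))"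
    and "orb_summand G F M (orb_free G W)" using fg unfolding orb_fg_projective_def by blast
  then obtain Q :: "('a, ('a set \<Rightarrow> nat \<times> 'a set) \<Rightarrow>\<^sub>0 int) orb_module" and h where Q: "is_orb_module G F Q"
    and h: "\<forall>X\<in>orb_objects G F. h X \<in> iso (Ob (orb_dirsum M Q) X) (Ob (orb_free G W) X)"
    unfolding orb_summand_def orb_isomorphic_def by blast
  have "gmaps G X W \<noteq> {}" if X: "X \<in> orb_objects G F" for X
  proof
    assume "gmaps G X W = {}"
    then have "carrier (Ob (orb_free G W) X) = {0}"
      unfolding orb_free_def free_Abelian_group_def by simp
    moreover have "bij_betw (h X) (carrier (Ob (orb_dirsum M Q) X)) (carrier (Ob (orb_free G W) X))"
      using h X unfolding iso_def by blast
    ultimately have bij: "bij_betw (h X) (carrier (Ob M X) \<times> carrier (Ob Q X)) {0}"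
      unfolding orb_dirsum_def by simp
    have "comm_group (Ob Q X)" using Q X unfolding is_orb_module_def by blast
    then interpret Q: comm_group "Ob Q X" .
    have single: "a = b" if "a \<in> carrier (Ob M X)" "b \<in> carrier (Ob M X)" for a b
    proof -
      have "h X (a, \<one>\<^bsub>Ob Q X\<^esub>) \<in> {0}" "h X (b, \<one>\<^bsub>Ob Q X\<^esub>) \<in> {0}"
        using bij_betwE[OF bij] that by auto
      then have "(a, \<one>\<^bsub>Ob Q X\<^esub>) = (b, \<one>\<^bsub>Ob Q X\<^esub>)"
        using bij_betw_imp_inj_on[OF bij] that by (intro inj_onD[of "h X"]) auto
      then show ?thesis by simp
    qed
    have "\<epsilon> X ` carrier (Ob M X) = UNIV"
      using \<epsilon> X unfolding orb_epi_def orb_const_int_def by simp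
    then obtain a b where "a \<in> carrier (Ob M X)" "\<epsilon> X a = 0" "b \<in> carrier (Ob M X)" "\<epsilon> X b = 1"
      by (metis UNIV_I imageE)
    then show False using single by fastforce
  qed
  then show ?thesis using W by blast
qed

text \<open>The image of the coset \<open>H\<close> under a \<open>G\<close>-map \<open>G/H \<rightarrow> W\<close> is a point fixed by \<open>H\<close>. Its stabilizer is conjugate to
  that of the chosen representative of its orbit.\<close>
lemma gmaps_imp_subconjugate:
  fixes G (structure)
  assumes G: "group G" and W: "gset_over G F W" "finite (orbits G (fst W) (snd W))"
  shows "\<exists>\<S>. finite \<S> \<and> \<S> \<subseteq> F \<and>
    (\<forall>H f g. subgroup H G \<longrightarrow> f \<in> gmaps G (coset_gset G H) W \<longrightarrow> g \<in> H \<longrightarrow>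
       (\<exists>y\<in>carrier G. \<exists>S\<in>\<S>. y \<otimes>\<^bsub>G\<^esub> g \<otimes>\<^bsub>G\<^esub> inv\<^bsub>G\<^esub> y \<in> S))"
proof -
  interpret group G by (rule G)
  obtain E \<psi> where W': "W = (E, \<psi>)" by fastforce
  interpret act: group_action G E \<psi> using W(1) unfolding gset_over_def W' by simp
  have F: "stabilizer G \<psi> x \<in> F" if "x \<in> E" for x using W(1) that unfolding gset_over_def W' by simp
  define rep where "rep U = (SOME x. x \<in> E \<and> U = orbit G \<psi> x)" for U
  have rep: "rep U \<in> E \<and> U = orbit G \<psi> (rep U)" if "U \<in> orbits G E \<psi>" for U
  proof -
    have "\<exists>x. x \<in> E \<and> U = orbit G \<psi> x" using that unfolding orbits_def by blast
    then show ?thesis unfolding rep_def by (rule someI_ex[where P = "\<lambda>x. x \<in> E \<and> U = orbit G \<psi> x"])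
  qed
  define \<S> where "\<S> = (\<lambda>U. stabilizer G \<psi> (rep U)) ` orbits G E \<psi>"
  have "finite \<S>" "\<S> \<subseteq> F" unfolding \<S>_def using W(2) F rep W' by auto
  moreover have "\<exists>y\<in>carrier G. \<exists>S\<in>\<S>. y \<otimes> g \<otimes> inv y \<in> S"
    if H: "subgroup H G" and f: "f \<in> gmaps G (coset_gset G H) W" and g: "g \<in> H" for H f g
  proof -
    have gG: "g \<in> carrier G" using H g subgroup.mem_carrier by metis
    have HE: "H \<in> (\<lambda>x. x <# H) ` carrier G"
      using lcos_mult_one[OF subgroup.subset[OF H]] by (metis image_eqI one_closed)
    have gH: "g <# H = H" using coset_join3[OF gG H g] .
    define w where "w = f H"
    have w: "w \<in> E" using f HE unfolding gmaps_def coset_gset_def W' w_def by auto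
    have "\<forall>g\<in>carrier G. \<forall>x\<in>fst (coset_gset G H). f (snd (coset_gset G H) g x) = snd W g (f x)"
      using f unfolding gmaps_def by blast
    moreover have "H \<in> fst (coset_gset G H)" using HE unfolding coset_gset_def by simp
    ultimately have "f (snd (coset_gset G H) g H) = \<psi> g (f H)" using gG unfolding W' by simp
    then have fixed: "\<psi> g w = w" using HE gH unfolding coset_gset_def w_def by simp
    define U where "U = orbit G \<psi> w"
    have U: "U \<in> orbits G E \<psi>" unfolding U_def orbits_def using w by blast
    have "w \<in> orbit G \<psi> (rep U)" using rep[OF U] act.orbit_refl[OF w] U_def by simp
    then obtain y where y: "y \<in> carrier G" "w = \<psi> y (rep U)" unfolding orbit_def by blast
    have r: "rep U \<in> E" using rep[OF U] by blast
    have ret: "\<psi> (inv y) w = rep U" using act.orbit_sym_aux[OF y(1) r] y(2) by simp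
    have "\<psi> (inv y \<otimes> g \<otimes> y) (rep U) = \<psi> (inv y \<otimes> g) w"
      using act.composition_rule[OF r, of "inv y \<otimes> g" y] y gG by simp
    also have "\<dots> = \<psi> (inv y) (\<psi> g w)"
      using act.composition_rule[OF w, of "inv y" g] y gG by simp
    also have "\<dots> = rep U" by (simp only: fixed ret)
    finally have "\<psi> (inv y \<otimes> g \<otimes> y) (rep U) = rep U" .
    then have "inv y \<otimes> g \<otimes> inv (inv y) \<in> stabilizer G \<psi> (rep U)"
      unfolding stabilizer_def using y gG by simp
    then show ?thesis unfolding \<S>_def using U y by (intro bexI[of _ "inv y"] bexI[of _ "stabilizer G \<psi> (rep U)"]) auto
  qed
  ultimately show ?thesis by blast
qed

lemma cyclic_subgroup_in_vc_family:
  fixes G (structure)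
  assumes G: "group G" and g: "g \<in> carrier G"
  shows "range (\<lambda>n::int. g [^]\<^bsub>G\<^esub> n) \<in> vc_family G"
proof -
  interpret group G by (rule G)
  let ?C = "range (\<lambda>n::int. g [^] n)"
  have C: "subgroup ?C G" "cyclic_group (G\<lparr>carrier := ?C\<rparr>)" using cyclic_groupI[OF G g] .
  interpret C: group "G\<lparr>carrier := ?C\<rparr>" using subgroup_imp_group[OF C(1)] .
  have "rcosets\<^bsub>G\<lparr>carrier := ?C\<rparr>\<^esub> ?C \<subseteq> {?C}"
    using C.coset_join2[OF _ C.subgroup_self] by (auto simp: RCOSETS_def)
  then have "finite (rcosets\<^bsub>G\<lparr>carrier := ?C\<rparr>\<^esub> ?C)" using finite_subset by blast
  then have "virtually_cyclic (G\<lparr>carrier := ?C\<rparr>)"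
    unfolding virtually_cyclic_def using C(2) C.subgroup_self by (intro exI[of _ ?C]) simp
  then show ?thesis unfolding vc_family_def using C(1) by blast
qed

theorem bredon_FP_imp_cyclic_cosets_cover:
  fixes G :: "('a, 'b) monoid_scheme" (structure)
  assumes G: "group G" and FP: "bredon_FP TYPE('m) G (vc_family G) n"
  shows "\<exists>P m. cyclic_cosets_cover G P m"
proof -
  interpret group G by (rule G)
  obtain M :: "nat \<Rightarrow> ('a, ('a, 'm) univ) orb_module" and d \<epsilon> where
    M: "\<forall>i\<le>n. orb_fg_projective G (vc_family G) (M i)" and res: "orb_resolution G (vc_family G) M d \<epsilon>"
    using FP unfolding bredon_FP_def by blast
  have "orb_fg_projective G (vc_family G) (M 0)" using M by simp
  moreover have "\<epsilon> \<in> orb_epi G (vc_family G) (M 0) orb_const_int"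
    using res unfolding orb_resolution_def by blast
  ultimately obtain W :: "('a, nat \<times> 'a set) gset" where W: "gset_over G (vc_family G) W"
    "finite (orbits G (fst W) (snd W))"
    and ne: "\<And>X. X \<in> orb_objects G (vc_family G) \<Longrightarrow> gmaps G X W \<noteq> {}"
    using orb_fg_projective_cover_imp_gmaps[OF G] by blast
  obtain \<S> where S: "finite \<S>" "\<S> \<subseteq> vc_family G"
    and cov: "\<And>H f g. subgroup H G \<Longrightarrow> f \<in> gmaps G (coset_gset G H) W \<Longrightarrow> g \<in> H \<Longrightarrow>
       \<exists>y\<in>carrier G. \<exists>S\<in>\<S>. y \<otimes> g \<otimes> inv y \<in> S"
    using gmaps_imp_subconjugate[OF G W] by blast
  show ?thesis
  proof (rule cyclic_cosets_cover_of_finite_vc_family[OF G S])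
    fix g assume g: "g \<in> carrier G"
    define C where "C = range (\<lambda>n::int. g [^] n)"
    have C: "subgroup C G" unfolding C_def using cyclic_groupI(1)[OF G g] .
    have "coset_gset G C \<in> orb_objects G (vc_family G)"
    proof (rule coset_gset_in_orb_objects[OF C])
      fix x assume x: "x \<in> carrier G"
      have "x \<otimes> g [^] (k::int) \<otimes> inv x = (x \<otimes> g \<otimes> inv x) [^] k" for k
        using conj_by_int_pow[OF x g, of k] unfolding conj_by_def .
      then have "(\<lambda>h. x \<otimes> h \<otimes> inv x) ` C = range (\<lambda>n::int. (x \<otimes> g \<otimes> inv x) [^] n)"
        unfolding C_def by (simp add: image_image)
      then show "(\<lambda>h. x \<otimes> h \<otimes> inv x) ` C \<in> vc_family G"
        using cyclic_subgroup_in_vc_family[OF G] x g by simp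
    qed
    then obtain f where "f \<in> gmaps G (coset_gset G C) W" using ne by blast
    moreover have "g \<in> C" unfolding C_def using g by (metis int_pow_1 rangeI)
    ultimately show "\<exists>y\<in>carrier G. \<exists>S\<in>\<S>. y \<otimes> g \<otimes> inv y \<in> S" using cov C by blast
  qed
qed

section \<open>Solubility\<close>

lemma (in comm_group) comm_group_imp_solvable: "solvable G"
proof -
  have "(derived G ^^ 1) (carrier G) = {\<one>}" using derived_eq_singleton by simp
  then show ?thesis using solvable_iff_trivial_derived_seq by blast
qed

lemma polycyclic_imp_solvable:
  fixes G (structure)
  assumes G: "group G" and poly: "polycyclic G"
  shows "solvable G"
proof -
  interpret group G by (rule G)
  obtain H n where H0: "H 0 = {\<one>}" and Hn: "H n = carrier G"
    and H: "\<And>i. i < n \<Longrightarrow> subgroup (H (Suc i)) G \<and> H i \<lhd> G\<lparr>carrier := H (Suc i)\<rparr> \<and>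
               cyclic_group (G\<lparr>carrier := H (Suc i)\<rparr> Mod H i)"
    using poly unfolding polycyclic_def by blast
  have "solvable_seq G (H i)" if "i \<le> n" for i
    using that
  proof (induction i)
    case 0
    show ?case unfolding H0 by (rule solvable_seq.unity)
  next
    case (Suc i)
    have i: "i < n" using Suc by simp
    have "group (G\<lparr>carrier := H (Suc i)\<rparr> Mod H i)" using H[OF i] normal.factorgroup_is_group by blast
    then have "comm_group (G\<lparr>carrier := H (Suc i)\<rparr> Mod H i)"
      using H[OF i] group.cyclic_imp_abelian_group by blast
    then show ?case using solvable_seq.extension[of G "H i" "H (Suc i)"] Suc H[OF i] by simp
  qed
  then show ?thesis unfolding solvable_def using Hn by (metis order_refl)
qed

lemma abelian_by_polycyclic_imp_solvable:
  fixes G (structure)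
  assumes G: "group G" and abp: "abelian_by_polycyclic G"
  shows "solvable G"
proof -
  interpret group G by (rule G)
  obtain A where A: "A \<lhd> G" "comm_group (G\<lparr>carrier := A\<rparr>)" "polycyclic (G Mod A)"
    using abp unfolding abelian_by_polycyclic_def by blast
  interpret A: normal A G by (rule A(1))
  have Q: "group (G Mod A)" by (rule A.factorgroup_is_group)
  show ?thesis
  proof (rule solvable_condition)
    show "group_hom (G\<lparr>carrier := A\<rparr>) G (\<lambda>x. x)"
      using A.subset by (intro group_hom.intro group_hom_axioms.intro subgroup_imp_group A.subgroup_axioms is_group)
        (auto simp: hom_def)
    show "group_hom G (G Mod A) (\<lambda>x. A #> x)"
      by (intro group_hom.intro group_hom_axioms.intro is_group Q A.r_coset_hom_Mod)
    show "(\<lambda>x. A #> x) ` carrier G = carrier (G Mod A)" by (simp add: carrier_FactGroup)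
    show "kernel G (G Mod A) (\<lambda>x. A #> x) \<subseteq> (\<lambda>x. x) ` carrier (G\<lparr>carrier := A\<rparr>)"
      unfolding kernel_def using coset_join1[OF _ _ A.subgroup_axioms] by auto
    show "solvable (G\<lparr>carrier := A\<rparr>)" by (rule comm_group.comm_group_imp_solvable[OF A(2)])
    show "solvable (G Mod A)" by (rule polycyclic_imp_solvable[OF Q A(3)])
  qed
qed

theorem corollary5p5:
  fixes G :: "('a, 'b) monoid_scheme"
  assumes "group G"
    and "abelian_by_polycyclic G"
    and "bredon_FP TYPE('m) G (vc_family G) 3"
    and "\<And>g. g \<in> carrier G \<Longrightarrow> group.ord G g = 0 \<Longrightarrow>
           fin_gen_group (G\<lparr>carrier := centralizer G g\<rparr>)"
  shows "virtually_cyclic G"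
proof -
  obtain P m where "cyclic_cosets_cover G P m"
    using bredon_FP_imp_cyclic_cosets_cover[OF assms(1,3)] by blast
  then have "virtually_cyclic_over G {\<one>\<^bsub>G\<^esub>}"
    using group.solvable_imp_virtually_cyclic_over_one[OF assms(1)]
      abelian_by_polycyclic_imp_solvable[OF assms(1,2)] by blast
  then show ?thesis by (rule virtually_cyclic_over_one_imp_virtually_cyclic[OF assms(1)])
qed

end
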